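(* Let a time-invariant memory device be given by a unitary channel $\mathcal{U}:\mathcal{S}(\mathcal{M}\otimes\mathcal{H})\to\mathcal{S}(\mathcal{H}\otimes\mathcal{M})$ (with $\mathcal{H}$ the system and $\mathcal{M}$ the memory Hilbert space) and an unknown initial memory state $\xi\in\mathcal{S}(\mathcal{M})$, and let quantum process tomography be implemented on it with randomly chosen settings $x=(\varrho_x,M_x)$, the setting $x$ being selected in each run independently with probability $q_x$. Let $\overline{\xi}\in\mathcal{S}(\mathcal{M})$ be the average state of the memory (for a large number of runs). Then $\overline{\xi}$ is a fixed point of the channel $$\mathcal{C}(\eta)=\mathrm{tr}_{\mathcal{H}}\big[\mathcal{U}(\eta\otimes\overline{\varrho})\big]$$ on the memory, where $\overline{\varrho}=\sum_x q_x\varrho_x$ is the average test state; i.e. $\mathcal{C}(\overline{\xi})=\overline{\xi}$.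
   Context: $\mathcal{S}(\mathcal{K})$ is the set of density operators on a Hilbert space $\mathcal{K}$. A measurement $M$ is a POVM, i.e. positive operators (effects) $E_1,\dots,E_m$ with $\sum_j E_j=I$. A unitary channel is a map $\mathcal{U}(\omega)=U\omega U^\dagger$ with $U$ unitary. Experiment: the memory starts in $\xi_1=\xi$, is never reset and is experimentally inaccessible; the same $\mathcal{U}$ acts in every run. In each run a setting $x=(\varrho_x,M_x)$ is drawn with probability $q_x$, the test state $\varrho_x\in\mathcal{S}(\mathcal{H})$ interacts with the memory via $\mathcal{U}$, and the output system is measured with $M_x=\{E_{xk}\}_k$. If the memory state before the run is $\eta$, then with $\mathcal{I}_{xk}[\eta]=\mathrm{tr}_{\mathcal{H}}[\mathcal{U}(\eta\otimes\varrho_x)(E_{xk}\otimes I_{\mathcal{M}})]$ the event $(\varrho_x,E_{xk})$ has probability $q_x\,\mathrm{tr}(\mathcal{I}_{xk}[\eta])$ and the memory state after it is $\mathcal{I}_{xk}[\eta]/\mathrm{tr}(\mathcal{I}_{xk}[\eta])$. This produces the sequence of memory states $\xi_1\mapsto\xi_2\mapsto\cdots\mapsto\xi_n$, with $\xi_j$ the state before the $j$-th run. The average state $\overline{\xi}$ is the average of the memory states $\xi_1,\dots,\xi_n$ occurring in the experiment for large $n$. It is the same for every setting $x$ (averaging only over runs in which $x$ was used gives the same state), and it is the state for which the relative frequency of the outcome $E_{xk}$ among runs with setting $x$ tends, as $n\to\infty$, to $\mathrm{tr}[\mathcal{U}(\overline{\xi}\otimes\varrho_x)(E_{xk}\otimes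 I_{\mathcal{M}})]$. *)

theory Defs
  imports "HOL-Probability.Probability"
begin

text \<open>
  A Hilbert space of arbitrary (possibly infinite) dimension is taken in the form
  $\ell^2(I)$, where the basis labels \<open>I\<close> are the elements of a type; the tensor product of
  $\ell^2(I)$ and $\ell^2(J)$ is $\ell^2(I \times J)$.  An operator \<open>A\<close> is represented by its matrix
  elements \<open>A i j = \<langle>e\<^sub>i, A e\<^sub>j\<rangle>\<close>.  In every use below the matrices belong to bounded operators, and
  all traces and partial traces are taken of trace class operators, so that all the infinite sums
  converge absolutely.
\<close>

type_synonym ('a, 'b) opmat = "'a \<Rightarrow> 'b \<Rightarrow> complex"

definition op_id :: "('a, 'a) opmat" where
  "op_id i j = (if i = j then 1 else 0)"

definition op_adj :: "('a, 'b) opmat \<Rightarrow> ('b, 'a) opmat" where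
  "op_adj A i j = cnj (A j i)"

definition op_mult :: "('a, 'b) opmat \<Rightarrow> ('b, 'c) opmat \<Rightarrow> ('a, 'c) opmat"  (infixl "\<odot>" 70) where
  "(A \<odot> B) i j = (\<Sum>\<^sub>\<infinity>k. A i k * B k j)"

definition op_tensor :: "('a, 'b) opmat \<Rightarrow> ('c, 'd) opmat \<Rightarrow> ('a \<times> 'c, 'b \<times> 'd) opmat"
    (infixr "\<otimes>\<^sub>o" 75) where
  "(A \<otimes>\<^sub>o B) i j = A (fst i) (fst j) * B (snd i) (snd j)"

definition op_trace :: "('a, 'a) opmat \<Rightarrow> complex" where
  "op_trace A = (\<Sum>\<^sub>\<infinity>i. A i i)"

text \<open>Partial trace over the first tensor factor.\<close>

definition ptrace_fst :: "('h \<times> 'm, 'h \<times> 'm) opmat \<Rightarrow> ('m, 'm) opmat" where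
  "ptrace_fst A i j = (\<Sum>\<^sub>\<infinity>h. A (h, i) (h, j))"

text \<open>
  Positivity is tested on the dense subspace of finitely supported vectors.  Over the complex
  numbers it entails self-adjointness.
\<close>

definition positive_op :: "('a, 'a) opmat \<Rightarrow> bool" where
  "positive_op A \<longleftrightarrow>
     (\<forall>F v. finite F \<longrightarrow> (\<Sum>i\<in>F. \<Sum>j\<in>F. cnj (v i) * A i j * v j) \<in> \<real>\<^sub>\<ge>\<^sub>0)"

text \<open>
  A sum \<open>\<Sum>\<^sub>\<infinity>\<close> that does not converge has the value 0, so \<open>op_trace \<rho> = 1\<close> includes
  that the trace converges; a positive matrix with convergent trace is the matrix of a trace
  class operator.
\<close>

definition density_op :: "('a, 'a) opmat \<Rightarrow> bool" where
  "density_op \<rho> \<longleftrightarrow> positive_op \<rho> \<and> op_trace \<rho> = 1"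

text \<open>
  Likewise the diagonal entries of the two equations include that the rows and columns of \<open>U\<close>
  are square summable.
\<close>

definition unitary_op :: "('a, 'b) opmat \<Rightarrow> bool" where
  "unitary_op U \<longleftrightarrow> op_adj U \<odot> U = op_id \<and> U \<odot> op_adj U = op_id"

text \<open>Here \<open>K\<close> is the set of outcomes.  The effects satisfy \<open>0 \<le> E k \<le> I\<close>, hence are bounded.\<close>

definition povm :: "'k set \<Rightarrow> ('k \<Rightarrow> ('a, 'a) opmat) \<Rightarrow> bool" where
  "povm K E \<longleftrightarrow> finite K \<and> (\<forall>k\<in>K. positive_op (E k)) \<and>
     (\<forall>i j. (\<Sum>k\<in>K. E k i j) = op_id i j)"

definition unitary_channel :: "('a, 'b) opmat \<Rightarrow> ('b, 'b) opmat \<Rightarrow> ('a, 'a) opmat" where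
  "unitary_channel U \<omega> = U \<odot> \<omega> \<odot> op_adj U"

text \<open>
  The unnormalised memory state after a run with test state \<open>\<rho>\<close> in which the effect \<open>E\<close> was
  observed, if the memory state before the run was \<open>\<eta>\<close>.
\<close>

definition instrument ::
    "('h \<times> 'm, 'm \<times> 'h) opmat \<Rightarrow> ('h, 'h) opmat \<Rightarrow> ('h, 'h) opmat \<Rightarrow> ('m, 'm) opmat \<Rightarrow> ('m, 'm) opmat"
  where
  "instrument U \<rho> E \<eta> = ptrace_fst (unitary_channel U (\<eta> \<otimes>\<^sub>o \<rho>) \<odot> (E \<otimes>\<^sub>o op_id))"

text \<open>
  The memory states along a record \<open>y\<close> of settings and outcomes.  Runs are counted from 0:
  \<open>memory_state U \<rho> E \<xi> y n\<close> is the state before run \<open>n\<close> and depends on \<open>y 0, \<dots>, y (n - 1)\<close> only.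
\<close>

primrec memory_state ::
    "('h \<times> 'm, 'm \<times> 'h) opmat \<Rightarrow> ('x \<Rightarrow> ('h, 'h) opmat) \<Rightarrow> ('x \<Rightarrow> 'k \<Rightarrow> ('h, 'h) opmat) \<Rightarrow>
     ('m, 'm) opmat \<Rightarrow> (nat \<Rightarrow> 'x \<times> 'k) \<Rightarrow> nat \<Rightarrow> ('m, 'm) opmat"
  where
    "memory_state U \<rho> E \<xi> y 0 = \<xi>"
  | "memory_state U \<rho> E \<xi> y (Suc n) =
       (let (x, k) = y n; \<eta> = instrument U (\<rho> x) (E x k) (memory_state U \<rho> E \<xi> y n)
        in (\<lambda>i j. \<eta> i j / op_trace \<eta>))"

text \<open>
  \<open>Y n\<close> is the random pair of the setting and the outcome of run \<open>n\<close>.  The last clause says that,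
  given the record of the previous runs, the pair \<open>(x, k)\<close> occurs with probability
  \<open>q\<^sub>x tr(\<I>\<^sub>x\<^sub>k[\<eta>])\<close>, where \<open>\<eta>\<close> is the memory state resulting from that record.  As the
  effects of each setting sum up to the identity, this makes the settings independent and
  distributed according to \<open>q\<close>.
\<close>

definition memory_experiment ::
    "'w measure \<Rightarrow> (nat \<Rightarrow> 'w \<Rightarrow> 'x \<times> 'k) \<Rightarrow> ('h \<times> 'm, 'm \<times> 'h) opmat \<Rightarrow> ('m, 'm) opmat \<Rightarrow>
     'x pmf \<Rightarrow> ('x \<Rightarrow> ('h, 'h) opmat) \<Rightarrow> ('x \<Rightarrow> 'k set) \<Rightarrow> ('x \<Rightarrow> 'k \<Rightarrow> ('h, 'h) opmat) \<Rightarrow> bool"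
  where
  "memory_experiment P Y U \<xi> q \<rho> K E \<longleftrightarrow>
     prob_space P \<and>
     (\<forall>n. Y n \<in> measurable P (count_space UNIV)) \<and>
     (\<forall>n y x k. y n = (x, k) \<longrightarrow> k \<in> K x \<longrightarrow>
        measure P {\<omega> \<in> space P. \<forall>j<Suc n. Y j \<omega> = y j} =
        measure P {\<omega> \<in> space P. \<forall>j<n. Y j \<omega> = y j} *
          (pmf q x * Re (op_trace (instrument U (\<rho> x) (E x k) (memory_state U \<rho> E \<xi> y n)))))"

text \<open>
  The limit is taken in the weak operator topology; for a sequence of density operators with a
  density operator as limit this coincides with convergence in trace norm.
\<close>

definition is_average_state :: "(nat \<Rightarrow> ('m, 'm) opmat) \<Rightarrow> ('m, 'm) opmat \<Rightarrow> bool" where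
  "is_average_state s \<sigma> \<longleftrightarrow> density_op \<sigma> \<and>
     (\<forall>i j. (\<lambda>n. (\<Sum>l<n. s l i j) / of_nat n) \<longlonglongrightarrow> \<sigma> i j)"

definition average_test_state :: "'x pmf \<Rightarrow> ('x \<Rightarrow> ('h, 'h) opmat) \<Rightarrow> ('h, 'h) opmat" where
  "average_test_state q \<rho> i j = (\<Sum>\<^sub>\<infinity>x. of_real (pmf q x) * \<rho> x i j)"

definition memory_channel ::
    "('h \<times> 'm, 'm \<times> 'h) opmat \<Rightarrow> ('h, 'h) opmat \<Rightarrow> ('m, 'm) opmat \<Rightarrow> ('m, 'm) opmat" where
  "memory_channel U \<rho> \<eta> = ptrace_fst (unitary_channel U (\<eta> \<otimes>\<^sub>o \<rho>))"

end

theory Submission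
  imports Defs
begin

text \<open>
  Given the record of the first runs, the expectation of the next memory state is
  \<open>\<Sum>\<^sub>x q\<^sub>x \<Sum>\<^sub>k \<I>\<^sub>x\<^sub>k[\<eta>] = \<C>(\<eta>)\<close>, since the probability of an outcome cancels the normalisation of the
  state after it.  So for every matrix entry the differences between the next state and the image
  under \<open>\<C>\<close> of the present one form a bounded martingale difference sequence, and their averages tend
  to 0 almost surely.  The averages of \<open>\<xi>\<^sub>j\<close> and of \<open>\<xi>\<^sub>j\<^sub>+\<^sub>1\<close> have the same limit, and \<open>\<C>\<close> is
  continuous with respect to the convergence of density operators, so the limit is a fixed point.

  The operator theory rests on writing a density operator as \<open>A A\<^sup>\<dagger>\<close> with a Hilbert-Schmidt matrix
  \<open>A\<close>: all rearrangements of iterated sums then take place in products of square-summable functions.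
\<close>

section \<open>Square-summable functions\<close>

text \<open>Products of infinite matrices cannot be reassociated freely here: every entry is an
  unordered sum, with value 0 if it diverges. The column index of a factor \<open>A\<close> acts as
  a purifying system; tracing out \<open>\<H>\<close>, or averaging the test states, then merely
  regroups column indices, and each rearrangement becomes a statement about inner products of
  vectors. Entrywise convergence by itself would not give continuity of the channel, since trace
  might escape to infinity. The limit is required to have trace 1, so a finite block carrying nearly
  all of its trace also carries nearly all of the trace of the averages. The error of cutting down
  to the block is a square root of the missing trace; it is replaced by a bound linear in that
  trace, because only a linear bound can be averaged over the runs. No conditional expectation
  operator is formed. Almost every record is a list over a countable alphabet, and the law of large
  numbers used needs bounded, pairwise orthogonal increments only. That nothing outside the alphabet
  occurs is not part of the hypotheses: it follows because the prescribed probabilities already add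
  up to 1.\<close>

definition sqsum :: "('a \<Rightarrow> complex) \<Rightarrow> bool" where
  "sqsum f \<longleftrightarrow> (\<lambda>x. (cmod (f x))\<^sup>2) summable_on UNIV"

text \<open>The square of the norm: it is additive over rows, columns and slices, which keeps square
  roots out of all estimates except Cauchy-Schwarz.\<close>

definition nrm2 :: "('a \<Rightarrow> complex) \<Rightarrow> real" where
  "nrm2 f = (\<Sum>\<^sub>\<infinity>x. (cmod (f x))\<^sup>2)"

text \<open>Antilinear in the second argument, so that the inner products of the rows of
  \<open>A\<close> are the entries of \<open>A\<close> times its adjoint.\<close>

definition l2_inner :: "('a \<Rightarrow> complex) \<Rightarrow> ('a \<Rightarrow> complex) \<Rightarrow> complex" where
  "l2_inner f g = (\<Sum>\<^sub>\<infinity>x. f x * cnj (g x))"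

lemma has_sum_finite_sum:
  fixes f :: "'i \<Rightarrow> 'a \<Rightarrow> 'b::topological_comm_monoid_add"
  assumes "finite F" "\<And>c. c \<in> F \<Longrightarrow> (f c has_sum s c) A"
  shows "((\<lambda>p. \<Sum>c\<in>F. f c p) has_sum (\<Sum>c\<in>F. s c)) A"
  using assms by (induction F rule: finite_induct) (auto intro!: has_sum_add)

lemma nrm2_nonneg: "0 \<le> nrm2 f"
  unfolding nrm2_def by (rule infsum_nonneg) auto

lemma sqsum_nrm2: "sqsum f \<Longrightarrow> ((\<lambda>x. (cmod (f x))\<^sup>2) has_sum nrm2 f) UNIV"
  unfolding sqsum_def nrm2_def by simp

lemma sqsum_bound:
  assumes "\<And>F. finite F \<Longrightarrow> (\<Sum>x\<in>F. (cmod (f x))\<^sup>2) \<le> c"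
  shows "sqsum f" "nrm2 f \<le> c"
proof -
  show "sqsum f"
    unfolding sqsum_def
    by (rule nonneg_bdd_above_summable_on) (auto intro!: bdd_aboveI2[where M=c] assms)
  then show "nrm2 f \<le> c"
    unfolding sqsum_def nrm2_def by (rule infsum_le_finite_sums) (use assms in auto)
qed

lemma sum_le_nrm2: "sqsum f \<Longrightarrow> finite F \<Longrightarrow> (\<Sum>x\<in>F. (cmod (f x))\<^sup>2) \<le> nrm2 f"
  unfolding sqsum_def nrm2_def by (rule finite_sum_le_infsum) auto

lemma sqsum_le:
  assumes "sqsum g" "\<And>x. cmod (f x) \<le> cmod (g x)"
  shows "sqsum f" "nrm2 f \<le> nrm2 g"
proof -
  have "(\<Sum>x\<in>F. (cmod (f x))\<^sup>2) \<le> nrm2 g" if "finite F" for F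
    using sum_le_nrm2[OF assms(1) that]
    by (rule order_trans[rotated]) (intro sum_mono power_mono assms norm_ge_zero)
  from sqsum_bound[OF this] show "sqsum f" "nrm2 f \<le> nrm2 g" by auto
qed

lemma sqsum_mult':
  assumes "sqsum f" "sqsum g" shows "(\<lambda>x. f x * g x) summable_on UNIV"
proof -
  have "(\<lambda>x. norm (f x * g x)) summable_on UNIV"
    by (rule Infinite_Sum.abs_summable_product)
       (use assms in \<open>simp_all add: sqsum_def norm_mult power2_eq_square\<close>)
  then show ?thesis by (rule abs_summable_summable)
qed

lemma sqsum_cnj: "sqsum (\<lambda>x. cnj (f x)) \<longleftrightarrow> sqsum f"
  by (simp add: sqsum_def)

lemma sqsum_mult:
  "sqsum f \<Longrightarrow> sqsum g \<Longrightarrow> (\<lambda>x. f x * cnj (g x)) summable_on UNIV"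
  by (rule sqsum_mult') (simp_all add: sqsum_cnj)

lemma l2_inner_has_sum:
  "sqsum f \<Longrightarrow> sqsum g \<Longrightarrow> ((\<lambda>x. f x * cnj (g x)) has_sum l2_inner f g) UNIV"
  unfolding l2_inner_def by (rule has_sum_infsum) (rule sqsum_mult)

lemma l2_inner_self:
  assumes "sqsum f" shows "l2_inner f f = of_real (nrm2 f)"
proof -
  have "((\<lambda>x. f x * cnj (f x)) has_sum of_real (nrm2 f)) UNIV"
    using has_sum_of_real[OF sqsum_nrm2[OF assms]]
    by (simp add: complex_norm_square[symmetric] del: of_real_power)
  then show ?thesis using l2_inner_has_sum[OF assms assms] has_sum_unique by blast
qed

text \<open>Young's inequality for the cross term. It stands in for the triangle inequality when
  working with squared norms: for small \<open>e\<close> the weight of \<open>a\<close> is close to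
  1.\<close>

lemma weighted_square_le:
  fixes a b :: complex
  assumes "e > 0"
  shows "(cmod (a + b))\<^sup>2 \<le> (1 + e) * (cmod a)\<^sup>2 + (1 + 1 / e) * (cmod b)\<^sup>2"
proof -
  have "(cmod (a + b))\<^sup>2 \<le> (cmod a + cmod b)\<^sup>2"
    by (intro power_mono norm_triangle_ineq norm_ge_zero)
  also have "\<dots> \<le> (1 + e) * (cmod a)\<^sup>2 + (1 + 1 / e) * (cmod b)\<^sup>2"
  proof -
    have "0 \<le> (e * cmod a - cmod b)\<^sup>2 / e" using assms by simp
    also have "\<dots> = e * (cmod a)\<^sup>2 - 2 * cmod a * cmod b + (cmod b)\<^sup>2 / e"
      using assms by (simp add: power2_eq_square field_simps)
    finally show ?thesis by (simp add: power2_eq_square algebra_simps)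
  qed
  finally show ?thesis .
qed

lemma sqsum_add:
  assumes "sqsum f" "sqsum g"
  shows "sqsum (\<lambda>x. f x + g x)"
    and "e > 0 \<Longrightarrow> nrm2 (\<lambda>x. f x + g x) \<le> (1 + e) * nrm2 f + (1 + 1 / e) * nrm2 g"
proof -
  have *: "(\<Sum>x\<in>F. (cmod (f x + g x))\<^sup>2) \<le> (1 + e) * nrm2 f + (1 + 1 / e) * nrm2 g"
    if "finite F" "e > 0" for F e
  proof -
    have "(\<Sum>x\<in>F. (cmod (f x + g x))\<^sup>2) \<le>
        (\<Sum>x\<in>F. (1 + e) * (cmod (f x))\<^sup>2 + (1 + 1 / e) * (cmod (g x))\<^sup>2)"
      by (intro sum_mono weighted_square_le that)
    also have "\<dots> = (1 + e) * (\<Sum>x\<in>F. (cmod (f x))\<^sup>2) + (1 + 1 / e) * (\<Sum>x\<in>F. (cmod (g x))\<^sup>2)"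
      by (simp add: sum.distrib sum_distrib_left)
    also have "\<dots> \<le> (1 + e) * nrm2 f + (1 + 1 / e) * nrm2 g"
      using that assms by (intro add_mono mult_left_mono sum_le_nrm2) auto
    finally show ?thesis .
  qed
  from sqsum_bound(1)[OF *[of _ 1]] show "sqsum (\<lambda>x. f x + g x)" by simp
  show "nrm2 (\<lambda>x. f x + g x) \<le> (1 + e) * nrm2 f + (1 + 1 / e) * nrm2 g" if "e > 0"
    by (rule sqsum_bound(2)[OF *[OF _ that]])
qed

lemma sqsum_cmult: "sqsum f \<Longrightarrow> sqsum (\<lambda>x. c * f x)"
  unfolding sqsum_def norm_mult power_mult_distrib by (rule summable_on_cmult_right)

lemma sqsum_zero: "sqsum (\<lambda>_. 0)"
  by (simp add: sqsum_def)

lemma sqsum_sum: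
  "finite F \<Longrightarrow> (\<And>c. c \<in> F \<Longrightarrow> sqsum (f c)) \<Longrightarrow> sqsum (\<lambda>x. \<Sum>c\<in>F. f c x)"
  by (induction F rule: finite_induct) (auto intro!: sqsum_add sqsum_zero)

lemma sqsum_diff: "sqsum f \<Longrightarrow> sqsum g \<Longrightarrow> sqsum (\<lambda>x. f x - g x)"
  using sqsum_add(1)[of f "\<lambda>x. (-1) * g x"] sqsum_cmult[of g "-1"] by simp

lemma sqsum_finite_support: "finite F \<Longrightarrow> (\<And>x. x \<notin> F \<Longrightarrow> f x = 0) \<Longrightarrow> sqsum f"
  unfolding sqsum_def by (rule finite_nonzero_values_imp_summable_on, rule finite_subset[of _ F]) auto

lemma l2_inner_sum_left:
  assumes "finite F" "\<And>c. c \<in> F \<Longrightarrow> sqsum (f c)" "sqsum g"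
  shows "l2_inner (\<lambda>x. \<Sum>c\<in>F. f c x) g = (\<Sum>c\<in>F. l2_inner (f c) g)"
  using has_sum_finite_sum[OF assms(1) l2_inner_has_sum[OF assms(2) assms(3)]]
  unfolding l2_inner_def by (simp add: infsumI sum_distrib_right)

lemma l2_inner_cnj: "cnj (l2_inner f g) = l2_inner g f"
  unfolding l2_inner_def infsum_cnj[symmetric] by (simp add: mult.commute)

lemma l2_inner_sum_right:
  assumes "finite F" "\<And>c. c \<in> F \<Longrightarrow> sqsum (f c)" "sqsum g"
  shows "l2_inner g (\<lambda>x. \<Sum>c\<in>F. f c x) = (\<Sum>c\<in>F. l2_inner g (f c))"
  using arg_cong[where f=cnj, OF l2_inner_sum_left[OF assms]] by (simp add: l2_inner_cnj)

lemma l2_inner_cmult_left: "l2_inner (\<lambda>x. c * f x) g = c * l2_inner f g"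
  unfolding l2_inner_def by (simp add: infsum_cmult_right'[symmetric] mult.assoc)

lemma l2_inner_cmult_right: "l2_inner f (\<lambda>x. c * g x) = cnj c * l2_inner f g"
  unfolding l2_inner_def by (simp add: infsum_cmult_right'[symmetric] mult_ac)

lemma l2_inner_add_left:
  assumes "sqsum f" "sqsum f'" "sqsum g"
  shows "l2_inner (\<lambda>x. f x + f' x) g = l2_inner f g + l2_inner f' g"
  using has_sum_add[OF l2_inner_has_sum[OF assms(1,3)] l2_inner_has_sum[OF assms(2,3)]]
  unfolding l2_inner_def by (simp add: infsumI distrib_right)

lemma l2_inner_diff_left:
  assumes "sqsum f" "sqsum f'" "sqsum g"
  shows "l2_inner (\<lambda>x. f x - f' x) g = l2_inner f g - l2_inner f' g"
  using l2_inner_add_left[OF assms(1) sqsum_cmult[OF assms(2), of "-1"] assms(3)]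
    l2_inner_cmult_left[of "-1" f' g] by simp

lemma l2_inner_diff_right:
  assumes "sqsum f" "sqsum f'" "sqsum g"
  shows "l2_inner g (\<lambda>x. f x - f' x) = l2_inner g f - l2_inner g f'"
  using arg_cong[where f=cnj, OF l2_inner_diff_left[OF assms]] by (simp add: l2_inner_cnj)

lemma l2_cauchy_schwarz:
  assumes "sqsum f" "sqsum g"
  shows "cmod (l2_inner f g) \<le> sqrt (nrm2 f) * sqrt (nrm2 g)"
proof -
  have "cmod (\<Sum>x\<in>F. f x * cnj (g x)) \<le> sqrt (nrm2 f) * sqrt (nrm2 g)" if "finite F" for F
  proof -
    have "cmod (\<Sum>x\<in>F. f x * cnj (g x)) \<le> (\<Sum>x\<in>F. \<bar>cmod (f x)\<bar> * \<bar>cmod (g x)\<bar>)"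
      using norm_sum[of "\<lambda>x. f x * cnj (g x)" F] by (simp add: norm_mult)
    also have "\<dots> \<le> L2_set (\<lambda>x. cmod (f x)) F * L2_set (\<lambda>x. cmod (g x)) F"
      by (rule L2_set_mult_ineq)
    also have "\<dots> \<le> sqrt (nrm2 f) * sqrt (nrm2 g)"
      unfolding L2_set_def
      by (intro mult_mono real_sqrt_le_mono sum_le_nrm2 assms that) (auto intro!: sum_nonneg nrm2_nonneg)
    finally show ?thesis .
  qed
  then have "eventually (\<lambda>F. cmod (\<Sum>x\<in>F. f x * cnj (g x)) \<le> sqrt (nrm2 f) * sqrt (nrm2 g))
      (finite_subsets_at_top UNIV)"
    by (auto simp: eventually_finite_subsets_at_top)
  moreover have "((\<lambda>F. cmod (\<Sum>x\<in>F. f x * cnj (g x))) \<longlongrightarrow> cmod (l2_inner f g))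
      (finite_subsets_at_top UNIV)"
    using l2_inner_has_sum[OF assms] unfolding has_sum_def by (rule tendsto_norm)
  ultimately show ?thesis
    by (intro tendsto_upperbound) auto
qed

section \<open>Approximation by finitely supported vectors\<close>

definition trunc :: "'a set \<Rightarrow> ('a \<Rightarrow> complex) \<Rightarrow> 'a \<Rightarrow> complex" where
  "trunc F v x = (if x \<in> F then v x else 0)"

lemma sqsum_trunc: "sqsum v \<Longrightarrow> sqsum (trunc F v)"
  by (rule sqsum_le(1)[of v]) (auto simp: trunc_def)

lemma nrm2_trunc_finite:
  assumes "finite F" shows "nrm2 (trunc F v) = (\<Sum>x\<in>F. (cmod (v x))\<^sup>2)"
  unfolding nrm2_def
  by (rule infsumI, rule has_sum_finite_neutralI[of F]) (auto simp: trunc_def assms)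

lemma nrm2_minus_trunc:
  assumes "sqsum v" "finite F"
  shows "nrm2 (\<lambda>x. v x - trunc F v x) = nrm2 v - (\<Sum>x\<in>F. (cmod (v x))\<^sup>2)"
proof -
  have "((\<lambda>x. (cmod (trunc F v x))\<^sup>2) has_sum nrm2 (trunc F v)) UNIV"
    by (intro sqsum_nrm2 sqsum_trunc assms)
  then have "((\<lambda>x. - (cmod (trunc F v x))\<^sup>2) has_sum - nrm2 (trunc F v)) UNIV"
    by (simp add: has_sum_uminus)
  from has_sum_add[OF sqsum_nrm2[OF assms(1)] this]
  have "((\<lambda>x. (cmod (v x))\<^sup>2 - (cmod (trunc F v x))\<^sup>2) has_sum nrm2 v - nrm2 (trunc F v)) UNIV"
    by simp
  moreover have "(\<lambda>x. (cmod (v x))\<^sup>2 - (cmod (trunc F v x))\<^sup>2) = (\<lambda>x. (cmod (v x - trunc F v x))\<^sup>2)"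
    by (auto simp: trunc_def)
  ultimately show ?thesis
    using infsumI unfolding nrm2_trunc_finite[OF assms(2), symmetric] by (simp add: nrm2_def infsumI)
qed

lemma nrm2_minus_trunc_tendsto:
  assumes "sqsum v"
  shows "((\<lambda>F. nrm2 (\<lambda>x. v x - trunc F v x)) \<longlongrightarrow> 0) (finite_subsets_at_top UNIV)"
proof -
  have "((\<lambda>F. nrm2 v - (\<Sum>x\<in>F. (cmod (v x))\<^sup>2)) \<longlongrightarrow> nrm2 v - nrm2 v) (finite_subsets_at_top UNIV)"
    using sqsum_nrm2[OF assms] unfolding has_sum_def by (intro tendsto_intros)
  moreover have "eventually (\<lambda>F. nrm2 v - (\<Sum>x\<in>F. (cmod (v x))\<^sup>2) = nrm2 (\<lambda>x. v x - trunc F v x))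
      (finite_subsets_at_top UNIV)"
    by (rule eventually_mono[OF eventually_finite_subsets_at_top_weakI[of UNIV finite]])
       (auto simp: nrm2_minus_trunc[OF assms])
  ultimately show ?thesis
    by (simp add: tendsto_cong)
qed

section \<open>Contractions and isometries\<close>

definition mat_app :: "('a, 'b) opmat \<Rightarrow> ('b \<Rightarrow> complex) \<Rightarrow> 'a \<Rightarrow> complex" where
  "mat_app A v i = (\<Sum>\<^sub>\<infinity>j. A i j * v j)"

lemma op_mult_eq_mat_app: "(A \<odot> B) i k = mat_app A (\<lambda>j. B j k) i"
  by (simp add: op_mult_def mat_app_def)

text \<open>Only finite sections occur, so the notion makes sense before any row is known to be
  square summable.\<close>

definition contraction :: "('a, 'b) opmat \<Rightarrow> bool" where
  "contraction A \<longleftrightarrow> (\<forall>F G y. finite F \<longrightarrow> finite G \<longrightarrow>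
     (\<Sum>i\<in>G. (cmod (\<Sum>j\<in>F. A i j * y j))\<^sup>2) \<le> (\<Sum>j\<in>F. (cmod (y j))\<^sup>2))"

text \<open>Feeding in the conjugated row, with the single output index \<open>i\<close>, gives
  \<open>s\<^sup>2 \<le> s\<close> for each partial sum \<open>s\<close> of squares, hence
  \<open>s \<le> 1\<close>.\<close>

lemma contraction_row:
  assumes "contraction A" shows "sqsum (A i)"
proof -
  have "(\<Sum>j\<in>F. (cmod (A i j))\<^sup>2) \<le> 1" if "finite F" for F
  proof -
    let ?s = "\<Sum>j\<in>F. (cmod (A i j))\<^sup>2"
    have "(\<Sum>l\<in>{i}. (cmod (\<Sum>j\<in>F. A l j * cnj (A i j)))\<^sup>2) \<le> (\<Sum>j\<in>F. (cmod (cnj (A i j)))\<^sup>2)"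
      using assms[unfolded contraction_def, rule_format, OF that finite.insertI[OF finite.emptyI],
          of "\<lambda>j. cnj (A i j)" i] .
    moreover have "(\<Sum>j\<in>F. A i j * cnj (A i j)) = of_real ?s"
      by (simp add: complex_norm_square del: of_real_power)
    ultimately have "?s\<^sup>2 \<le> ?s" by (simp del: of_real_sum)
    moreover have "0 \<le> ?s" by (simp add: sum_nonneg)
    ultimately show ?thesis by (cases "?s = 0") (simp_all add: power2_eq_square)
  qed
  then show ?thesis by (rule sqsum_bound(1))
qed

lemma mat_app_has_sum:
  assumes "contraction A" "sqsum v"
  shows "((\<lambda>j. A i j * v j) has_sum mat_app A v i) UNIV"
  unfolding mat_app_def
  by (rule has_sum_infsum) (rule sqsum_mult'[OF contraction_row[OF assms(1)] assms(2)])

text \<open>For fixed \<open>G\<close> the bound on finite sections passes to the limit in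
  \<open>F\<close>; the bounds for all \<open>G\<close> then control the whole norm.\<close>

lemma contraction_mat_app:
  assumes "contraction A" "sqsum v"
  shows "sqsum (mat_app A v)" "nrm2 (mat_app A v) \<le> nrm2 v"
proof -
  have "(\<Sum>i\<in>G. (cmod (mat_app A v i))\<^sup>2) \<le> nrm2 v" if G: "finite G" for G
  proof (rule tendsto_upperbound)
    show "((\<lambda>F. \<Sum>i\<in>G. (cmod (\<Sum>j\<in>F. A i j * v j))\<^sup>2) \<longlongrightarrow> (\<Sum>i\<in>G. (cmod (mat_app A v i))\<^sup>2))
        (finite_subsets_at_top UNIV)"
      using mat_app_has_sum[OF assms] unfolding has_sum_def by (intro tendsto_intros) auto
    show "\<forall>\<^sub>F F in finite_subsets_at_top UNIV.
        (\<Sum>i\<in>G. (cmod (\<Sum>j\<in>F. A i j * v j))\<^sup>2) \<le> nrm2 v"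
    proof (rule eventually_finite_subsets_at_top_weakI)
      fix F :: "'b set" assume F: "finite F"
      have "(\<Sum>i\<in>G. (cmod (\<Sum>j\<in>F. A i j * v j))\<^sup>2) \<le> (\<Sum>j\<in>F. (cmod (v j))\<^sup>2)"
        using assms(1) F G unfolding contraction_def by blast
      also have "\<dots> \<le> nrm2 v" by (rule sum_le_nrm2[OF assms(2) F])
      finally show "(\<Sum>i\<in>G. (cmod (\<Sum>j\<in>F. A i j * v j))\<^sup>2) \<le> nrm2 v" .
    qed
  qed auto
  from sqsum_bound[OF this] show "sqsum (mat_app A v)" "nrm2 (mat_app A v) \<le> nrm2 v" by auto
qed

lemma mat_app_add:
  assumes "contraction A" "sqsum v" "sqsum w"
  shows "mat_app A (\<lambda>x. v x + w x) i = mat_app A v i + mat_app A w i"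
  using has_sum_add[OF mat_app_has_sum[OF assms(1,2)] mat_app_has_sum[OF assms(1,3)]]
  unfolding mat_app_def by (simp add: infsumI distrib_left)

lemma mat_app_diff:
  assumes "contraction A" "sqsum v" "sqsum w"
  shows "mat_app A (\<lambda>x. v x - w x) i = mat_app A v i - mat_app A w i"
  using mat_app_add[OF assms(1) sqsum_diff[OF assms(2,3)] assms(3), of i] by simp

lemma mat_app_sum:
  assumes "contraction A" "finite F" "\<And>c. c \<in> F \<Longrightarrow> sqsum (f c)"
  shows "mat_app A (\<lambda>x. \<Sum>c\<in>F. a c * f c x) i = (\<Sum>c\<in>F. a c * mat_app A (f c) i)"
proof -
  have "((\<lambda>j. \<Sum>c\<in>F. a c * (A i j * f c j)) has_sum (\<Sum>c\<in>F. a c * mat_app A (f c) i)) UNIV"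
    by (intro has_sum_finite_sum has_sum_cmult_right mat_app_has_sum assms)
  then have "((\<lambda>j. A i j * (\<Sum>c\<in>F. a c * f c j)) has_sum (\<Sum>c\<in>F. a c * mat_app A (f c) i)) UNIV"
    by (simp add: sum_distrib_left mult_ac)
  then show ?thesis unfolding mat_app_def by (rule infsumI)
qed

lemma mat_app_trunc:
  assumes "finite F" shows "mat_app A (trunc F v) i = (\<Sum>j\<in>F. A i j * v j)"
  unfolding mat_app_def
  by (rule infsumI, rule has_sum_finite_neutralI[of F]) (auto simp: trunc_def assms)

section \<open>Unitary matrices preserve norms\<close>

lemma unitary_col:
  assumes "unitary_op U"
  shows "sqsum (\<lambda>p. U p c)"
    and "((\<lambda>p. cnj (U p c) * U p d) has_sum (if c = d then 1 else 0)) UNIV"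
proof -
  have *: "(\<Sum>\<^sub>\<infinity>p. cnj (U p c) * U p d) = (if c = d then 1 else 0)" for c d
    using fun_cong[OF fun_cong[OF conjunct1[OF assms[unfolded unitary_op_def]], of c], of d]
    by (simp add: op_mult_def op_adj_def op_id_def)
  \<comment> \<open>A divergent sum would have the value 0, whereas the diagonal entry of the
    identity is 1.\<close>
  have "(\<lambda>p. cnj (U p c) * U p c) summable_on UNIV" for c
    using *[of c c] infsum_not_exists by fastforce
  then have "(\<lambda>p. cmod (cnj (U p c) * U p c)) summable_on UNIV" for c
    by (rule summable_on_iff_abs_summable_on_complex[THEN iffD1])
  then have sq: "sqsum (\<lambda>p. U p c)" for c
    by (simp add: sqsum_def norm_mult power2_eq_square)
  then show "sqsum (\<lambda>p. U p c)" .
  show "((\<lambda>p. cnj (U p c) * U p d) has_sum (if c = d then 1 else 0)) UNIV"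
    unfolding *[of c d, symmetric]
    by (intro has_sum_infsum sqsum_mult' sq sqsum_cnj[THEN iffD2])
qed

lemma unitary_mat_app_trunc:
  assumes "unitary_op U" "finite F"
  shows "((\<lambda>p. (cmod (\<Sum>c\<in>F. U p c * y c))\<^sup>2) has_sum (\<Sum>c\<in>F. (cmod (y c))\<^sup>2)) UNIV"
proof -
  have "((\<lambda>p. \<Sum>c\<in>F. \<Sum>d\<in>F. cnj (y c) * y d * (cnj (U p c) * U p d)) has_sum
      (\<Sum>c\<in>F. \<Sum>d\<in>F. cnj (y c) * y d * (if c = d then 1 else 0))) UNIV"
    by (intro has_sum_finite_sum has_sum_cmult_right unitary_col assms)
  moreover have "(\<Sum>c\<in>F. \<Sum>d\<in>F. cnj (y c) * y d * (cnj (U p c) * U p d)) =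
      of_real ((cmod (\<Sum>c\<in>F. U p c * y c))\<^sup>2)" for p
    by (simp only: complex_norm_square, simp add: sum_product mult_ac) (rule sum.swap)
  moreover have "(\<Sum>c\<in>F. \<Sum>d\<in>F. cnj (y c) * y d * (if c = d then 1 else 0)) =
      of_real (\<Sum>c\<in>F. (cmod (y c))\<^sup>2)"
    using assms(2)
    by (simp add: complex_norm_square mult.commute if_distrib del: of_real_power cong: if_cong)
  ultimately show ?thesis by (simp only: has_sum_of_real_iff)
qed

lemma unitary_contraction:
  assumes "unitary_op U" shows "contraction U"
  unfolding contraction_def
proof (intro allI impI)
  fix F :: "'b set" and G :: "'a set" and y :: "'b \<Rightarrow> complex"
  assume "finite F" "finite G"
  show "(\<Sum>i\<in>G. (cmod (\<Sum>j\<in>F. U i j * y j))\<^sup>2) \<le> (\<Sum>j\<in>F. (cmod (y j))\<^sup>2)"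
    by (rule finite_sum_le_has_sum[OF unitary_mat_app_trunc[OF assms \<open>finite F\<close>] \<open>finite G\<close>]) auto
qed

text \<open>
  Contractivity gives one inequality; the other one holds with equality on the dense set of
  finitely supported vectors and extends by continuity.
\<close>

lemma unitary_isometry:
  assumes "unitary_op U" "sqsum v"
  shows "nrm2 (mat_app U v) = nrm2 v"
proof (rule antisym)
  note con = unitary_contraction[OF assms(1)]
  show "nrm2 (mat_app U v) \<le> nrm2 v" by (rule contraction_mat_app[OF con assms(2)])
  have *: "nrm2 v \<le> (1 + e) * nrm2 (mat_app U v)" if e: "e > 0" for e
  proof (rule tendsto_upperbound)
    \<comment> \<open>The tail of \<open>v\<close> is lost twice: once with weight 1 in passing from
      \<open>v\<close> to its truncation, and once with weight \<open>1 + 1 / e\<close> in comparing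
      the two images under \<open>U\<close>.\<close>
    show "((\<lambda>F. nrm2 v - (2 + 1 / e) * nrm2 (\<lambda>x. v x - trunc F v x)) \<longlongrightarrow> nrm2 v)
        (finite_subsets_at_top UNIV)"
      using tendsto_diff[OF tendsto_const tendsto_mult[OF tendsto_const nrm2_minus_trunc_tendsto[OF assms(2)]]]
      by (rule tendsto_eq_rhs) simp
    show "\<forall>\<^sub>F F in finite_subsets_at_top UNIV.
        nrm2 v - (2 + 1 / e) * nrm2 (\<lambda>x. v x - trunc F v x) \<le> (1 + e) * nrm2 (mat_app U v)"
    proof (rule eventually_finite_subsets_at_top_weakI)
      fix F :: "'b set" assume F: "finite F"
      let ?r = "\<lambda>x. trunc F v x - v x"
      note r = sqsum_diff[OF sqsum_trunc[OF assms(2)] assms(2)]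
      have "nrm2 (mat_app U (trunc F v)) = nrm2 (trunc F v)"
        using infsumI[OF unitary_mat_app_trunc[OF assms(1) F, of v]]
        by (simp add: nrm2_def[of "mat_app U _"] mat_app_trunc[OF F] nrm2_trunc_finite[OF F])
      moreover have "mat_app U (trunc F v) = (\<lambda>i. mat_app U v i + mat_app U ?r i)"
        by (rule ext) (simp add: mat_app_diff[OF con sqsum_trunc[OF assms(2)] assms(2)])
      ultimately have "nrm2 (trunc F v) \<le> (1 + e) * nrm2 (mat_app U v) + (1 + 1 / e) * nrm2 (mat_app U ?r)"
        using sqsum_add(2)[OF contraction_mat_app(1)[OF con assms(2)] contraction_mat_app(1)[OF con r] e]
        by metis
      moreover have "nrm2 (mat_app U ?r) \<le> nrm2 ?r"
        by (rule contraction_mat_app[OF con r])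
      then have "(1 + 1 / e) * nrm2 (mat_app U ?r) \<le> (1 + 1 / e) * nrm2 ?r"
        using e by (intro mult_left_mono) auto
      moreover have "nrm2 ?r = nrm2 (\<lambda>x. v x - trunc F v x)"
        by (simp add: nrm2_def norm_minus_commute)
      moreover have "nrm2 v = nrm2 (trunc F v) + nrm2 (\<lambda>x. v x - trunc F v x)"
        by (simp add: nrm2_minus_trunc[OF assms(2) F] nrm2_trunc_finite[OF F])
      ultimately show "nrm2 v - (2 + 1 / e) * nrm2 (\<lambda>x. v x - trunc F v x) \<le> (1 + e) * nrm2 (mat_app U v)"
        by (simp add: algebra_simps)
    qed
  qed auto
  show "nrm2 v \<le> nrm2 (mat_app U v)"
  proof (rule field_le_epsilon)
    fix d :: real assume "d > 0"
    \<comment> \<open>Chosen so that \<open>e\<close> times the norm is at most \<open>d\<close>;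
      adding 1 keeps the denominator positive.\<close>
    define e where "e = d / (nrm2 (mat_app U v) + 1)"
    have "e > 0" using \<open>d > 0\<close> nrm2_nonneg[of "mat_app U v"] by (simp add: e_def)
    have "nrm2 v \<le> nrm2 (mat_app U v) + e * nrm2 (mat_app U v)"
      using *[OF \<open>e > 0\<close>] by (simp add: algebra_simps)
    also have "e * nrm2 (mat_app U v) \<le> d"
      using \<open>d > 0\<close> nrm2_nonneg[of "mat_app U v"] by (simp add: e_def field_simps)
    finally show "nrm2 v \<le> nrm2 (mat_app U v) + d" by simp
  qed
qed

section \<open>Positive operators and effects\<close>

lemma has_sum_nonneg_Reals:
  fixes f :: "'a \<Rightarrow> complex"
  assumes "(f has_sum s) A" "\<And>x. x \<in> A \<Longrightarrow> f x \<in> \<real>\<^sub>\<ge>\<^sub>0"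
  shows "s \<in> \<real>\<^sub>\<ge>\<^sub>0"
proof (rule Lim_in_closed_set[OF closed_nonneg_Reals_complex])
  show "(sum f \<longlongrightarrow> s) (finite_subsets_at_top A)"
    using assms(1) by (simp add: has_sum_def)
  show "\<forall>\<^sub>F F in finite_subsets_at_top A. sum f F \<in> \<real>\<^sub>\<ge>\<^sub>0"
    by (rule eventually_finite_subsets_at_top_weakI)
       (use assms(2) in \<open>auto intro!: sum_in_Reals simp: complex_nonneg_Reals_iff subset_iff sum_nonneg\<close>)
qed simp

lemma positive_opD:
  "positive_op A \<Longrightarrow> finite F \<Longrightarrow> (\<Sum>i\<in>F. \<Sum>j\<in>F. cnj (v i) * A i j * v j) \<in> \<real>\<^sub>\<ge>\<^sub>0"
  by (simp add: positive_op_def)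

lemma positive_op_diag: "positive_op A \<Longrightarrow> A i i \<in> \<real>\<^sub>\<ge>\<^sub>0"
  using positive_opD[of A "{i}" "\<lambda>_. 1"] by simp

text \<open>The form of the compressed matrix at \<open>v\<close> is the form of \<open>A\<close> at
  the combination of the vectors \<open>u a\<close> with coefficients \<open>v a\<close>. It is
  applied both to a pair of vectors and to the elimination vectors of a Schur complement.\<close>

lemma positive_op_compress:
  assumes "positive_op A" "finite F"
  shows "positive_op (\<lambda>a b. \<Sum>i\<in>F. \<Sum>j\<in>F. cnj (u a i) * A i j * u b j)"
  unfolding positive_op_def
proof (intro allI impI)
  fix G :: "'b set" and v :: "'b \<Rightarrow> complex" assume G: "finite G"
  let ?w = "\<lambda>i. \<Sum>a\<in>G. v a * u a i"
  have "(\<Sum>a\<in>G. \<Sum>b\<in>G. cnj (v a) * (\<Sum>i\<in>F. \<Sum>j\<in>F. cnj (u a i) * A i j * u b j) * v b) =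
      (\<Sum>a\<in>G. \<Sum>b\<in>G. \<Sum>i\<in>F. \<Sum>j\<in>F. cnj (v a) * cnj (u a i) * A i j * u b j * v b)"
    by (simp add: sum_distrib_left sum_distrib_right mult_ac)
  also have "\<dots> = (\<Sum>a\<in>G. \<Sum>i\<in>F. \<Sum>b\<in>G. \<Sum>j\<in>F. cnj (v a) * cnj (u a i) * A i j * u b j * v b)"
    by (intro sum.cong refl sum.swap)
  also have "\<dots> = (\<Sum>i\<in>F. \<Sum>a\<in>G. \<Sum>j\<in>F. \<Sum>b\<in>G. cnj (v a) * cnj (u a i) * A i j * u b j * v b)"
    by (subst sum.swap) (intro sum.cong refl sum.swap)
  also have "\<dots> = (\<Sum>i\<in>F. \<Sum>j\<in>F. \<Sum>a\<in>G. \<Sum>b\<in>G. cnj (v a) * cnj (u a i) * A i j * u b j * v b)"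
    by (intro sum.cong refl sum.swap)
  also have "\<dots> = (\<Sum>i\<in>F. \<Sum>j\<in>F. cnj (?w i) * A i j * ?w j)"
    by (simp add: sum_distrib_left sum_distrib_right mult_ac)
  also have "\<dots> \<in> \<real>\<^sub>\<ge>\<^sub>0" by (rule positive_opD[OF assms])
  finally show "(\<Sum>a\<in>G. \<Sum>b\<in>G. cnj (v a) * (\<Sum>i\<in>F. \<Sum>j\<in>F. cnj (u a i) * A i j * u b j) * v b) \<in> \<real>\<^sub>\<ge>\<^sub>0" .
qed

lemma positive_op_two:
  assumes "positive_op A" "i \<noteq> j"
  shows "cnj x * A i i * x + cnj x * A i j * y + (cnj y * A j i * x + cnj y * A j j * y) \<in> \<real>\<^sub>\<ge>\<^sub>0"
  using positive_opD[OF assms(1), of "{i, j}" "\<lambda>l. if l = i then x else y"] assms(2) by simp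

text \<open>Testing with (1, 1) makes the imaginary parts of \<open>A i j\<close> and
  \<open>A j i\<close> opposite; testing with (1, \<i>) makes their real parts equal.\<close>

lemma positive_op_hermitian:
  assumes "positive_op A" shows "A i j = cnj (A j i)"
proof (cases "i = j")
  case True
  then show ?thesis
    using positive_op_diag[OF assms, of i] by (simp add: complex_nonneg_Reals_iff complex_eq_iff)
next
  case False
  show ?thesis
    using positive_op_two[OF assms False, of 1 1] positive_op_two[OF assms False, of 1 \<i>]
      positive_op_diag[OF assms, of i] positive_op_diag[OF assms, of j]
    by (simp add: complex_nonneg_Reals_iff complex_eq_iff)
qed

text \<open>The form is tested at the vector (t b, -1) with \<open>b = A i j\<close>. The optimal
  choice is t = 1/a; if \<open>a = 0\<close>, the form is affine in t with slope
  \<open>- 2 * (cmod b)\<^sup>2\<close>, so a large t would make it negative unless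
  \<open>b = 0\<close>.\<close>

lemma positive_op_entry_le:
  assumes "positive_op A" shows "(cmod (A i j))\<^sup>2 \<le> Re (A i i) * Re (A j j)"
proof -
  define a d b where "a = Re (A i i)" and "d = Re (A j j)" and "b = A i j"
  have aa: "A i i = of_real a" "A j j = of_real d" "0 \<le> a" "0 \<le> d"
    using positive_op_diag[OF assms, of i] positive_op_diag[OF assms, of j]
    by (auto simp: complex_nonneg_Reals_iff complex_eq_iff a_def d_def)
  show ?thesis
  proof (cases "i = j")
    case True
    then show ?thesis using aa by (simp add: power2_eq_square)
  next
    case False
    have *: "0 \<le> t\<^sup>2 * (cmod b)\<^sup>2 * a - 2 * t * (cmod b)\<^sup>2 + d" for t :: real
    proof -
      have ji: "A j i = cnj b" unfolding b_def by (rule positive_op_hermitian[OF assms])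
      have "cnj (of_real t * b) * A i i * (of_real t * b) + cnj (of_real t * b) * A i j * (-1)
          + (cnj (-1) * A j i * (of_real t * b) + cnj (-1) * A j j * (-1))
          = of_real (t\<^sup>2) * (b * cnj b) * of_real a - of_real (2 * t) * (b * cnj b) + of_real d"
        unfolding ji aa b_def[symmetric] by (simp add: power2_eq_square)
      also have "\<dots> = of_real (t\<^sup>2 * (cmod b)\<^sup>2 * a - 2 * t * (cmod b)\<^sup>2 + d)"
        unfolding complex_norm_square[symmetric] by simp
      finally have "cnj (of_real t * b) * A i i * (of_real t * b) + cnj (of_real t * b) * A i j * (-1)
          + (cnj (-1) * A j i * (of_real t * b) + cnj (-1) * A j j * (-1))
          = of_real (t\<^sup>2 * (cmod b)\<^sup>2 * a - 2 * t * (cmod b)\<^sup>2 + d)" .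
      then show ?thesis
        using positive_op_two[OF assms False, of "of_real t * b" "-1"]
        by (metis nonneg_Reals_of_real_iff)
    qed
    show ?thesis
    proof (cases "a = 0")
      case True
      have "(cmod b)\<^sup>2 = 0"
      proof (rule ccontr)
        assume "(cmod b)\<^sup>2 \<noteq> 0"
        then show False using *[of "(d + 1) / (cmod b)\<^sup>2"] True aa(4) by simp
      qed
      then show ?thesis using True by (simp add: b_def[symmetric] a_def[symmetric])
    next
      case False
      with aa have "a > 0" by simp
      have "0 \<le> (1 / a)\<^sup>2 * (cmod b)\<^sup>2 * a - 2 * (1 / a) * (cmod b)\<^sup>2 + d" by (rule *)
      also have "\<dots> = d - (cmod b)\<^sup>2 / a" using \<open>a > 0\<close> by (simp add: field_simps power2_eq_square)
      finally show ?thesis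
        using \<open>a > 0\<close> by (simp add: a_def[symmetric] d_def[symmetric] b_def[symmetric] field_simps)
    qed
  qed
qed

definition effect :: "('a, 'a) opmat \<Rightarrow> bool" where
  "effect E \<longleftrightarrow> positive_op E \<and> positive_op (\<lambda>i j. op_id i j - E i j)"

lemma effect_form_le:
  assumes "effect E" "finite F"
  shows "Re (\<Sum>i\<in>F. \<Sum>j\<in>F. cnj (v i) * E i j * v j) \<le> (\<Sum>i\<in>F. (cmod (v i))\<^sup>2)"
proof -
  have "(\<Sum>i\<in>F. \<Sum>j\<in>F. cnj (v i) * op_id i j * v j) = (\<Sum>i\<in>F. cnj (v i) * v i)"
  proof (rule sum.cong[OF refl])
    fix i assume "i \<in> F"
    have "(\<Sum>j\<in>F. cnj (v i) * op_id i j * v j) = (\<Sum>j\<in>F. if i = j then cnj (v i) * v j else 0)"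
      by (intro sum.cong) (auto simp: op_id_def)
    then show "(\<Sum>j\<in>F. cnj (v i) * op_id i j * v j) = cnj (v i) * v i"
      using assms(2) \<open>i \<in> F\<close> by simp
  qed
  also have "\<dots> = of_real (\<Sum>i\<in>F. (cmod (v i))\<^sup>2)"
    by (simp add: complex_norm_square mult.commute del: of_real_power)
  finally have "(\<Sum>i\<in>F. \<Sum>j\<in>F. cnj (v i) * (op_id i j - E i j) * v j) =
      of_real (\<Sum>i\<in>F. (cmod (v i))\<^sup>2) - (\<Sum>i\<in>F. \<Sum>j\<in>F. cnj (v i) * E i j * v j)"
    by (simp add: algebra_simps sum_subtractf)
  moreover have "(\<Sum>i\<in>F. \<Sum>j\<in>F. cnj (v i) * (op_id i j - E i j) * v j) \<in> \<real>\<^sub>\<ge>\<^sub>0"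
    using assms(1) unfolding effect_def by (intro positive_opD assms(2)) simp
  ultimately show ?thesis by (simp add: complex_nonneg_Reals_iff)
qed

text \<open>Vectors with different supports are extended by zero to one index set, on which their
  common compression can be formed.\<close>

lemma sum_restrict_square:
  assumes "finite H" "F \<subseteq> H" "G \<subseteq> H"
  shows "(\<Sum>i\<in>H. \<Sum>j\<in>H. cnj (if i \<in> G then x i else 0) * A i j * (if j \<in> F then y j else 0)) =
    (\<Sum>i\<in>G. \<Sum>j\<in>F. cnj (x i) * A i j * (y j :: complex))"
proof -
  have "(\<Sum>i\<in>G. \<Sum>j\<in>F. cnj (x i) * A i j * y j) =
      (\<Sum>i\<in>H. \<Sum>j\<in>F. cnj (if i \<in> G then x i else 0) * A i j * y j)"
    by (rule sum.mono_neutral_cong_left) (use assms in auto)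
  also have "\<dots> = (\<Sum>i\<in>H. \<Sum>j\<in>H. cnj (if i \<in> G then x i else 0) * A i j * (if j \<in> F then y j else 0))"
    by (rule sum.cong[OF refl], rule sum.mono_neutral_cong_left) (use assms in auto)
  finally show ?thesis by simp
qed

text \<open>
  Cauchy-Schwarz for the form of \<open>E\<close>, applied to \<open>E y\<close> and \<open>y\<close>, is the \<open>2 \<times> 2\<close> case of positivity.
\<close>

lemma effect_contraction:
  assumes "effect E" shows "contraction E"
  unfolding contraction_def
proof (intro allI impI)
  fix F G :: "'a set" and y :: "'a \<Rightarrow> complex"
  assume F: "finite F" and G: "finite G"
  define x where "x i = (\<Sum>j\<in>F. E i j * y j)" for i
  let ?S = "\<Sum>i\<in>G. (cmod (x i))\<^sup>2" and ?H = "F \<union> G"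
  \<comment> \<open>The type \<open>bool\<close> indexes the two vectors, so that \<open>M\<close>
    is their 2 by 2 compression: \<open>True\<close> stands for \<open>E y\<close> cut down to
    \<open>G\<close>, \<open>False\<close> for \<open>y\<close> on \<open>F\<close>.\<close>
  define u where "u b = (if b then (\<lambda>i. if i \<in> G then x i else 0) else (\<lambda>i. if i \<in> F then y i else 0))"
    for b
  define M where "M a b = (\<Sum>i\<in>?H. \<Sum>j\<in>?H. cnj (u a i) * E i j * u b j)" for a b
  have H: "finite ?H" using F G by simp
  have "positive_op M"
    unfolding M_def using assms by (intro positive_op_compress H) (simp add: effect_def)
  \<comment> \<open>The off-diagonal entry is \<open>?S\<close> itself, and \<open>E \<le> I\<close>
    bounds the diagonal entries by \<open>?S\<close> and by the squared norm of \<open>y\<close>;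
    one factor \<open>?S\<close> then cancels.\<close>
  then have "(cmod (M True False))\<^sup>2 \<le> Re (M True True) * Re (M False False)"
    by (rule positive_op_entry_le)
  also have "\<dots> \<le> ?S * (\<Sum>j\<in>F. (cmod (y j))\<^sup>2)"
  proof (intro mult_mono)
    have "M True True = (\<Sum>i\<in>G. \<Sum>j\<in>G. cnj (x i) * E i j * x j)"
      unfolding M_def u_def by (simp only: if_True, rule sum_restrict_square[OF H]) auto
    then show "Re (M True True) \<le> ?S" using effect_form_le[OF assms G, of x] by simp
    have "M False False = (\<Sum>i\<in>F. \<Sum>j\<in>F. cnj (y i) * E i j * y j)"
      unfolding M_def u_def by (simp only: if_False, rule sum_restrict_square[OF H]) auto
    then show "Re (M False False) \<le> (\<Sum>j\<in>F. (cmod (y j))\<^sup>2)" using effect_form_le[OF assms F, of y] by simp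
    show "0 \<le> Re (M False False)"
      using positive_op_diag[OF \<open>positive_op M\<close>] by (simp add: complex_nonneg_Reals_iff)
  qed (simp add: sum_nonneg)
  also have "M True False = (\<Sum>i\<in>G. \<Sum>j\<in>F. cnj (x i) * E i j * y j)"
    unfolding M_def u_def by (simp only: if_True if_False, rule sum_restrict_square[OF H]) auto
  also have "\<dots> = (\<Sum>i\<in>G. cnj (x i) * x i)"
    unfolding x_def by (simp add: sum_distrib_left mult.assoc)
  also have "\<dots> = of_real ?S"
    by (simp add: complex_norm_square mult.commute del: of_real_power)
  finally have "?S\<^sup>2 \<le> ?S * (\<Sum>j\<in>F. (cmod (y j))\<^sup>2)" by (simp del: of_real_sum)
  moreover have "0 \<le> ?S" "0 \<le> (\<Sum>j\<in>F. (cmod (y j))\<^sup>2)" by (simp_all add: sum_nonneg)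
  ultimately have "?S \<le> (\<Sum>j\<in>F. (cmod (y j))\<^sup>2)"
    by (cases "?S = 0") (simp_all add: power2_eq_square)
  then show "(\<Sum>i\<in>G. (cmod (\<Sum>j\<in>F. E i j * y j))\<^sup>2) \<le> (\<Sum>j\<in>F. (cmod (y j))\<^sup>2)"
    by (simp add: x_def)
qed

text \<open>Changing one argument at a time leaves two inner products, each containing a
  difference.\<close>

lemma l2_inner_diff_bound:
  assumes "sqsum f" "sqsum g" "sqsum f'" "sqsum g'"
  shows "cmod (l2_inner f g - l2_inner f' g') \<le>
    sqrt (nrm2 f) * sqrt (nrm2 (\<lambda>x. g x - g' x)) + sqrt (nrm2 (\<lambda>x. f x - f' x)) * sqrt (nrm2 g')"
proof -
  have "l2_inner f g - l2_inner f' g' = l2_inner f (\<lambda>x. g x - g' x) + l2_inner (\<lambda>x. f x - f' x) g'"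
    by (simp add: l2_inner_diff_right l2_inner_diff_left assms)
  then show ?thesis
    by (simp only:) (intro norm_triangle_le add_mono l2_cauchy_schwarz sqsum_diff assms)
qed

text \<open>Positivity is given for finitely supported vectors only. Truncations of \<open>v\<close>
  converge in norm, \<open>E\<close> is a contraction, and the nonnegative reals are closed.\<close>

lemma effect_inner_nonneg:
  assumes "effect E" "sqsum v"
  shows "l2_inner v (mat_app E v) \<in> \<real>\<^sub>\<ge>\<^sub>0"
proof (rule Lim_in_closed_set[OF closed_nonneg_Reals_complex])
  note con = effect_contraction[OF assms(1)]
  let ?r = "\<lambda>F x. v x - trunc F v x"
  show "((\<lambda>F. l2_inner (trunc F v) (mat_app E (trunc F v))) \<longlongrightarrow> l2_inner v (mat_app E v))
      (finite_subsets_at_top UNIV)"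
  proof (rule Lim_null[THEN iffD2], rule Lim_null_comparison)
    show "\<forall>\<^sub>F F in finite_subsets_at_top UNIV.
        norm (l2_inner (trunc F v) (mat_app E (trunc F v)) - l2_inner v (mat_app E v)) \<le>
        2 * sqrt (nrm2 v) * sqrt (nrm2 (?r F))"
    proof (rule always_eventually, rule allI)
      fix F :: "'a set"
      note t = sqsum_trunc[OF assms(2), of F]
      have tv: "nrm2 (trunc F v) \<le> nrm2 v"
        by (rule sqsum_le(2)[OF assms(2)]) (simp add: trunc_def)
      have "norm (l2_inner v (mat_app E v) - l2_inner (trunc F v) (mat_app E (trunc F v))) \<le>
          sqrt (nrm2 v) * sqrt (nrm2 (\<lambda>x. mat_app E v x - mat_app E (trunc F v) x)) +
          sqrt (nrm2 (?r F)) * sqrt (nrm2 (mat_app E (trunc F v)))"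
        by (intro l2_inner_diff_bound contraction_mat_app[OF con] t assms)
      also have "(\<lambda>x. mat_app E v x - mat_app E (trunc F v) x) = mat_app E (?r F)"
        by (rule ext) (simp add: mat_app_diff[OF con assms(2) t])
      also have "sqrt (nrm2 v) * sqrt (nrm2 (mat_app E (?r F))) +
          sqrt (nrm2 (?r F)) * sqrt (nrm2 (mat_app E (trunc F v))) \<le>
          sqrt (nrm2 v) * sqrt (nrm2 (?r F)) + sqrt (nrm2 (?r F)) * sqrt (nrm2 v)"
        using contraction_mat_app(2)[OF con t] contraction_mat_app(2)[OF con sqsum_diff[OF assms(2) t]] tv
        by (intro add_mono mult_left_mono real_sqrt_le_mono) (auto simp: nrm2_nonneg)
      finally show "norm (l2_inner (trunc F v) (mat_app E (trunc F v)) - l2_inner v (mat_app E v)) \<le>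
          2 * sqrt (nrm2 v) * sqrt (nrm2 (?r F))"
        by (simp add: norm_minus_commute mult.commute)
    qed
    show "((\<lambda>F. 2 * sqrt (nrm2 v) * sqrt (nrm2 (?r F))) \<longlongrightarrow> 0) (finite_subsets_at_top UNIV)"
      using tendsto_mult[OF tendsto_const[of "2 * sqrt (nrm2 v)"]
          tendsto_real_sqrt[OF nrm2_minus_trunc_tendsto[OF assms(2)]]] by simp
  qed
  show "\<forall>\<^sub>F F in finite_subsets_at_top UNIV. l2_inner (trunc F v) (mat_app E (trunc F v)) \<in> \<real>\<^sub>\<ge>\<^sub>0"
  proof (rule eventually_finite_subsets_at_top_weakI)
    fix F :: "'a set" assume F: "finite F"
    have "l2_inner (trunc F v) (mat_app E (trunc F v)) = (\<Sum>i\<in>F. v i * cnj (\<Sum>j\<in>F. E i j * v j))"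
      unfolding l2_inner_def mat_app_trunc[OF F]
      by (rule infsumI, rule has_sum_finite_neutralI[of F]) (auto simp: trunc_def F)
    \<comment> \<open>The effect stands in the antilinear argument, so the form appears conjugated;
      being real, it is unchanged.\<close>
    also have "\<dots> = cnj (\<Sum>i\<in>F. \<Sum>j\<in>F. cnj (v i) * E i j * v j)"
      by (simp add: sum_distrib_left mult_ac)
    also have "\<dots> \<in> \<real>\<^sub>\<ge>\<^sub>0"
      using positive_opD[OF _ F, of E v] assms(1)
      by (metis (no_types, lifting) Reals_cnj_iff effect_def nonneg_Reals_subset_Reals subsetD)
    finally show "l2_inner (trunc F v) (mat_app E (trunc F v)) \<in> \<real>\<^sub>\<ge>\<^sub>0" .
  qed
qed simp

section \<open>Hilbert-Schmidt matrices and Gram matrices\<close>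

text \<open>The Hilbert-Schmidt class: summing over pairs makes \<open>nrm2\<close> of the uncurried
  matrix the squared Hilbert-Schmidt norm.\<close>

definition hs :: "('a, 'k) opmat \<Rightarrow> bool" where
  "hs A \<longleftrightarrow> sqsum (\<lambda>(i, k). A i k)"

text \<open>Tonelli's theorem for unordered sums.\<close>

lemma summable_on_prod_nonneg:
  fixes f :: "'a \<times> 'b \<Rightarrow> real"
  assumes "\<And>x. 0 \<le> f x"
  shows "f summable_on UNIV \<longleftrightarrow>
    (\<forall>x. (\<lambda>y. f (x, y)) summable_on UNIV) \<and> (\<lambda>x. \<Sum>\<^sub>\<infinity>y. f (x, y)) summable_on UNIV"
  using Infinite_Sum.abs_summable_on_Sigma_iff[of f UNIV "\<lambda>_. UNIV"] assms
  by (simp add: infsum_nonneg)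

lemma infsum_prod:
  fixes f :: "'a \<times> 'b \<Rightarrow> 'c::banach"
  assumes "f summable_on UNIV"
  shows "(\<Sum>\<^sub>\<infinity>x. \<Sum>\<^sub>\<infinity>y. f (x, y)) = (\<Sum>\<^sub>\<infinity>p. f p)"
  using infsum_Sigma_banach[of f UNIV "\<lambda>_. UNIV"] assms by simp

lemma has_sum_prod:
  fixes f :: "'a \<times> 'b \<Rightarrow> complex"
  assumes "f summable_on UNIV"
  shows "((\<lambda>x. \<Sum>\<^sub>\<infinity>y. f (x, y)) has_sum (\<Sum>\<^sub>\<infinity>p. f p)) UNIV"
    and "(\<lambda>y. f (x, y)) summable_on UNIV"
proof -
  show s: "(\<lambda>y. f (x, y)) summable_on UNIV" for x
    using summable_on_SigmaD1[of "\<lambda>x y. f (x, y)" UNIV "\<lambda>_. UNIV" x] assms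
    by simp
  show "((\<lambda>x. \<Sum>\<^sub>\<infinity>y. f (x, y)) has_sum (\<Sum>\<^sub>\<infinity>p. f p)) UNIV"
    by (rule has_sum_SigmaD[where f = f and A = UNIV and B = "\<lambda>_. UNIV"]) (use assms s in auto)
qed

lemma sqsum_swap: "sqsum (\<lambda>(x, y). f x y) \<longleftrightarrow> sqsum (\<lambda>(y, x). f x y)"
  unfolding sqsum_def
  using summable_on_reindex_bij_betw[OF bij_swap, of "\<lambda>p. (cmod (case p of (x, y) \<Rightarrow> f x y))\<^sup>2"]
  by (simp add: case_prod_unfold prod.swap_def)

lemma nrm2_swap: "nrm2 (\<lambda>(x, y). f x y) = nrm2 (\<lambda>(y, x). f x y)"
  unfolding nrm2_def
  using infsum_reindex_bij_betw[OF bij_swap, of "\<lambda>p. (cmod (case p of (x, y) \<Rightarrow> f x y))\<^sup>2"]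
  by (simp add: case_prod_unfold prod.swap_def)

lemma sqsum_prod_iff:
  "sqsum (\<lambda>(x, y). f x y) \<longleftrightarrow> (\<forall>x. sqsum (f x)) \<and> (\<lambda>x. nrm2 (f x)) summable_on UNIV"
  unfolding sqsum_def nrm2_def
  by (subst summable_on_prod_nonneg) auto

lemma nrm2_prod:
  assumes "sqsum (\<lambda>(x, y). f x y)"
  shows "((\<lambda>x. nrm2 (f x)) has_sum nrm2 (\<lambda>(x, y). f x y)) UNIV"
proof -
  have "(\<Sum>\<^sub>\<infinity>x. nrm2 (f x)) = nrm2 (\<lambda>(x, y). f x y)"
    using infsum_prod[OF assms[unfolded sqsum_def]] by (simp add: nrm2_def)
  then show ?thesis using assms by (simp add: sqsum_prod_iff has_sum_iff)
qed

lemma l2_inner_prod: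
  assumes "sqsum (\<lambda>(x, y). f x y)" "sqsum (\<lambda>(x, y). g x y)"
  shows "((\<lambda>x. l2_inner (f x) (g x)) has_sum l2_inner (\<lambda>(x, y). f x y) (\<lambda>(x, y). g x y)) UNIV"
  using has_sum_prod(1)[OF sqsum_mult[OF assms]] by (simp add: l2_inner_def)

lemma l2_inner_swap: "l2_inner (\<lambda>(x, y). f x y) (\<lambda>(x, y). g x y) = l2_inner (\<lambda>(y, x). f x y) (\<lambda>(y, x). g x y)"
  unfolding l2_inner_def
  using infsum_reindex_bij_betw[OF bij_swap, of "\<lambda>p. (case p of (x, y) \<Rightarrow> f x y) * cnj (case p of (x, y) \<Rightarrow> g x y)"]
  by (simp add: case_prod_unfold prod.swap_def)

lemma hs_swap: "hs A \<longleftrightarrow> sqsum (\<lambda>(k, i). A i k)"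
  unfolding hs_def by (rule sqsum_swap)

lemma hs_row: "hs A \<Longrightarrow> sqsum (A i)"
  by (simp add: hs_def sqsum_prod_iff)

lemma hs_col: "hs A \<Longrightarrow> sqsum (\<lambda>i. A i k)"
  unfolding hs_swap by (simp add: sqsum_prod_iff)

lemma sqsum_tensor:
  assumes "sqsum f" "sqsum g"
  shows "sqsum (\<lambda>(x, y). f x * g y)" "nrm2 (\<lambda>(x, y). f x * g y) = nrm2 f * nrm2 g"
proof -
  have *: "nrm2 (\<lambda>y. f x * g y) = (cmod (f x))\<^sup>2 * nrm2 g" for x
    by (simp add: nrm2_def norm_mult power_mult_distrib infsum_cmult_right')
  have h: "((\<lambda>x. nrm2 (\<lambda>y. f x * g y)) has_sum nrm2 f * nrm2 g) UNIV"
    unfolding * by (intro has_sum_cmult_left sqsum_nrm2 assms)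
  then show s: "sqsum (\<lambda>(x, y). f x * g y)"
    unfolding sqsum_prod_iff using sqsum_cmult[OF assms(2)] by (auto simp: has_sum_iff)
  show "nrm2 (\<lambda>(x, y). f x * g y) = nrm2 f * nrm2 g"
    by (rule has_sum_unique[OF nrm2_prod[OF s] h])
qed

lemma l2_inner_tensor:
  assumes "sqsum f" "sqsum g" "sqsum f'" "sqsum g'"
  shows "l2_inner (\<lambda>(x, y). f x * g y) (\<lambda>(x, y). f' x * g' y) = l2_inner f f' * l2_inner g g'"
proof -
  have "((\<lambda>x. l2_inner (\<lambda>y. f x * g y) (\<lambda>y. f' x * g' y)) has_sum l2_inner f f' * l2_inner g g') UNIV"
    unfolding l2_inner_cmult_left l2_inner_cmult_right mult.assoc[symmetric]
    by (intro has_sum_cmult_left l2_inner_has_sum assms)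
  from has_sum_unique[OF l2_inner_prod this] sqsum_tensor(1) assms show ?thesis by blast
qed

text \<open>The same matrix as \<open>A \<otimes>\<^sub>o B\<close>, written with patterns so that a
  row unfolds to a product function on pairs, as in \<open>sqsum_tensor\<close>.\<close>

definition mat_tensor :: "('a, 'k) opmat \<Rightarrow> ('b, 'l) opmat \<Rightarrow> ('a \<times> 'b, 'k \<times> 'l) opmat" where
  "mat_tensor A B = (\<lambda>(a, b) (k, l). A a k * B b l)"

lemma hs_tensor:
  fixes A :: "('a, 'k) opmat" and B :: "('b, 'l) opmat"
  assumes "hs A" "hs B"
  shows "hs (mat_tensor A B)"
    "nrm2 (\<lambda>(p, q). mat_tensor A B p q) = nrm2 (\<lambda>(i, k). A i k) * nrm2 (\<lambda>(i, k). B i k)"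
proof -
  have row: "sqsum (mat_tensor A B (a, b))" "nrm2 (mat_tensor A B (a, b)) = nrm2 (A a) * nrm2 (B b)"
    for a b
    using sqsum_tensor[OF hs_row[OF assms(1)] hs_row[OF assms(2)], of a b]
    by (simp_all add: mat_tensor_def)
  let ?s = "nrm2 (\<lambda>(i, k). A i k) * nrm2 (\<lambda>(i, k). B i k)"
  have A: "((\<lambda>a. nrm2 (A a)) has_sum nrm2 (\<lambda>(i, k). A i k)) UNIV"
    and B: "((\<lambda>b. nrm2 (B b)) has_sum nrm2 (\<lambda>(i, k). B i k)) UNIV"
    using assms unfolding hs_def by (auto intro: nrm2_prod)
  have "(\<lambda>(a, b). nrm2 (A a) * nrm2 (B b)) summable_on UNIV"
    by (subst summable_on_prod_nonneg)
       (use A B in \<open>auto simp: nrm2_nonneg infsum_cmult_right' has_sum_iff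
          intro!: summable_on_cmult_right summable_on_cmult_left\<close>)
  then have "((\<lambda>(a, b). nrm2 (A a) * nrm2 (B b)) has_sum (\<Sum>\<^sub>\<infinity>(a, b). nrm2 (A a) * nrm2 (B b))) UNIV"
    by (rule has_sum_infsum)
  moreover have "(\<Sum>\<^sub>\<infinity>(a, b). nrm2 (A a) * nrm2 (B b)) = ?s"
    using infsum_prod[OF \<open>(\<lambda>(a, b). nrm2 (A a) * nrm2 (B b)) summable_on UNIV\<close>] A B
    by (simp add: infsum_cmult_right' infsum_cmult_left' has_sum_iff)
  moreover have "(\<lambda>(a, b). nrm2 (A a) * nrm2 (B b)) = (\<lambda>p. nrm2 (mat_tensor A B p))"
    by (auto simp: row)
  ultimately have h: "((\<lambda>p. nrm2 (mat_tensor A B p)) has_sum ?s) UNIV" by simp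
  then show s: "hs (mat_tensor A B)"
    unfolding hs_def sqsum_prod_iff using row(1) by (auto simp: has_sum_iff)
  show "nrm2 (\<lambda>(p, q). mat_tensor A B p q) = ?s"
    by (rule has_sum_unique[OF nrm2_prod[OF s[unfolded hs_def]] h])
qed

text \<open>The matrix of \<open>A\<close> times its adjoint. For a density operator,
  \<open>A\<close> is a purification whose environment is labelled by the column index.\<close>

definition gram :: "('a, 'k) opmat \<Rightarrow> ('a, 'a) opmat" where
  "gram A i j = l2_inner (A i) (A j)"

lemma gram_tensor:
  assumes "hs A" "hs B"
  shows "gram A \<otimes>\<^sub>o gram B = gram (mat_tensor A B)"
  by (intro ext) (auto simp: gram_def op_tensor_def mat_tensor_def l2_inner_tensor hs_row assms)

text \<open>The form at \<open>v\<close> is the squared norm of the combination of the rows with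
  coefficients \<open>cnj (v i)\<close>.\<close>

lemma positive_gram:
  assumes "\<And>i. sqsum (A i)" shows "positive_op (gram A)"
  unfolding positive_op_def
proof (intro allI impI)
  fix F :: "'a set" and v :: "'a \<Rightarrow> complex" assume F: "finite F"
  let ?w = "\<lambda>k. \<Sum>i\<in>F. cnj (v i) * A i k"
  have w: "sqsum ?w" by (intro sqsum_sum sqsum_cmult assms F)
  have "l2_inner ?w ?w = (\<Sum>i\<in>F. l2_inner (\<lambda>k. cnj (v i) * A i k) ?w)"
    by (rule l2_inner_sum_left[OF F _ w]) (intro sqsum_cmult assms)
  also have "\<dots> = (\<Sum>i\<in>F. \<Sum>j\<in>F. l2_inner (\<lambda>k. cnj (v i) * A i k) (\<lambda>k. cnj (v j) * A j k))"
    by (intro sum.cong refl l2_inner_sum_right F sqsum_cmult assms)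
  finally have "(\<Sum>i\<in>F. \<Sum>j\<in>F. cnj (v i) * gram A i j * v j) = l2_inner ?w ?w"
    unfolding gram_def l2_inner_cmult_left l2_inner_cmult_right by (simp add: mult_ac)
  also have "\<dots> \<in> \<real>\<^sub>\<ge>\<^sub>0" by (simp add: l2_inner_self[OF w] nrm2_nonneg)
  finally show "(\<Sum>i\<in>F. \<Sum>j\<in>F. cnj (v i) * gram A i j * v j) \<in> \<real>\<^sub>\<ge>\<^sub>0" .
qed

lemma gram_trace:
  assumes "hs A"
  shows "((\<lambda>i. gram A i i) has_sum of_real (nrm2 (\<lambda>(i, k). A i k))) UNIV"
  using l2_inner_prod[of A A] assms l2_inner_self[of "\<lambda>(i, k). A i k"]
  by (simp add: hs_def gram_def)

lemma density_gram:
  assumes "hs A" "nrm2 (\<lambda>(i, k). A i k) = 1" shows "density_op (gram A)"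
  using gram_trace[OF assms(1)] assms(2) positive_gram[OF hs_row[OF assms(1)]]
  by (simp add: density_op_def op_trace_def infsumI)

text \<open>Multiplication from the left acts on each column separately and does not increase its
  norm; the squared norms of the columns are then summed.\<close>

lemma hs_op_mult:
  assumes "contraction U" "hs Z" shows "hs (U \<odot> Z)"
proof -
  have c: "sqsum (\<lambda>i. (U \<odot> Z) i k)" "nrm2 (\<lambda>i. (U \<odot> Z) i k) \<le> nrm2 (\<lambda>j. Z j k)" for k
    unfolding op_mult_eq_mat_app
    using contraction_mat_app[OF assms(1) hs_col[OF assms(2)], of k] by auto
  have "(\<lambda>k. nrm2 (\<lambda>j. Z j k)) summable_on UNIV"
    using assms(2) unfolding hs_swap by (simp add: sqsum_prod_iff)
  then have "(\<lambda>k. nrm2 (\<lambda>i. (U \<odot> Z) i k)) summable_on UNIV"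
    by (rule summable_on_comparison_test) (use c nrm2_nonneg in auto)
  then show ?thesis
    unfolding hs_swap using c by (simp add: sqsum_prod_iff)
qed

lemma nrm2_op_mult_unitary:
  assumes "unitary_op U" "hs Z"
  shows "nrm2 (\<lambda>(i, k). (U \<odot> Z) i k) = nrm2 (\<lambda>(i, k). Z i k)"
proof -
  note h = hs_op_mult[OF unitary_contraction[OF assms(1)] assms(2)]
  have "nrm2 (\<lambda>(k, i). (U \<odot> Z) i k) = nrm2 (\<lambda>(k, i). Z i k)"
    using nrm2_prod[OF h[unfolded hs_swap]] nrm2_prod[OF assms(2)[unfolded hs_swap]]
    unfolding op_mult_eq_mat_app unitary_isometry[OF assms(1) hs_col[OF assms(2)]]
    by (rule has_sum_unique)
  then show ?thesis
    using nrm2_swap[of "U \<odot> Z"] nrm2_swap[of Z] by (simp only:)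
qed

text \<open>Exchanging the two sums is legitimate because the summand is a product of two
  square-summable functions of the pair (c, k): the matrix \<open>Z\<close>, and the tensor product
  of \<open>u\<close> with the conjugate of \<open>w\<close>.\<close>

lemma l2_inner_combination:
  assumes "sqsum u" "sqsum w" "hs Z"
  shows "(\<Sum>\<^sub>\<infinity>c. u c * l2_inner (Z c) w) = l2_inner (\<lambda>k. \<Sum>\<^sub>\<infinity>c. u c * Z c k) w"
proof -
  let ?f = "\<lambda>(c, k). u c * (Z c k * cnj (w k))"
  have "(\<lambda>p. (case p of (c, k) \<Rightarrow> Z c k) * (case p of (c, k) \<Rightarrow> u c * cnj (w k))) summable_on UNIV"
    using assms by (intro sqsum_mult' sqsum_tensor) (auto simp: hs_def sqsum_cnj)
  then have s: "?f summable_on UNIV"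
    by (rule summable_on_cong[THEN iffD1, rotated]) auto
  have s': "(\<lambda>(k, c). u c * (Z c k * cnj (w k))) summable_on UNIV"
    using summable_on_reindex_bij_betw[OF bij_swap, of ?f] s
    by (simp add: case_prod_unfold prod.swap_def)
  have "(\<Sum>\<^sub>\<infinity>c. u c * l2_inner (Z c) w) = (\<Sum>\<^sub>\<infinity>c. \<Sum>\<^sub>\<infinity>k. u c * (Z c k * cnj (w k)))"
    by (simp add: l2_inner_def infsum_cmult_right')
  also have "\<dots> = (\<Sum>\<^sub>\<infinity>k. \<Sum>\<^sub>\<infinity>c. u c * (Z c k * cnj (w k)))"
    using infsum_swap_banach[of "\<lambda>c k. u c * (Z c k * cnj (w k))" UNIV UNIV] s by simp
  also have "\<dots> = l2_inner (\<lambda>k. \<Sum>\<^sub>\<infinity>c. u c * Z c k) w"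
    by (simp add: l2_inner_def infsum_cmult_left'[symmetric] mult.assoc)
  finally show ?thesis .
qed

lemma op_mult_gram:
  assumes "contraction U" "hs Z" "sqsum w"
  shows "(\<Sum>\<^sub>\<infinity>c. U p c * l2_inner (Z c) w) = l2_inner ((U \<odot> Z) p) w"
proof -
  have "(U \<odot> Z) p = (\<lambda>k. \<Sum>\<^sub>\<infinity>c. U p c * Z c k)"
    by (rule ext) (simp add: op_mult_def)
  then show ?thesis
    by (simp add: l2_inner_combination[OF contraction_row[OF assms(1)] assms(3,2)])
qed

text \<open>Associativity of the product of \<open>U\<close>, \<open>Z\<close> and their adjoints,
  used once from the left and, after conjugation, once from the right. The square-summable factor
  \<open>Z\<close> is what permits it.\<close>

lemma unitary_channel_gram:
  assumes "contraction U" "hs Z"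
  shows "unitary_channel U (gram Z) = gram (U \<odot> Z)"
proof (intro ext)
  fix p q
  have 1: "(U \<odot> gram Z) p d = l2_inner ((U \<odot> Z) p) (Z d)" for d
    unfolding op_mult_def[of U "gram Z"] gram_def
    by (rule op_mult_gram[OF assms hs_row[OF assms(2)]])
  have "unitary_channel U (gram Z) p q = (\<Sum>\<^sub>\<infinity>d. cnj (U q d * l2_inner (Z d) ((U \<odot> Z) p)))"
    unfolding unitary_channel_def op_mult_def[of "U \<odot> gram Z"] 1 op_adj_def
    by (simp add: l2_inner_cnj mult.commute)
  also have "\<dots> = gram (U \<odot> Z) p q"
    unfolding infsum_cnj op_mult_gram[OF assms hs_row[OF hs_op_mult[OF assms]]] gram_def
    by (rule l2_inner_cnj)
  finally show "unitary_channel U (gram Z) p q = gram (U \<odot> Z) p q" .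
qed

section \<open>Partial traces and Cholesky decomposition\<close>

text \<open>The system index \<open>h\<close> is moved from the rows to the columns: tracing out
  \<open>\<H>\<close> counts it as part of the environment.\<close>

definition slice :: "('h \<times> 'm, 'k) opmat \<Rightarrow> 'm \<Rightarrow> 'h \<times> 'k \<Rightarrow> complex" where
  "slice V i = (\<lambda>(h, k). V (h, i) k)"

lemma sqsum_slice:
  assumes "hs V"
  shows "sqsum (slice V i)" "nrm2 (slice V i) \<le> nrm2 (\<lambda>(p, k). V p k)"
proof -
  have "(\<Sum>x\<in>F. (cmod (slice V i x))\<^sup>2) \<le> nrm2 (\<lambda>(p, k). V p k)" if F: "finite F" for F
  proof -
    have inj: "inj_on (\<lambda>(h, k). ((h, i), k)) F" by (auto simp: inj_on_def)
    have "(\<Sum>x\<in>F. (cmod (slice V i x))\<^sup>2) =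
        (\<Sum>x\<in>(\<lambda>(h, k). ((h, i), k)) ` F. (cmod (case x of (p, k) \<Rightarrow> V p k))\<^sup>2)"
      by (subst sum.reindex[OF inj]) (simp add: slice_def case_prod_unfold)
    also have "\<dots> \<le> nrm2 (\<lambda>(p, k). V p k)"
      by (rule sum_le_nrm2) (use assms F in \<open>auto simp: hs_def\<close>)
    finally show ?thesis .
  qed
  from sqsum_bound[OF this] show "sqsum (slice V i)" "nrm2 (slice V i) \<le> nrm2 (\<lambda>(p, k). V p k)" by auto
qed

lemma ptrace_gram:
  assumes "hs V" shows "ptrace_fst (gram V) i j = l2_inner (slice V i) (slice V j)"
  using l2_inner_prod[of "\<lambda>h k. V (h, i) k" "\<lambda>h k. V (h, j) k"] sqsum_slice(1)[OF assms]
  by (simp add: ptrace_fst_def gram_def slice_def infsumI)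

definition mat_app_fst :: "('h, 'h) opmat \<Rightarrow> ('h \<times> 'k \<Rightarrow> complex) \<Rightarrow> 'h \<times> 'k \<Rightarrow> complex" where
  "mat_app_fst E f = (\<lambda>(h, k). mat_app E (\<lambda>g. f (g, k)) h)"

lemma mat_app_fst_op_mult: "mat_app_fst E (\<lambda>(h, k). Z h k) = (\<lambda>(h, k). (E \<odot> Z) h k)"
  by (simp add: mat_app_fst_def op_mult_eq_mat_app)

lemma sqsum_mat_app_fst:
  assumes "contraction E" "sqsum f" shows "sqsum (mat_app_fst E f)"
  using hs_op_mult[OF assms(1), of "\<lambda>h k. f (h, k)"] assms(2)
    mat_app_fst_op_mult[of E "\<lambda>h k. f (h, k)"]
  by (simp add: hs_def)

text \<open>The identity on the second factor decouples the columns, so the inner product is a sum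
  over \<open>k\<close> of forms of \<open>E\<close> alone.\<close>

lemma effect_inner_fst_nonneg:
  assumes "effect E" "sqsum f"
  shows "l2_inner f (mat_app_fst E f) \<in> \<real>\<^sub>\<ge>\<^sub>0"
proof -
  have f: "sqsum (\<lambda>(k, h). f (h, k))" using assms(2) sqsum_swap[of "\<lambda>h k. f (h, k)"] by simp
  have e: "sqsum (\<lambda>(k, h). mat_app_fst E f (h, k))"
    using sqsum_mat_app_fst[OF effect_contraction[OF assms(1)] assms(2)]
      sqsum_swap[of "\<lambda>h k. mat_app_fst E f (h, k)"] by simp
  have "((\<lambda>k. l2_inner (\<lambda>h. f (h, k)) (\<lambda>h. mat_app_fst E f (h, k))) has_sum l2_inner f (mat_app_fst E f)) UNIV"
    using l2_inner_prod[OF f e] l2_inner_swap[of "\<lambda>h k. f (h, k)" "\<lambda>h k. mat_app_fst E f (h, k)"]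
    by simp
  then show ?thesis
  proof (rule has_sum_nonneg_Reals)
    fix k
    have "sqsum (\<lambda>h. f (h, k))" using f by (simp add: sqsum_prod_iff)
    from effect_inner_nonneg[OF assms(1) this]
    show "l2_inner (\<lambda>h. f (h, k)) (\<lambda>h. mat_app_fst E f (h, k)) \<in> \<real>\<^sub>\<ge>\<^sub>0"
      by (simp add: mat_app_fst_def)
  qed
qed

lemma op_mult_tensor_id:
  "(W \<odot> (E \<otimes>\<^sub>o op_id)) (h, i) (h', j) = (\<Sum>\<^sub>\<infinity>g. W (h, i) (g, j) * E g h')"
proof -
  have "(\<Sum>\<^sub>\<infinity>p. W (h, i) p * (E \<otimes>\<^sub>o op_id) p (h', j)) =
      (\<Sum>\<^sub>\<infinity>p\<in>range (\<lambda>g. (g, j)). W (h, i) p * (E \<otimes>\<^sub>o op_id) p (h', j))"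
    by (rule infsum_cong_neutral) (auto simp: op_tensor_def op_id_def)
  also have "\<dots> = (\<Sum>\<^sub>\<infinity>g. W (h, i) (g, j) * E g h')"
    by (subst infsum_reindex) (auto simp: inj_on_def op_tensor_def op_id_def o_def)
  finally show ?thesis by (simp add: op_mult_def)
qed

text \<open>Since \<open>E\<close> is self-adjoint, it can be moved from the right of the Gram
  matrix onto the second argument of the inner product; there it acts on the system index
  only.\<close>

lemma instrument_gram_entry:
  assumes "effect E" "hs V"
  shows "ptrace_fst (gram V \<odot> (E \<otimes>\<^sub>o op_id)) i j = l2_inner (slice V i) (mat_app_fst E (slice V j))"
proof -
  note con = effect_contraction[OF assms(1)]
  define Z where "Z = (\<lambda>h k. V (h, j) k)"
  have hsZ: "hs Z" using sqsum_slice(1)[OF assms(2), of j] by (simp add: hs_def Z_def slice_def)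
  have "(gram V \<odot> (E \<otimes>\<^sub>o op_id)) (h, i) (h', j) = l2_inner (V (h, i)) ((E \<odot> Z) h')" for h h'
  proof -
    \<comment> \<open>Conjugation brings the sum over \<open>g\<close> to the form of a matrix
      acting from the left on a Gram matrix.\<close>
    have "gram V (h, i) (g, j) * E g h' = cnj (E h' g * l2_inner (Z g) (V (h, i)))" for g
    proof -
      have "E g h' = cnj (E h' g)"
        by (rule positive_op_hermitian) (use assms(1) in \<open>simp add: effect_def\<close>)
      then show ?thesis by (simp add: gram_def Z_def l2_inner_cnj mult.commute)
    qed
    then have "(gram V \<odot> (E \<otimes>\<^sub>o op_id)) (h, i) (h', j) = cnj (\<Sum>\<^sub>\<infinity>g. E h' g * l2_inner (Z g) (V (h, i)))"
      unfolding op_mult_tensor_id by (simp only: infsum_cnj)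
    then show ?thesis
      by (simp add: op_mult_gram[OF con hsZ hs_row[OF assms(2)]] l2_inner_cnj)
  qed
  then have "ptrace_fst (gram V \<odot> (E \<otimes>\<^sub>o op_id)) i j = (\<Sum>\<^sub>\<infinity>h. l2_inner (V (h, i)) ((E \<odot> Z) h))"
    by (simp add: ptrace_fst_def)
  also have "\<dots> = l2_inner (\<lambda>(h, k). V (h, i) k) (\<lambda>(h, k). (E \<odot> Z) h k)"
    using l2_inner_prod[of "\<lambda>h k. V (h, i) k" "E \<odot> Z"] sqsum_slice(1)[OF assms(2), of i]
      hs_op_mult[OF con hsZ]
    by (simp add: slice_def hs_def infsumI)
  finally show ?thesis
    by (simp add: slice_def mat_app_fst_op_mult[symmetric] Z_def)
qed

text \<open>
  One step of the Cholesky algorithm with pivot \<open>p\<close>.  If \<open>W p p = 0\<close>, positivity makes the whole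
  row \<open>p\<close> vanish, and the convention \<open>x / 0 = 0\<close> makes the step trivial.
\<close>

definition schur_col :: "('a, 'a) opmat \<Rightarrow> 'a \<Rightarrow> 'a \<Rightarrow> complex" where
  "schur_col W p i = W i p / of_real (sqrt (Re (W p p)))"

definition schur_step :: "('a, 'a) opmat \<Rightarrow> 'a \<Rightarrow> ('a, 'a) opmat" where
  "schur_step W p i j = W i j - schur_col W p i * cnj (schur_col W p j)"

lemma positive_op_zero_row:
  assumes "positive_op W" "W p p = 0" shows "W p j = 0" "W j p = 0"
proof -
  have "(cmod (W p j))\<^sup>2 \<le> 0" using positive_op_entry_le[OF assms(1), of p j] assms(2) by simp
  then show "W p j = 0" by simp
  then show "W j p = 0" using positive_op_hermitian[OF assms(1), of j p] by simp
qed

lemma schur_step_entry: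
  assumes "positive_op W" "W p p \<noteq> 0"
  shows "schur_step W p i j = W i j - W i p * W p j / W p p"
proof -
  have r: "W p p = of_real (Re (W p p))" "Re (W p p) > 0"
    using positive_op_diag[OF assms(1), of p] assms(2)
    by (auto simp: complex_nonneg_Reals_iff complex_eq_iff)
  have "cnj (W j p) = W p j" by (rule positive_op_hermitian[OF assms(1), symmetric])
  then have "schur_col W p i * cnj (schur_col W p j) =
      W i p * W p j / (of_real (sqrt (Re (W p p))) * of_real (sqrt (Re (W p p))))"
    by (simp add: schur_col_def)
  also have "\<dots> = W i p * W p j / W p p"
    using r by (simp only: of_real_mult[symmetric] real_sqrt_mult_self abs_of_pos)
  finally show ?thesis by (simp add: schur_step_def)
qed

lemma schur_step_zero:
  assumes "positive_op W" "W p p = 0" shows "schur_step W p = W"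
  by (intro ext) (simp add: schur_step_def schur_col_def positive_op_zero_row[OF assms])

lemma positive_schur_step:
  assumes "positive_op W" shows "positive_op (schur_step W p)"
proof (cases "W p p = 0")
  case True
  then show ?thesis using schur_step_zero assms by metis
next
  case False
  have pp: "cnj (W p p) = W p p" by (rule positive_op_hermitian[OF assms, symmetric])
  show ?thesis
    unfolding positive_op_def
  proof (intro allI impI)
    fix F :: "'a set" and v :: "'a \<Rightarrow> complex" assume F: "finite F"
    \<comment> \<open>These are the basis vectors made orthogonal to \<open>e\<^sub>p\<close> with
      respect to the form \<open>W\<close>; their compression is the Schur complement. Their
      component at \<open>p\<close> is why \<open>p\<close> joins the index set.\<close>
    define u where "u i j = (if i = j then 1 else 0) - (if j = p then W p i / W p p else 0)" for i j
    let ?G = "insert p F"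
    have G: "finite ?G" using F by simp
    have "(\<Sum>a\<in>?G. \<Sum>b\<in>?G. cnj (u i a) * W a b * u j b) = schur_step W p i j"
      if ij: "i \<in> F" "j \<in> F" for i j
    proof -
      have uj: "(\<Sum>b\<in>?G. W a b * u j b) = W a j - W a p * W p j / W p p" for a
      proof -
        have "(\<Sum>b\<in>?G. W a b * u j b) = (\<Sum>b\<in>?G. (if j = b then W a b else 0)) -
            (\<Sum>b\<in>?G. if b = p then W a b * W p j / W p p else 0)"
          unfolding sum_subtractf[symmetric] u_def by (intro sum.cong refl) (auto simp: algebra_simps)
        then show ?thesis using G ij by (simp del: sum.insert)
      qed
      have ui: "(\<Sum>a\<in>?G. cnj (u i a) * X a) = X i - cnj (W p i) / W p p * X p" for X
      proof -
        have "(\<Sum>a\<in>?G. cnj (u i a) * X a) = (\<Sum>a\<in>?G. (if i = a then X a else 0)) -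
            (\<Sum>a\<in>?G. if a = p then cnj (W p i) / W p p * X a else 0)"
          unfolding sum_subtractf[symmetric] u_def
          by (intro sum.cong refl) (auto simp: algebra_simps pp)
        then show ?thesis using G ij by (simp del: sum.insert)
      qed
      have "(\<Sum>a\<in>?G. \<Sum>b\<in>?G. cnj (u i a) * W a b * u j b) =
          (\<Sum>a\<in>?G. cnj (u i a) * (\<Sum>b\<in>?G. W a b * u j b))"
        by (simp only: sum_distrib_left mult.assoc)
      also have "\<dots> = schur_step W p i j"
        unfolding uj ui schur_step_entry[OF assms False] using False by simp
      finally show ?thesis .
    qed
    then have "(\<Sum>i\<in>F. \<Sum>j\<in>F. cnj (v i) * schur_step W p i j * v j) =
        (\<Sum>i\<in>F. \<Sum>j\<in>F. cnj (v i) * (\<Sum>a\<in>?G. \<Sum>b\<in>?G. cnj (u i a) * W a b * u j b) * v j)"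
      by simp
    also have "\<dots> \<in> \<real>\<^sub>\<ge>\<^sub>0"
      by (rule positive_opD[OF positive_op_compress[OF assms G] F])
    finally show "(\<Sum>i\<in>F. \<Sum>j\<in>F. cnj (v i) * schur_step W p i j * v j) \<in> \<real>\<^sub>\<ge>\<^sub>0" .
  qed
qed

lemma schur_step_pivot:
  assumes "positive_op W" shows "schur_step W p p j = 0"
  using schur_step_entry[OF assms, of p p j] schur_step_zero[OF assms, of p]
    positive_op_zero_row[OF assms, of p j]
  by (cases "W p p = 0") auto

lemma schur_step_keeps_zero:
  assumes "positive_op W" "\<And>j. W q j = 0" shows "schur_step W p q j = 0"
  using assms by (simp add: schur_step_def schur_col_def)

section \<open>Factorisation of density operators\<close>

lemma density_diag_has_sum:
  assumes "density_op \<rho>"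
  shows "((\<lambda>i. Re (\<rho> i i)) has_sum 1) UNIV" "0 \<le> Re (\<rho> i i)"
proof -
  have t: "(\<Sum>\<^sub>\<infinity>i. \<rho> i i) = 1" using assms by (simp add: density_op_def op_trace_def)
  then have "(\<lambda>i. \<rho> i i) summable_on UNIV" using infsum_not_exists by fastforce
  then have "((\<lambda>i. \<rho> i i) has_sum 1) UNIV" using t by (simp add: has_sum_iff)
  from has_sum_Re[OF this] show "((\<lambda>i. Re (\<rho> i i)) has_sum 1) UNIV" by simp
  show "0 \<le> Re (\<rho> i i)"
    using positive_op_diag[of \<rho> i] assms by (simp add: density_op_def complex_nonneg_Reals_iff)
qed

text \<open>A summable family has countable support. This supplies the sequence of pivots even if
  the index type is uncountable.\<close>

lemma density_countable_support:
  assumes "density_op \<rho>" shows "countable {i. \<rho> i i \<noteq> 0}"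
proof -
  have "(\<lambda>i. norm (Re (\<rho> i i))) summable_on UNIV"
    using density_diag_has_sum[OF assms] by (simp add: has_sum_iff)
  then have "countable {i \<in> UNIV. Re (\<rho> i i) \<noteq> 0}" by (rule Infinite_Sum.abs_summable_countable)
  moreover have "\<rho> i i \<noteq> 0 \<Longrightarrow> Re (\<rho> i i) \<noteq> 0" for i
    using positive_op_diag[of \<rho> i] assms
    by (auto simp: density_op_def complex_nonneg_Reals_iff complex_eq_iff)
  ultimately show ?thesis by (auto elim: countable_subset[rotated])
qed

text \<open>Cholesky elimination along an enumeration of the support. Each row becomes zero after
  finitely many steps and stays so, hence the factorisation holds entry by entry without any
  limit.\<close>

lemma positive_op_gram:
  assumes "positive_op W" "countable {i. W i i \<noteq> 0}"
  obtains A :: "('a, nat) opmat" where "W = gram A" "\<And>i. sqsum (A i)"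
proof -
  \<comment> \<open>The enumeration may repeat elements, and is arbitrary if the support is empty.
    This is harmless, since elimination at a pivot whose row is already zero changes
    nothing.\<close>
  define f where "f = from_nat_into {i. W i i \<noteq> 0}"
  have f: "{i. W i i \<noteq> 0} \<subseteq> range f"
    unfolding f_def by (rule subset_range_from_nat_into[OF assms(2)])
  define R where "R n = rec_nat W (\<lambda>n V. schur_step V (f n)) n" for n
  have R0: "R 0 = W" and RS: "R (Suc n) = schur_step (R n) (f n)" for n
    by (simp_all add: R_def)
  define A where "A i n = schur_col (R n) (f n) i" for i n
  have pos: "positive_op (R n)" for n
    by (induction n) (simp_all add: R0 RS assms positive_schur_step)
  have dec: "W i j = (\<Sum>k<n. A i k * cnj (A j k)) + R n i j" for i j n
    by (induction n) (simp_all add: R0 RS schur_step_def A_def)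
  have zero_row: "R n p j = 0" if "W p p = 0" for n p j
    by (induction n arbitrary: j)
       (simp_all add: R0 RS positive_op_zero_row(1)[OF assms(1) that] schur_step_keeps_zero pos)
  have piv: "R n (f m) j = 0" if "m < n" for n m j
    using that
  proof (induction n arbitrary: j)
    case (Suc n)
    then show ?case
      by (cases "m = n") (simp_all add: RS schur_step_pivot schur_step_keeps_zero pos)
  qed simp
  have ev: "\<exists>N. \<forall>n\<ge>N. \<forall>j. R n i j = 0" for i
  proof (cases "W i i = 0")
    case True
    then show ?thesis using zero_row by blast
  next
    case False
    then obtain m where "i = f m" using f by auto
    then show ?thesis using piv[of m] by (intro exI[of _ "Suc m"]) auto
  qed
  have fin: "\<exists>N. \<forall>n\<ge>N. A i n = 0" for i
    using ev[of i] by (auto simp: A_def schur_col_def)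
  have sq: "sqsum (A i)" for i
  proof -
    obtain N where N: "\<forall>n\<ge>N. A i n = 0" using fin by blast
    show ?thesis by (rule sqsum_finite_support[of "{..<N}"]) (use N in auto)
  qed
  have "W i j = gram A i j" for i j
  proof -
    obtain N where N: "\<forall>n\<ge>N. \<forall>j. R n i j = 0" using ev by blast
    obtain N' where N': "\<forall>n\<ge>N'. A i n = 0" using fin by blast
    \<comment> \<open>Beyond \<open>N\<close> the remainder in row \<open>i\<close> is zero, beyond
      \<open>N'\<close> the row of the factor is.\<close>
    let ?M = "max N N'"
    have "gram A i j = (\<Sum>k<?M. A i k * cnj (A j k))"
      unfolding gram_def l2_inner_def
      by (rule infsumI, rule has_sum_finite_neutralI[of "{..<?M}"]) (use N' in auto)
    then show ?thesis using dec[of i j ?M] N by simp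
  qed
  then have "W = gram A" by blast
  from that[OF this sq] show ?thesis .
qed

text \<open>The squared norms of the rows are the diagonal entries, so trace 1 turns into
  Hilbert-Schmidt norm 1.\<close>

lemma density_op_gram:
  assumes "density_op \<rho>"
  obtains A :: "('a, nat) opmat" where "\<rho> = gram A" "hs A" "nrm2 (\<lambda>(i, k). A i k) = 1"
proof -
  obtain A :: "('a, nat) opmat" where A: "\<rho> = gram A" "\<And>i. sqsum (A i)"
    using positive_op_gram density_countable_support[OF assms] assms by (metis density_op_def)
  have "nrm2 (A i) = Re (\<rho> i i)" for i
    using A(1) l2_inner_self[OF A(2)] by (simp add: gram_def)
  then have h: "((\<lambda>i. nrm2 (A i)) has_sum 1) UNIV"
    using density_diag_has_sum(1)[OF assms] by simp
  then have "hs A" unfolding hs_def sqsum_prod_iff using A(2) by (auto simp: has_sum_iff)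
  moreover from this have "nrm2 (\<lambda>(i, k). A i k) = 1"
    using has_sum_unique[OF nrm2_prod h] by (simp add: hs_def)
  ultimately show ?thesis using that A(1) by blast
qed

section \<open>The instruments of a memory device\<close>

lemma hs_slice:
  assumes "hs V"
  shows "hs (slice V)" "nrm2 (\<lambda>(i, x). slice V i x) = nrm2 (\<lambda>(p, k). V p k)"
proof -
  let ?f = "\<lambda>(i, x). ((fst x, i), snd x)"
  have bij: "bij ?f"
    by (rule bijI) (auto simp: inj_on_def surj_def)
  have e: "(cmod (case ?f y of (p, k) \<Rightarrow> V p k))\<^sup>2 = (cmod (case y of (i, x) \<Rightarrow> slice V i x))\<^sup>2" for y
    by (simp add: slice_def case_prod_unfold)
  show "hs (slice V)"
    using assms summable_on_reindex_bij_betw[OF bij, of "\<lambda>y. (cmod (case y of (p, k) \<Rightarrow> V p k))\<^sup>2"]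
    unfolding hs_def sqsum_def e by simp
  show "nrm2 (\<lambda>(i, x). slice V i x) = nrm2 (\<lambda>(p, k). V p k)"
    using infsum_reindex_bij_betw[OF bij, of "\<lambda>y. (cmod (case y of (p, k) \<Rightarrow> V p k))\<^sup>2"]
    unfolding nrm2_def e by simp
qed

lemma channel_gram:
  assumes "unitary_op U" "hs A" "hs B"
  shows "unitary_channel U (gram A \<otimes>\<^sub>o gram B) = gram (U \<odot> mat_tensor A B)"
    and "hs (U \<odot> mat_tensor A B)"
    and "nrm2 (\<lambda>(p, k). (U \<odot> mat_tensor A B) p k) = nrm2 (\<lambda>(i, k). A i k) * nrm2 (\<lambda>(i, k). B i k)"
  using unitary_contraction[OF assms(1)] assms
  by (simp_all add: gram_tensor unitary_channel_gram hs_tensor hs_op_mult nrm2_op_mult_unitary)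

text \<open>A Stinespring form: the environment consists of the system and the column indices of the
  two factors.\<close>

lemma memory_channel_gram:
  assumes "unitary_op U" "hs A" "hs B"
  shows "memory_channel U (gram B) (gram A) = gram (slice (U \<odot> mat_tensor A B))"
  by (intro ext) (simp add: memory_channel_def channel_gram assms ptrace_gram gram_def[of "slice _"])

lemma instrument_gram:
  assumes "unitary_op U" "hs A" "hs B" "effect E"
  shows "instrument U (gram B) E (gram A) i j =
    l2_inner (slice (U \<odot> mat_tensor A B) i) (mat_app_fst E (slice (U \<odot> mat_tensor A B) j))"
  by (simp add: instrument_def channel_gram assms instrument_gram_entry)

lemma density_memory_channel:
  assumes "unitary_op U" "density_op \<rho>" "density_op \<eta>"
  shows "density_op (memory_channel U \<rho> \<eta>)"
proof -
  obtain A :: "('b, nat) opmat" where A: "\<eta> = gram A" "hs A" "nrm2 (\<lambda>(i, k). A i k) = 1"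
    using density_op_gram[OF assms(3)] .
  obtain B :: "('a, nat) opmat" where B: "\<rho> = gram B" "hs B" "nrm2 (\<lambda>(i, k). B i k) = 1"
    using density_op_gram[OF assms(2)] .
  show ?thesis
    unfolding A(1) B(1) memory_channel_gram[OF assms(1) A(2) B(2)]
    using channel_gram[OF assms(1) A(2) B(2)] A(3) B(3) by (intro density_gram) (simp_all add: hs_slice)
qed

lemma mat_app_fst_sum:
  fixes f :: "'c \<Rightarrow> 'h \<times> 'k \<Rightarrow> complex"
  assumes "contraction E" "finite F" "\<And>c. c \<in> F \<Longrightarrow> sqsum (f c)"
  shows "mat_app_fst E (\<lambda>x. \<Sum>c\<in>F. a c * f c x) = (\<lambda>x. \<Sum>c\<in>F. a c * mat_app_fst E (f c) x)"
proof
  fix x :: "'h \<times> 'k"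
  obtain h k where x: "x = (h, k)" by fastforce
  have "sqsum (\<lambda>g. f c (g, k))" if "c \<in> F" for c
    using hs_col[of "\<lambda>h k. f c (h, k)" k] assms(3)[OF that] by (simp add: hs_def)
  then show "mat_app_fst E (\<lambda>x. \<Sum>c\<in>F. a c * f c x) x = (\<Sum>c\<in>F. a c * mat_app_fst E (f c) x)"
    unfolding x mat_app_fst_def by (simp add: mat_app_sum[OF assms(1,2)])
qed

text \<open>The form at \<open>v\<close> equals the form of the effect, acting on the system, at a
  single combination of the slices.\<close>

lemma positive_instrument:
  assumes "unitary_op U" "density_op \<rho>" "density_op \<eta>" "effect E"
  shows "positive_op (instrument U \<rho> E \<eta>)"
proof -
  obtain A :: "('b, nat) opmat" where A: "\<eta> = gram A" "hs A" "nrm2 (\<lambda>(i, k). A i k) = 1"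
    using density_op_gram[OF assms(3)] .
  obtain B :: "('a, nat) opmat" where B: "\<rho> = gram B" "hs B" "nrm2 (\<lambda>(i, k). B i k) = 1"
    using density_op_gram[OF assms(2)] .
  define V where "V = slice (U \<odot> mat_tensor A B)"
  have V: "sqsum (V i)" for i
    unfolding V_def using channel_gram(2)[OF assms(1) A(2) B(2)] by (rule sqsum_slice)
  note con = effect_contraction[OF assms(4)]
  have I: "instrument U \<rho> E \<eta> i j = l2_inner (V i) (mat_app_fst E (V j))" for i j
    unfolding A(1) B(1) V_def by (rule instrument_gram[OF assms(1) A(2) B(2) assms(4)])
  show ?thesis
    unfolding positive_op_def I
  proof (intro allI impI)
    fix F :: "'b set" and v :: "'b \<Rightarrow> complex" assume F: "finite F"
    let ?y = "\<lambda>x. \<Sum>i\<in>F. cnj (v i) * V i x"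
    have y: "sqsum ?y" by (intro sqsum_sum sqsum_cmult V F)
    note EV = sqsum_mat_app_fst[OF con V]
    have "l2_inner ?y (mat_app_fst E ?y) = l2_inner ?y (\<lambda>x. \<Sum>j\<in>F. cnj (v j) * mat_app_fst E (V j) x)"
      by (subst mat_app_fst_sum[OF con F V]) (rule refl)
    also have "\<dots> = (\<Sum>i\<in>F. l2_inner (\<lambda>x. cnj (v i) * V i x) (\<lambda>x. \<Sum>j\<in>F. cnj (v j) * mat_app_fst E (V j) x))"
      by (intro l2_inner_sum_left F sqsum_sum sqsum_cmult V EV)
    also have "\<dots> = (\<Sum>i\<in>F. \<Sum>j\<in>F. l2_inner (\<lambda>x. cnj (v i) * V i x) (\<lambda>x. cnj (v j) * mat_app_fst E (V j) x))"
      by (intro sum.cong refl l2_inner_sum_right F sqsum_cmult V EV)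
    finally have "(\<Sum>i\<in>F. \<Sum>j\<in>F. cnj (v i) * l2_inner (V i) (mat_app_fst E (V j)) * v j) =
        l2_inner ?y (mat_app_fst E ?y)"
      unfolding l2_inner_cmult_left l2_inner_cmult_right by (simp add: mult_ac)
    then show "(\<Sum>i\<in>F. \<Sum>j\<in>F. cnj (v i) * l2_inner (V i) (mat_app_fst E (V j)) * v j) \<in> \<real>\<^sub>\<ge>\<^sub>0"
      using effect_inner_fst_nonneg[OF assms(4) y] by simp
  qed
qed

lemma positive_op_sum:
  assumes "\<And>k. k \<in> K \<Longrightarrow> positive_op (E k)"
  shows "positive_op (\<lambda>i j. \<Sum>k\<in>K. E k i j)"
  unfolding positive_op_def
proof (intro allI impI)
  fix F :: "'b set" and v :: "'b \<Rightarrow> complex" assume F: "finite F"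
  have "(\<Sum>i\<in>F. \<Sum>j\<in>F. cnj (v i) * (\<Sum>k\<in>K. E k i j) * v j) =
      (\<Sum>i\<in>F. \<Sum>j\<in>F. \<Sum>k\<in>K. cnj (v i) * E k i j * v j)"
    by (simp add: sum_distrib_left sum_distrib_right)
  also have "\<dots> = (\<Sum>i\<in>F. \<Sum>k\<in>K. \<Sum>j\<in>F. cnj (v i) * E k i j * v j)"
    by (intro sum.cong refl sum.swap)
  also have "\<dots> = (\<Sum>k\<in>K. \<Sum>i\<in>F. \<Sum>j\<in>F. cnj (v i) * E k i j * v j)"
    by (rule sum.swap)
  also have "\<dots> \<in> \<real>\<^sub>\<ge>\<^sub>0"
    using positive_opD[OF assms F] by (induction K rule: infinite_finite_induct) (auto intro: nonneg_Reals_add_I)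
  finally show "(\<Sum>i\<in>F. \<Sum>j\<in>F. cnj (v i) * (\<Sum>k\<in>K. E k i j) * v j) \<in> \<real>\<^sub>\<ge>\<^sub>0" .
qed

text \<open>What is missing from the identity is the sum of the other effects.\<close>

lemma povm_effect:
  assumes "povm K E" "k \<in> K" shows "effect (E k)"
proof -
  have "op_id i j - E k i j = (\<Sum>l\<in>K - {k}. E l i j)" for i j
    using assms sum.remove[of K k "\<lambda>l. E l i j"] by (simp add: povm_def)
  moreover have "positive_op (\<lambda>i j. \<Sum>l\<in>K - {k}. E l i j)"
    by (rule positive_op_sum) (use assms in \<open>simp add: povm_def\<close>)
  ultimately show ?thesis using assms by (simp add: effect_def povm_def)
qed

text \<open>The effects add up to the identity on the system index of the slice. Forgetting the
  outcome therefore leaves the plain channel.\<close>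

lemma instrument_sum:
  assumes "unitary_op U" "density_op \<rho>" "density_op \<eta>" "povm K E"
  shows "(\<Sum>k\<in>K. instrument U \<rho> (E k) \<eta> i j) = memory_channel U \<rho> \<eta> i j"
proof -
  obtain A :: "('b, nat) opmat" where A: "\<eta> = gram A" "hs A" "nrm2 (\<lambda>(i, k). A i k) = 1"
    using density_op_gram[OF assms(3)] .
  obtain B :: "('a, nat) opmat" where B: "\<rho> = gram B" "hs B" "nrm2 (\<lambda>(i, k). B i k) = 1"
    using density_op_gram[OF assms(2)] .
  define V where "V = slice (U \<odot> mat_tensor A B)"
  have hsV: "hs (U \<odot> mat_tensor A B)" by (rule channel_gram(2)[OF assms(1) A(2) B(2)])
  have V: "sqsum (V i)" for i
    unfolding V_def using hsV by (rule sqsum_slice)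
  have K: "finite K" using assms(4) by (simp add: povm_def)
  note eff = povm_effect[OF assms(4)]
  note con = effect_contraction[OF eff]
  have id: "(\<Sum>k\<in>K. mat_app_fst (E k) (V j) x) = V j x" for x
  proof -
    obtain h l where x: "x = (h, l)" by (rule prod.exhaust)
    have sq: "sqsum (\<lambda>g. V j (g, l))"
      using hs_col[of "\<lambda>h k. V j (h, k)" l] V[of j] by (simp add: hs_def)
    have "((\<lambda>g. \<Sum>k\<in>K. E k h g * V j (g, l)) has_sum (\<Sum>k\<in>K. mat_app (E k) (\<lambda>g. V j (g, l)) h)) UNIV"
      by (intro has_sum_finite_sum mat_app_has_sum K con sq)
    moreover have "(\<lambda>g. \<Sum>k\<in>K. E k h g * V j (g, l)) = (\<lambda>g. op_id h g * V j (g, l))"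
      using assms(4) by (auto simp: povm_def sum_distrib_right[symmetric])
    moreover have "((\<lambda>g. op_id h g * V j (g, l)) has_sum V j (h, l)) UNIV"
      by (rule has_sum_finite_neutralI[of "{h}"]) (auto simp: op_id_def)
    ultimately show ?thesis
      using has_sum_unique unfolding x mat_app_fst_def by fastforce
  qed
  have "(\<Sum>k\<in>K. instrument U \<rho> (E k) \<eta> i j) = (\<Sum>k\<in>K. l2_inner (V i) (mat_app_fst (E k) (V j)))"
    unfolding A(1) B(1) V_def
    by (intro sum.cong refl instrument_gram[OF assms(1) A(2) B(2) eff])
  also have "\<dots> = l2_inner (V i) (\<lambda>x. \<Sum>k\<in>K. mat_app_fst (E k) (V j) x)"
    by (intro l2_inner_sum_right[symmetric] K V sqsum_mat_app_fst con)
  also have "\<dots> = memory_channel U \<rho> \<eta> i j"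
    unfolding id A(1) B(1) memory_channel_gram[OF assms(1) A(2) B(2)]
    by (simp add: gram_def V_def)
  finally show ?thesis .
qed

lemma positive_diag_of_real: "positive_op W \<Longrightarrow> W i i = of_real (Re (W i i))"
  using positive_op_diag[of W i] by (simp add: complex_nonneg_Reals_iff complex_eq_iff)

lemma positive_diag_nonneg: "positive_op W \<Longrightarrow> 0 \<le> Re (W i i)"
  using positive_op_diag[of W i] by (simp add: complex_nonneg_Reals_iff)

text \<open>Convergence of the trace has to be secured, as divergence would read as 0. The diagonal
  of one outcome is dominated by that of the sum over outcomes, a density operator.\<close>

lemma instrument_trace:
  assumes "unitary_op U" "density_op \<rho>" "density_op \<eta>" "povm K E" "k \<in> K"
  shows "((\<lambda>i. Re (instrument U \<rho> (E k) \<eta> i i)) has_sum Re (op_trace (instrument U \<rho> (E k) \<eta>))) UNIV"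
    and "op_trace (instrument U \<rho> (E k) \<eta>) = of_real (Re (op_trace (instrument U \<rho> (E k) \<eta>)))"
    and "0 \<le> Re (op_trace (instrument U \<rho> (E k) \<eta>))"
proof -
  let ?I = "\<lambda>l. instrument U \<rho> (E l) \<eta>"
  have pos: "positive_op (?I l)" if "l \<in> K" for l
    by (rule positive_instrument[OF assms(1-3) povm_effect[OF assms(4) that]])
  have le: "Re (?I k i i) \<le> Re (memory_channel U \<rho> \<eta> i i)" for i
  proof -
    have "Re (memory_channel U \<rho> \<eta> i i) = (\<Sum>l\<in>K. Re (?I l i i))"
      unfolding instrument_sum[OF assms(1-4), symmetric] by simp
    moreover have "Re (?I k i i) \<le> (\<Sum>l\<in>K. Re (?I l i i))"
      using assms(4,5) positive_diag_nonneg[OF pos] by (intro member_le_sum) (auto simp: povm_def)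
    ultimately show ?thesis by simp
  qed
  have "(\<lambda>i. Re (memory_channel U \<rho> \<eta> i i)) summable_on UNIV"
    using density_diag_has_sum(1)[OF density_memory_channel[OF assms(1-3)]] by (simp add: has_sum_iff)
  then have "(\<lambda>i. Re (?I k i i)) summable_on UNIV"
    by (rule summable_on_comparison_test) (use le positive_diag_nonneg[OF pos[OF assms(5)]] in auto)
  then have h: "((\<lambda>i. Re (?I k i i)) has_sum (\<Sum>\<^sub>\<infinity>i. Re (?I k i i))) UNIV" by simp
  from has_sum_of_real[OF this, where 'a = complex]
  have "((\<lambda>i. ?I k i i) has_sum of_real (\<Sum>\<^sub>\<infinity>i. Re (?I k i i))) UNIV"
    by (simp only: positive_diag_of_real[OF pos[OF assms(5)], symmetric])
  then have t: "op_trace (?I k) = of_real (\<Sum>\<^sub>\<infinity>i. Re (?I k i i))"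
    unfolding op_trace_def by (rule infsumI)
  show "((\<lambda>i. Re (?I k i i)) has_sum Re (op_trace (?I k))) UNIV" using h t by simp
  show "op_trace (?I k) = of_real (Re (op_trace (?I k)))" using t by simp
  show "0 \<le> Re (op_trace (?I k))"
    unfolding t by (simp add: infsum_nonneg positive_diag_nonneg[OF pos[OF assms(5)]])
qed

lemma instrument_trace_sum:
  assumes "unitary_op U" "density_op \<rho>" "density_op \<eta>" "povm K E"
  shows "(\<Sum>k\<in>K. Re (op_trace (instrument U \<rho> (E k) \<eta>))) = 1"
proof -
  have K: "finite K" using assms(4) by (simp add: povm_def)
  have "((\<lambda>i. \<Sum>k\<in>K. Re (instrument U \<rho> (E k) \<eta> i i)) has_sum
      (\<Sum>k\<in>K. Re (op_trace (instrument U \<rho> (E k) \<eta>)))) UNIV"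
    by (intro has_sum_finite_sum K instrument_trace(1)[OF assms])
  moreover have "(\<lambda>i. \<Sum>k\<in>K. Re (instrument U \<rho> (E k) \<eta> i i)) = (\<lambda>i. Re (memory_channel U \<rho> \<eta> i i))"
    unfolding instrument_sum[OF assms, symmetric] by simp
  ultimately have "((\<lambda>i. Re (memory_channel U \<rho> \<eta> i i)) has_sum
      (\<Sum>k\<in>K. Re (op_trace (instrument U \<rho> (E k) \<eta>)))) UNIV" by (simp only:)
  then show ?thesis
    by (rule has_sum_unique) (rule density_diag_has_sum(1)[OF density_memory_channel[OF assms(1-3)]])
qed

text \<open>For an outcome of probability 0 the normalisation divides by 0. The unnormalised state
  is then zero itself, so such outcomes drop out of the mean.\<close>

lemma instrument_zero_trace:
  assumes "unitary_op U" "density_op \<rho>" "density_op \<eta>" "povm K E" "k \<in> K"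
    and "op_trace (instrument U \<rho> (E k) \<eta>) = 0"
  shows "instrument U \<rho> (E k) \<eta> i j = 0"
proof -
  let ?I = "instrument U \<rho> (E k) \<eta>"
  have pos: "positive_op ?I"
    by (rule positive_instrument[OF assms(1-3) povm_effect[OF assms(4,5)]])
  have "((\<lambda>i. Re (?I i i)) has_sum 0) UNIV"
    using instrument_trace(1)[OF assms(1-5)] assms(6) by simp
  then have "Re (?I i i) = 0"
    by (rule nonneg_has_sum_le_0D) (simp_all add: positive_diag_nonneg[OF pos])
  then have "?I i i = 0" by (subst positive_diag_of_real[OF pos]) simp
  then show ?thesis by (rule positive_op_zero_row(1)[OF pos])
qed

lemma density_normalized_instrument:
  assumes "unitary_op U" "density_op \<rho>" "density_op \<eta>" "povm K E" "k \<in> K"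
    and "0 < Re (op_trace (instrument U \<rho> (E k) \<eta>))"
  shows "density_op (\<lambda>i j. instrument U \<rho> (E k) \<eta> i j / op_trace (instrument U \<rho> (E k) \<eta>))"
proof -
  let ?I = "instrument U \<rho> (E k) \<eta>"
  define t where "t = Re (op_trace ?I)"
  have t: "op_trace ?I = of_real t" "0 < t"
    unfolding t_def using instrument_trace(2)[OF assms(1-5)] assms(6) by auto
  have pos: "positive_op ?I"
    by (rule positive_instrument[OF assms(1-3) povm_effect[OF assms(4,5)]])
  have "positive_op (\<lambda>i j. ?I i j / of_real t)"
    unfolding positive_op_def
  proof (intro allI impI)
    fix F :: "'b set" and v :: "'b \<Rightarrow> complex" assume F: "finite F"
    have "(\<Sum>i\<in>F. \<Sum>j\<in>F. cnj (v i) * (?I i j / of_real t) * v j) =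
        of_real (1 / t) * (\<Sum>i\<in>F. \<Sum>j\<in>F. cnj (v i) * ?I i j * v j)"
      by (simp add: sum_distrib_left divide_simps mult_ac)
    also have "\<dots> \<in> \<real>\<^sub>\<ge>\<^sub>0"
      using t(2) by (intro nonneg_Reals_mult_I positive_opD[OF pos F]) simp
    finally show "(\<Sum>i\<in>F. \<Sum>j\<in>F. cnj (v i) * (?I i j / of_real t) * v j) \<in> \<real>\<^sub>\<ge>\<^sub>0" .
  qed
  moreover have "op_trace (\<lambda>i j. ?I i j / of_real t) = op_trace ?I / of_real t"
    unfolding op_trace_def divide_inverse by (rule infsum_cmult_left')
  ultimately show ?thesis unfolding t(1) using t by (simp add: density_op_def)
qed

lemma pmf_has_sum: "(pmf q has_sum 1) A" if "set_pmf q \<subseteq> A"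
proof -
  have "pmf q summable_on A"
    by (rule Infinite_Sum.abs_summable_summable[OF abs_summable_equivalent[THEN iffD2, OF pmf_abs_summable]])
  moreover have "infsum (pmf q) A = 1"
    using infsetsum_infsum[OF pmf_abs_summable[of q A]] infsetsum_pmf_eq_1[OF that] by simp
  ultimately show ?thesis by (simp add: has_sum_iff)
qed

text \<open>A mixture is purified by adding the label of the setting to the columns, with amplitude
  \<open>sqrt (pmf q x)\<close>.\<close>

lemma average_test_state_gram:
  fixes q :: "'x pmf" and B :: "'x \<Rightarrow> ('a, 'k) opmat"
  assumes "\<And>x. hs (B x)" "\<And>x. nrm2 (\<lambda>(i, k). B x i k) = 1"
  defines "C \<equiv> (\<lambda>a (x, b). of_real (sqrt (pmf q x)) * B x a b)"
  shows "hs C" "nrm2 (\<lambda>(i, k). C i k) = 1" "average_test_state q (\<lambda>x. gram (B x)) = gram C"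
proof -
  have q: "(pmf q has_sum 1) UNIV" by (rule pmf_has_sum) simp
  have B: "((\<lambda>a. nrm2 (B x a)) has_sum 1) UNIV" for x
    using nrm2_prod[of "B x"] assms(1)[of x] assms(2)[of x] by (simp add: hs_def)
  have sqrt_sq: "cmod (of_real (sqrt (pmf q x)) * z) ^ 2 = pmf q x * (cmod z)\<^sup>2" for x z
    by (simp add: norm_mult power_mult_distrib)
  let ?f = "\<lambda>(x, (a, b)). of_real (sqrt (pmf q x)) * B x a b"
  have fx: "sqsum (\<lambda>(a, b). of_real (sqrt (pmf q x)) * B x a b)"
    "nrm2 (\<lambda>(a, b). of_real (sqrt (pmf q x)) * B x a b) = pmf q x" for x
  proof -
    have e: "(\<lambda>(a, b). of_real (sqrt (pmf q x)) * B x a b) =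
        (\<lambda>p. of_real (sqrt (pmf q x)) * (case p of (a, b) \<Rightarrow> B x a b))" by auto
    show "sqsum (\<lambda>(a, b). of_real (sqrt (pmf q x)) * B x a b)"
      unfolding e by (rule sqsum_cmult) (use assms(1) in \<open>simp add: hs_def\<close>)
    show "nrm2 (\<lambda>(a, b). of_real (sqrt (pmf q x)) * B x a b) = pmf q x"
      using assms(2)[of x] unfolding e nrm2_def sqrt_sq by (simp add: infsum_cmult_right')
  qed
  have f: "sqsum ?f" "nrm2 ?f = 1"
  proof -
    show s: "sqsum ?f"
      by (rule sqsum_prod_iff[THEN iffD2]) (use q in \<open>auto simp: fx has_sum_iff\<close>)
    show "nrm2 ?f = 1"
      using has_sum_unique[OF nrm2_prod[OF s]] q unfolding fx(2) by blast
  qed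
  have bij: "bij (\<lambda>(a, (x, b)). (x, (a, b)))"
    by (rule bijI) (auto simp: inj_on_def surj_def)
  have e: "(cmod (?f ((\<lambda>(a, (x, b)). (x, (a, b))) y)))\<^sup>2 = (cmod (case y of (i, k) \<Rightarrow> C i k))\<^sup>2" for y
    by (simp add: C_def case_prod_unfold)
  show hsC: "hs C"
    using f(1) summable_on_reindex_bij_betw[OF bij, of "\<lambda>y. (cmod (?f y))\<^sup>2"]
    unfolding hs_def sqsum_def e by simp
  show "nrm2 (\<lambda>(i, k). C i k) = 1"
    using f(2) infsum_reindex_bij_betw[OF bij, of "\<lambda>y. (cmod (?f y))\<^sup>2"]
    unfolding nrm2_def e by simp
  have "average_test_state q (\<lambda>x. gram (B x)) a a' = gram C a a'" for a a'
  proof -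
    have Ca: "sqsum (\<lambda>(x, b). of_real (sqrt (pmf q x)) * B x a b)" for a
      using hs_row[OF hsC, of a] by (simp add: C_def)
    have "l2_inner (\<lambda>b. of_real (sqrt (pmf q x)) * B x a b) (\<lambda>b. of_real (sqrt (pmf q x)) * B x a' b) =
        of_real (pmf q x) * gram (B x) a a'" for x
      unfolding l2_inner_cmult_left l2_inner_cmult_right gram_def
      by (simp add: mult.assoc[symmetric] of_real_mult[symmetric] del: of_real_mult)
    then have "((\<lambda>x. of_real (pmf q x) * gram (B x) a a') has_sum
        l2_inner (\<lambda>(x, b). of_real (sqrt (pmf q x)) * B x a b) (\<lambda>(x, b). of_real (sqrt (pmf q x)) * B x a' b)) UNIV"
      using l2_inner_prod[OF Ca[of a] Ca[of a']] by simp
    then show ?thesis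
      unfolding average_test_state_def gram_def[of C] by (simp add: C_def infsumI)
  qed
  then show "average_test_state q (\<lambda>x. gram (B x)) = gram C" by blast
qed

section \<open>Averaging and continuity\<close>

lemma sqsum_reindex_bij: "bij f \<Longrightarrow> sqsum (\<lambda>x. g (f x)) \<longleftrightarrow> sqsum g"
  unfolding sqsum_def by (rule summable_on_reindex_bij_betw)

lemma l2_inner_reindex_bij: "bij f \<Longrightarrow> l2_inner (\<lambda>x. g (f x)) (\<lambda>x. h (f x)) = l2_inner g h"
  unfolding l2_inner_def by (rule infsum_reindex_bij_betw)

text \<open>The channel is linear in the test state even for infinitely many settings: with the
  factor of the mixture, the sum over settings is just the outermost sum of one inner product over
  the environment.\<close>

lemma memory_channel_average:
  fixes q :: "'x pmf"
  assumes "unitary_op U" "\<And>x. density_op (\<rho> x)"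
  shows "density_op (average_test_state q \<rho>)"
    and "density_op \<eta> \<Longrightarrow> ((\<lambda>x. of_real (pmf q x) * memory_channel U (\<rho> x) \<eta> i j) has_sum
      memory_channel U (average_test_state q \<rho>) \<eta> i j) UNIV"
proof -
  have "\<exists>B :: ('a, nat) opmat. \<rho> x = gram B \<and> hs B \<and> nrm2 (\<lambda>(i, k). B i k) = 1" for x
    using density_op_gram[OF assms(2)[of x]] by metis
  then obtain B :: "'x \<Rightarrow> ('a, nat) opmat"
    where B: "\<And>x. \<rho> x = gram (B x)" "\<And>x. hs (B x)" "\<And>x. nrm2 (\<lambda>(i, k). B x i k) = 1"
    by metis
  then have \<rho>: "\<rho> = (\<lambda>x. gram (B x))" by auto
  define C :: "('a, 'x \<times> nat) opmat" where "C = (\<lambda>a (x, b). of_real (sqrt (pmf q x)) * B x a b)"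
  have C: "hs C" "nrm2 (\<lambda>(i, k). C i k) = 1" "average_test_state q \<rho> = gram C"
    unfolding C_def \<rho> by (rule average_test_state_gram[OF B(2,3)])+
  show "density_op (average_test_state q \<rho>)"
    unfolding C(3) by (rule density_gram[OF C(1,2)])
  assume \<eta>: "density_op \<eta>"
  obtain A :: "('b, nat) opmat" where A: "\<eta> = gram A" "hs A" "nrm2 (\<lambda>(i, k). A i k) = 1"
    using density_op_gram[OF \<eta>] .
  define V where "V = U \<odot> mat_tensor A C"
  define W where "W x = U \<odot> mat_tensor A (B x)" for x
  have VW: "V p (k, (x, b)) = of_real (sqrt (pmf q x)) * W x p (k, b)" for p k x b
  proof -
    have "V p (k, (x, b)) = (\<Sum>\<^sub>\<infinity>c. of_real (sqrt (pmf q x)) * (U p c * mat_tensor A (B x) c (k, b)))"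
      unfolding V_def op_mult_def
      by (rule infsum_cong) (simp add: mat_tensor_def C_def case_prod_unfold)
    then show ?thesis unfolding W_def op_mult_def by (simp only: infsum_cmult_right')
  qed
  let ?f = "\<lambda>i (x, (h, (k, b))). V (h, i) (k, (x, b))"
  let ?t = "\<lambda>(h, (k, (x, b))). (x, (h, (k, b)))"
  have bij: "bij ?t" by (rule bijI) (auto simp: inj_on_def surj_def)
  have ft: "(\<lambda>y. ?f i (?t y)) = slice V i" for i
    by (auto simp: slice_def)
  have hsV: "hs V" unfolding V_def by (rule channel_gram(2)[OF assms(1) A(2) C(1)])
  have sf: "sqsum (?f i)" for i
    using sqsum_reindex_bij[OF bij, of "?f i"] sqsum_slice(1)[OF hsV] unfolding ft by simp
  have "memory_channel U (average_test_state q \<rho>) \<eta> i j = l2_inner (slice V i) (slice V j)"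
    unfolding C(3) A(1) memory_channel_gram[OF assms(1) A(2) C(1)] by (simp add: gram_def V_def)
  also have "\<dots> = l2_inner (?f i) (?f j)"
    using l2_inner_reindex_bij[OF bij, of "?f i" "?f j"] unfolding ft .
  finally have e: "memory_channel U (average_test_state q \<rho>) \<eta> i j = l2_inner (?f i) (?f j)" .
  have "l2_inner (\<lambda>(h, (k, b)). V (h, i) (k, (x, b))) (\<lambda>(h, (k, b)). V (h, j) (k, (x, b))) =
      of_real (pmf q x) * memory_channel U (\<rho> x) \<eta> i j" for x
  proof -
    have "(\<lambda>(h, (k, b)). V (h, i) (k, (x, b))) = (\<lambda>y. of_real (sqrt (pmf q x)) * slice (W x) i y)" for i
      by (auto simp: slice_def VW)
    then have "l2_inner (\<lambda>(h, (k, b)). V (h, i) (k, (x, b))) (\<lambda>(h, (k, b)). V (h, j) (k, (x, b))) =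
        of_real (sqrt (pmf q x) * sqrt (pmf q x)) * l2_inner (slice (W x) i) (slice (W x) j)"
      by (simp only: l2_inner_cmult_left l2_inner_cmult_right complex_cnj_complex_of_real of_real_mult mult.assoc)
    moreover have "memory_channel U (\<rho> x) \<eta> i j = l2_inner (slice (W x) i) (slice (W x) j)"
      unfolding B(1) A(1) memory_channel_gram[OF assms(1) A(2) B(2)] by (simp add: gram_def W_def)
    ultimately show ?thesis by simp
  qed
  then show "((\<lambda>x. of_real (pmf q x) * memory_channel U (\<rho> x) \<eta> i j) has_sum
      memory_channel U (average_test_state q \<rho>) \<eta> i j) UNIV"
    using l2_inner_prod[OF sf[of i] sf[of j]] unfolding e by simp
qed

text \<open>
  Up to an error controlled by the trace outside \<open>F\<close>, the channel depends on the finite block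
  \<open>F \<times> F\<close> only.  This is what makes it continuous for entrywise convergence of density operators.
\<close>

lemma memory_channel_truncation:
  assumes "unitary_op U" "density_op \<rho>" "finite F"
  obtains \<Phi> where "\<And>s. density_op s \<Longrightarrow>
    cmod (memory_channel U \<rho> s i j - (\<Sum>c\<in>F. \<Sum>d\<in>F. s c d * \<Phi> c d)) \<le> 2 * sqrt (1 - (\<Sum>c\<in>F. Re (s c c)))"
proof -
  obtain B :: "('a, nat) opmat" where B: "\<rho> = gram B" "hs B" "nrm2 (\<lambda>(i, k). B i k) = 1"
    using density_op_gram[OF assms(2)] .
  note con = unitary_contraction[OF assms(1)]
  \<comment> \<open>A basis vector of the memory as a matrix with a single column, so that the
    results on Hilbert-Schmidt factors apply to it.\<close>
  define e :: "'b \<Rightarrow> ('b, unit) opmat" where "e c = (\<lambda>a _. if a = c then 1 else 0)" for c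
  have hse: "hs (e c)" for c
    unfolding hs_def by (rule sqsum_finite_support[of "{(c, ())}"]) (auto simp: e_def split: if_splits)
  define X where "X c = U \<odot> mat_tensor (e c) B" for c
  have hsX: "hs (X c)" for c unfolding X_def by (rule channel_gram(2)[OF assms(1) hse B(2)])
  define x where "x c i = (\<lambda>(h, b). X c (h, i) ((), b))" for c i
  have sqx: "sqsum (x c i)" for c i
  proof -
    have bij: "bij (\<lambda>(h, b). (h, ((), b)))" by (rule bijI) (auto simp: inj_on_def surj_def)
    have "x c i = (\<lambda>y. slice (X c) i ((\<lambda>(h, b). (h, ((), b))) y))"
      by (auto simp: x_def slice_def)
    then show ?thesis
      using sqsum_reindex_bij[OF bij, of "slice (X c) i"] sqsum_slice(1)[OF hsX] by simp
  qed
  show ?thesis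
  \<comment> \<open>The coefficients are the entries of the channel applied to the matrix units;
    they depend on the device and on \<open>i\<close> and \<open>j\<close>, but not on
    \<open>s\<close>.\<close>
  proof (rule that[of "\<lambda>c d. l2_inner (x c i) (x d j)"])
    fix s :: "('b, 'b) opmat" assume s: "density_op s"
    obtain A :: "('b, nat) opmat" where A: "s = gram A" "hs A" "nrm2 (\<lambda>(i, k). A i k) = 1"
      using density_op_gram[OF s] .
    \<comment> \<open>The factor is split by rows: \<open>A'\<close> lives on \<open>F\<close>, and
      the squared Hilbert-Schmidt norm of the rest is the trace of \<open>s\<close> outside
      \<open>F\<close>.\<close>
    define A' where "A' = (\<lambda>a k. if a \<in> F then A a k else 0)"
    define A'' where "A'' = (\<lambda>a k. A a k - A' a k)"
    have hsA': "hs A'"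
      unfolding hs_def by (rule sqsum_le(1)[OF A(2)[unfolded hs_def]]) (auto simp: A'_def)
    have nA': "nrm2 (\<lambda>(i, k). A' i k) \<le> 1"
      unfolding A(3)[symmetric] by (rule sqsum_le(2)[OF A(2)[unfolded hs_def]]) (auto simp: A'_def)
    have hsA'': "hs A''"
      unfolding hs_def by (rule sqsum_le(1)[OF A(2)[unfolded hs_def]]) (auto simp: A''_def A'_def)
    define t where "t = 1 - (\<Sum>c\<in>F. Re (s c c))"
    have nA'': "nrm2 (\<lambda>(i, k). A'' i k) = t"
    proof -
      have "((\<lambda>a. if a \<in> F then Re (s a a) else 0) has_sum (\<Sum>c\<in>F. Re (s c c))) UNIV"
        by (rule has_sum_finite_neutralI[OF assms(3)]) auto
      from has_sum_add[OF density_diag_has_sum(1)[OF s] has_sum_cmult_right[OF this, of "-1"]]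
      have "((\<lambda>a. Re (s a a) - (if a \<in> F then Re (s a a) else 0)) has_sum t) UNIV"
        by (simp add: t_def)
      moreover have "nrm2 (A'' a) = Re (s a a) - (if a \<in> F then Re (s a a) else 0)" for a
        using l2_inner_self[OF hs_row[OF A(2)], of a]
        by (auto simp: A''_def A'_def A(1) gram_def) (simp add: nrm2_def)
      ultimately show ?thesis
        using has_sum_unique[OF nrm2_prod[OF hsA''[unfolded hs_def]]] by simp
    qed
    define V where "V = U \<odot> mat_tensor A B"
    define V' where "V' = U \<odot> mat_tensor A' B"
    define V'' where "V'' = U \<odot> mat_tensor A'' B"
    note cV = channel_gram(2,3)[OF assms(1) A(2) B(2), folded V_def]
    note cV' = channel_gram(2,3)[OF assms(1) hsA' B(2), folded V'_def]
    note cV'' = channel_gram(2,3)[OF assms(1) hsA'' B(2), folded V''_def]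
    have nV: "nrm2 (slice V l) \<le> 1" and nV': "nrm2 (slice V' l) \<le> 1" and nV'': "nrm2 (slice V'' l) \<le> t" for l
      using sqsum_slice(2)[OF cV(1), of l] sqsum_slice(2)[OF cV'(1), of l] sqsum_slice(2)[OF cV''(1), of l]
        cV(2) cV'(2) cV''(2) A(3) B(3) nA' nA'' by auto
    have "V'' p kb = V p kb - V' p kb" for p kb
    proof -
      have "(\<lambda>c. mat_tensor A'' B c kb) = (\<lambda>c. mat_tensor A B c kb - mat_tensor A' B c kb)"
        by (auto simp: mat_tensor_def A''_def algebra_simps split: prod.split)
      then show ?thesis
        unfolding V_def V'_def V''_def op_mult_eq_mat_app
        using mat_app_diff[OF con hs_col[OF hs_tensor(1)[OF A(2) B(2)]] hs_col[OF hs_tensor(1)[OF hsA' B(2)]]]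
        by simp
    qed
    then have diff: "(\<lambda>y. slice V l y - slice V' l y) = slice V'' l" for l
      by (auto simp: slice_def)
    have mc: "memory_channel U \<rho> s i j = l2_inner (slice V i) (slice V j)"
      unfolding A(1) B(1) memory_channel_gram[OF assms(1) A(2) B(2)] by (simp add: gram_def V_def)
    have V'_entry: "V' p (k, b) = (\<Sum>c\<in>F. A c k * X c p ((), b))" for p k b
    proof -
      have "(\<lambda>y. mat_tensor A' B y (k, b)) = (\<lambda>y. \<Sum>c\<in>F. A c k * mat_tensor (e c) B y ((), b))"
      proof
        fix y :: "'b \<times> 'a"
        have "(\<Sum>c\<in>F. A c k * mat_tensor (e c) B y ((), b)) =
            (\<Sum>c\<in>F. if fst y = c then A c k * B (snd y) b else 0)"
          by (intro sum.cong) (auto simp: mat_tensor_def e_def split: prod.split)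
        then show "mat_tensor A' B y (k, b) = (\<Sum>c\<in>F. A c k * mat_tensor (e c) B y ((), b))"
          using assms(3) by (simp add: mat_tensor_def A'_def split: prod.split)
      qed
      then show ?thesis
        unfolding V'_def X_def op_mult_eq_mat_app
        using mat_app_sum[OF con assms(3) hs_col[OF hs_tensor(1)[OF hse B(2)]]] by simp
    qed
    have main: "l2_inner (slice V' i) (slice V' j) = (\<Sum>c\<in>F. \<Sum>d\<in>F. s c d * l2_inner (x c i) (x d j))"
    proof -
      let ?t = "\<lambda>(h, (k, b)). (k, (h, b))"
      have bij: "bij ?t" by (rule bijI) (auto simp: inj_on_def surj_def)
      let ?y = "\<lambda>l c. (\<lambda>(k, z). A c k * x c l z)"
      have y: "sqsum (?y l c)" for l c by (rule sqsum_tensor(1)[OF hs_row[OF A(2)] sqx])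
      have sl: "slice V' l = (\<lambda>w. \<Sum>c\<in>F. ?y l c (?t w))" for l
        by (auto simp: slice_def V'_entry x_def)
      have "l2_inner (slice V' i) (slice V' j) = l2_inner (\<lambda>w. \<Sum>c\<in>F. ?y i c w) (\<lambda>w. \<Sum>c\<in>F. ?y j c w)"
        unfolding sl by (rule l2_inner_reindex_bij[OF bij])
      also have "\<dots> = (\<Sum>c\<in>F. l2_inner (?y i c) (\<lambda>w. \<Sum>c\<in>F. ?y j c w))"
        by (intro l2_inner_sum_left assms(3) y sqsum_sum)
      also have "\<dots> = (\<Sum>c\<in>F. \<Sum>d\<in>F. l2_inner (?y i c) (?y j d))"
        by (intro sum.cong refl l2_inner_sum_right assms(3) y)
      also have "\<dots> = (\<Sum>c\<in>F. \<Sum>d\<in>F. s c d * l2_inner (x c i) (x d j))"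
        unfolding A(1) gram_def
        by (intro sum.cong refl l2_inner_tensor hs_row[OF A(2)] sqx)
      finally show ?thesis .
    qed
    have "cmod (l2_inner (slice V i) (slice V j) - l2_inner (slice V' i) (slice V' j)) \<le>
        sqrt (nrm2 (slice V i)) * sqrt (nrm2 (slice V'' j)) + sqrt (nrm2 (slice V'' i)) * sqrt (nrm2 (slice V' j))"
      unfolding diff[symmetric] by (intro l2_inner_diff_bound sqsum_slice(1) cV(1) cV'(1))
    \<comment> \<open>Changing either argument costs \<open>sqrt t\<close>, the undisturbed vectors
      having norm at most 1; this is the factor 2.\<close>
    also have "\<dots> \<le> 1 * sqrt t + sqrt t * 1"
      using nV nV' nV'' order_trans[OF nrm2_nonneg nV'']
      by (intro add_mono mult_mono) (simp_all add: nrm2_nonneg)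
    finally show "cmod (memory_channel U \<rho> s i j - (\<Sum>c\<in>F. \<Sum>d\<in>F. s c d * l2_inner (x c i) (x d j))) \<le>
        2 * sqrt (1 - (\<Sum>c\<in>F. Re (s c c)))"
      unfolding mc main t_def by simp
  qed
qed

lemma density_trace_le: "density_op s \<Longrightarrow> finite F \<Longrightarrow> (\<Sum>c\<in>F. Re (s c c)) \<le> 1"
  by (rule finite_sum_le_has_sum[OF density_diag_has_sum(1)]) (auto intro: density_diag_has_sum(2))

text \<open>The right-hand side is affine in \<open>t\<close>, so the truncation error can be summed
  over the runs and expressed by the average trace outside the block.\<close>

lemma two_sqrt_le:
  assumes "0 \<le> t" "0 < e" shows "2 * sqrt t \<le> e + t / e"
proof -
  have "0 \<le> (sqrt t - e)\<^sup>2 / e" using assms by simp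
  also have "\<dots> = t / e - 2 * sqrt t + e"
    using assms by (simp add: power2_diff diff_divide_distrib add_divide_distrib) (simp add: power2_eq_square)
  finally show ?thesis by simp
qed

text \<open>The channel is compared with its finite block, which is linear and hence follows the
  entrywise limit. A single \<open>F\<close>, chosen for the limit, works for the averages too,
  because their trace on \<open>F\<close> converges.\<close>

lemma memory_channel_average_tendsto:
  assumes "unitary_op U" "density_op \<rho>" "\<And>l. density_op (s l)" "is_average_state s \<sigma>"
  shows "(\<lambda>n. (\<Sum>l<n. memory_channel U \<rho> (s l) i j) / of_nat n) \<longlonglongrightarrow> memory_channel U \<rho> \<sigma> i j"
proof -
  let ?C = "\<lambda>\<eta>. memory_channel U \<rho> \<eta> i j"
  have \<sigma>: "density_op \<sigma>" and lim: "\<And>i j. (\<lambda>n. (\<Sum>l<n. s l i j) / of_nat n) \<longlonglongrightarrow> \<sigma> i j"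
    using assms(4) by (auto simp: is_average_state_def)
  show ?thesis
  proof (rule LIMSEQ_I)
    fix r :: real assume r: "0 < r"
    \<comment> \<open>The three contributions add up to 5 e, which is less than
      \<open>r\<close>.\<close>
    define e where "e = r / 8"
    have e: "0 < e" using r by (simp add: e_def)
    \<comment> \<open>The bound with half of \<open>e\<^sup>2\<close> leaves room for the strict
      inequality that the averages satisfy from some \<open>n\<close> on.\<close>
    obtain F where F: "finite F" "dist (\<Sum>c\<in>F. Re (\<sigma> c c)) 1 \<le> e\<^sup>2 / 2"
      using has_sum_finite_approximation[OF density_diag_has_sum(1)[OF \<sigma>], of "e\<^sup>2 / 2"] e by auto
    obtain \<Phi> where \<Phi>: "\<And>s. density_op s \<Longrightarrow> cmod (?C s - (\<Sum>c\<in>F. \<Sum>d\<in>F. s c d * \<Phi> c d)) \<le>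
        2 * sqrt (1 - (\<Sum>c\<in>F. Re (s c c)))"
      using memory_channel_truncation[OF assms(1,2) F(1)] by blast
    define T where "T \<eta> = 1 - (\<Sum>c\<in>F. Re (\<eta> c c))" for \<eta> :: "('b, 'b) opmat"
    define B where "B \<eta> = (\<Sum>c\<in>F. \<Sum>d\<in>F. \<eta> c d * \<Phi> c d)" for \<eta> :: "('b, 'b) opmat"
    have bound: "cmod (?C \<eta> - B \<eta>) \<le> e + T \<eta> / e" if "density_op \<eta>" for \<eta>
    proof -
      have "0 \<le> T \<eta>" using density_trace_le[OF that F(1)] by (simp add: T_def)
      from \<Phi>[OF that] two_sqrt_le[OF this e] show ?thesis by (simp add: T_def B_def)
    qed
    define m where "m n = (\<lambda>i j. (\<Sum>l<n. s l i j) / of_nat n)" for n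
    have Bm: "B (m n) = (\<Sum>l<n. B (s l)) / of_nat n" for n
    proof -
      have "(\<Sum>l<n. B (s l)) = (\<Sum>c\<in>F. \<Sum>d\<in>F. \<Sum>l<n. s l c d * \<Phi> c d)"
        unfolding B_def by (subst sum.swap, intro sum.cong refl, rule sum.swap)
      then show ?thesis
        by (simp add: B_def m_def sum_divide_distrib sum_distrib_right)
    qed
    have Tm: "T (m n) = (\<Sum>l<n. T (s l)) / real n" if "n > 0" for n
    proof -
      have "(\<Sum>l<n. T (s l)) = real n - (\<Sum>c\<in>F. \<Sum>l<n. Re (s l c c))"
        unfolding T_def sum_subtractf by (simp add: sum.swap[of _ F])
      moreover have "Re (m n c c) = (\<Sum>l<n. Re (s l c c)) / real n" for c
        by (simp add: m_def Re_divide_of_nat)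
      ultimately show ?thesis
        using that by (simp add: T_def sum_divide_distrib[symmetric] diff_divide_distrib)
    qed
    have B_lim: "(\<lambda>n. B (m n)) \<longlonglongrightarrow> B \<sigma>"
      unfolding B_def m_def by (intro tendsto_intros lim)
    have T_lim: "(\<lambda>n. T (m n)) \<longlonglongrightarrow> T \<sigma>"
      unfolding T_def m_def by (intro tendsto_intros lim)
    have T\<sigma>: "T \<sigma> \<le> e\<^sup>2 / 2" using F(2) unfolding T_def dist_real_def by linarith
    then have "T \<sigma> < e\<^sup>2" using e by (smt (verit) field_sum_of_halves zero_less_power)
    have ev: "\<forall>\<^sub>F n in sequentially. T (m n) < e\<^sup>2 \<and> dist (B (m n)) (B \<sigma>) < e \<and> n > 0"
      using order_tendstoD(2)[OF T_lim \<open>T \<sigma> < e\<^sup>2\<close>] tendstoD[OF B_lim e] eventually_gt_at_top[of 0]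
      by eventually_elim auto
    have "\<forall>\<^sub>F n in sequentially. norm ((\<Sum>l<n. ?C (s l)) / of_nat n - ?C \<sigma>) < r"
      using ev
    proof eventually_elim
      case (elim n)
      have q: "t / e \<le> e" if "t \<le> e\<^sup>2" for t
        using that e by (simp add: divide_le_eq power2_eq_square)
      have "norm ((\<Sum>l<n. ?C (s l)) / of_nat n - B (m n)) = norm ((\<Sum>l<n. ?C (s l) - B (s l)) / of_nat n)"
        by (simp add: Bm sum_subtractf diff_divide_distrib)
      also have "\<dots> = norm (\<Sum>l<n. ?C (s l) - B (s l)) / real n"
        by (simp add: norm_divide)
      also have "\<dots> \<le> (\<Sum>l<n. e + T (s l) / e) / real n"
        by (intro divide_right_mono order_trans[OF norm_sum sum_mono] bound assms(3)) simp
      also have "\<dots> = e + T (m n) / e"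
        using elim Tm[of n] by (simp add: sum.distrib add_divide_distrib sum_divide_distrib[symmetric])
      also have "\<dots> \<le> 2 * e" using q[of "T (m n)"] elim by simp
      finally have 1: "norm ((\<Sum>l<n. ?C (s l)) / of_nat n - B (m n)) \<le> 2 * e" .
      have 2: "norm (?C \<sigma> - B \<sigma>) \<le> 2 * e"
        using bound[OF \<sigma>] q[of "T \<sigma>"] \<open>T \<sigma> < e\<^sup>2\<close> by simp
      have tri: "norm (x + y - z) \<le> norm x + norm y + norm z" for x y z :: complex
        using norm_triangle_ineq4[of "x + y" z] norm_triangle_ineq[of x y] by linarith
      have "(\<Sum>l<n. ?C (s l)) / of_nat n - ?C \<sigma> =
          ((\<Sum>l<n. ?C (s l)) / of_nat n - B (m n)) + (B (m n) - B \<sigma>) - (?C \<sigma> - B \<sigma>)" by simp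
      also have "norm \<dots> \<le> 2 * e + e + 2 * e"
        using 1 2 elim by (intro order_trans[OF tri]) (simp add: dist_norm)
      also have "\<dots> < r" using r by (simp add: e_def)
      finally show ?case .
    qed
    then show "\<exists>no. \<forall>n\<ge>no. norm ((\<Sum>l<n. ?C (s l)) / of_nat n - ?C \<sigma>) < r"
      by (simp add: eventually_sequentially)
  qed
qed

section \<open>Strong law of large numbers for random histories\<close>

text \<open>Between consecutive squares the partial sum changes by at most \<open>2 * c\<close>
  times the root of the lower square, which is negligible against that square.\<close>

lemma tendsto_average_from_squares:
  fixes x :: "nat \<Rightarrow> real"
  assumes bd: "\<And>l. \<bar>x l\<bar> \<le> c"
    and sq: "(\<lambda>k. (\<Sum>l<k\<^sup>2. x l) / (real k)\<^sup>2) \<longlonglongrightarrow> 0"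
  shows "(\<lambda>n. (\<Sum>l<n. x l) / real n) \<longlonglongrightarrow> 0"
proof -
  define S where "S n = (\<Sum>l<n. x l)" for n
  define k where "k n = nat \<lfloor>sqrt (real n)\<rfloor>" for n
  have c: "0 \<le> c" using bd[of 0] by linarith
  have lim_k: "filterlim k at_top sequentially"
    unfolding filterlim_at_top
  proof
    fix Z
    show "\<forall>\<^sub>F n in sequentially. Z \<le> k n"
    proof (rule eventually_sequentiallyI[of "Z\<^sup>2"])
      fix n assume "Z\<^sup>2 \<le> n"
      then have "(real Z)\<^sup>2 \<le> real n" by (metis of_nat_le_iff of_nat_power)
      then have "real Z \<le> sqrt (real n)" by (rule real_le_rsqrt)
      then show "Z \<le> k n" unfolding k_def by (simp add: le_nat_floor)
    qed
  qed
  have bound: "\<bar>S n / real n\<bar> \<le> \<bar>S ((k n)\<^sup>2) / (real (k n))\<^sup>2\<bar> + 2 * c / real (k n)" if n: "n \<ge> 1" for n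
  proof -
    have kr: "real (k n) \<le> sqrt (real n)" "sqrt (real n) < real (k n) + 1"
      unfolding k_def by (auto simp: of_nat_floor)
    have k1: "1 \<le> k n" unfolding k_def using n by (simp add: le_nat_floor)
    have "(real (k n))\<^sup>2 \<le> real n" using kr(1)
      by (metis of_nat_0_le_iff power_mono real_sqrt_pow2)
    then have kn: "(k n)\<^sup>2 \<le> n" by (metis of_nat_le_iff of_nat_power)
    have "real n < (real (k n) + 1)\<^sup>2"
      using kr(2) by (metis of_nat_0_le_iff power_strict_mono real_sqrt_ge_zero real_sqrt_pow2 zero_less_numeral)
    \<comment> \<open>Integrality sharpens the evident bound 2 k + 1 to 2 k.\<close>
    then have gap: "real n - (real (k n))\<^sup>2 \<le> 2 * real (k n)"
    proof -
      have "n < (k n + 1)\<^sup>2" using \<open>real n < (real (k n) + 1)\<^sup>2\<close>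
        by (metis of_nat_1 of_nat_add of_nat_less_iff of_nat_power)
      then have "n \<le> (k n)\<^sup>2 + 2 * k n" by (simp add: power2_eq_square)
      then have "real n \<le> real ((k n)\<^sup>2 + 2 * k n)" by (simp only: of_nat_le_iff)
      then show ?thesis by simp
    qed
    have "S n = S ((k n)\<^sup>2) + (\<Sum>l=(k n)\<^sup>2..<n. x l)"
      unfolding S_def using kn by (simp add: lessThan_atLeast0 sum.atLeastLessThan_concat)
    moreover have "\<bar>\<Sum>l=(k n)\<^sup>2..<n. x l\<bar> \<le> (\<Sum>l=(k n)\<^sup>2..<n. c)"
      by (rule order_trans[OF sum_abs sum_mono]) (rule bd)
    moreover have "(\<Sum>l=(k n)\<^sup>2..<n. c) = (real n - (real (k n))\<^sup>2) * c"
      using kn by (simp add: of_nat_diff)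
    moreover have "(real n - (real (k n))\<^sup>2) * c \<le> 2 * real (k n) * c"
      by (rule mult_right_mono[OF gap c])
    ultimately have "\<bar>S n\<bar> \<le> \<bar>S ((k n)\<^sup>2)\<bar> + 2 * real (k n) * c" by linarith
    then have "\<bar>S n\<bar> / real n \<le> (\<bar>S ((k n)\<^sup>2)\<bar> + 2 * real (k n) * c) / real n"
      by (rule divide_right_mono) simp
    also have "\<dots> \<le> (\<bar>S ((k n)\<^sup>2)\<bar> + 2 * real (k n) * c) / (real (k n))\<^sup>2"
      using c k1 n \<open>(real (k n))\<^sup>2 \<le> real n\<close> by (intro divide_left_mono) auto
    also have "\<dots> = \<bar>S ((k n)\<^sup>2) / (real (k n))\<^sup>2\<bar> + 2 * c / real (k n)"
      using k1 by (simp add: add_divide_distrib power2_eq_square abs_divide)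
    finally show ?thesis by (simp add: abs_divide)
  qed
  show ?thesis
    unfolding S_def[symmetric]
  proof (rule Lim_null_comparison)
    show "\<forall>\<^sub>F n in sequentially. norm (S n / real n) \<le>
        \<bar>S ((k n)\<^sup>2) / (real (k n))\<^sup>2\<bar> + 2 * c / real (k n)"
      by (rule eventually_sequentiallyI[of 1]) (use bound in simp)
    have "(\<lambda>j. \<bar>S (j\<^sup>2) / (real j)\<^sup>2\<bar> + 2 * c / real j) \<longlonglongrightarrow> 0 + 0"
      using tendsto_rabs_zero[OF sq] unfolding S_def
      by (intro tendsto_add) (auto intro: lim_const_over_n)
    from filterlim_compose[OF this lim_k]
    show "(\<lambda>n. \<bar>S ((k n)\<^sup>2) / (real (k n))\<^sup>2\<bar> + 2 * c / real (k n)) \<longlonglongrightarrow> 0" by simp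
  qed
qed

text \<open>Orthogonality bounds the second moment of the \<open>n\<close>-th partial sum by
  \<open>real n * c\<^sup>2\<close>. Along the squares the averages thus have second moments at most
  \<open>c\<^sup>2 / (real k)\<^sup>2\<close>, which are summable; the sum of their squares is then
  almost surely finite, and boundedness fills in the remaining \<open>n\<close>.\<close>

lemma (in prob_space) slln_orthogonal:
  fixes D :: "nat \<Rightarrow> 'a \<Rightarrow> real"
  assumes [measurable]: "\<And>n. D n \<in> borel_measurable M"
    and bd: "\<And>n. AE \<omega> in M. \<bar>D n \<omega>\<bar> \<le> c"
    and orth: "\<And>m n. m < n \<Longrightarrow> expectation (\<lambda>\<omega>. D m \<omega> * D n \<omega>) = 0"
  shows "AE \<omega> in M. (\<lambda>n. (\<Sum>l<n. D l \<omega>) / real n) \<longlonglongrightarrow> 0"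
proof -
  define S where "S n \<omega> = (\<Sum>l<n. D l \<omega>)" for n \<omega>
  have [measurable]: "S n \<in> borel_measurable M" for n
    unfolding S_def by measurable
  have int: "integrable M (\<lambda>\<omega>. D m \<omega> * D n \<omega>)" for m n
  proof (rule integrable_const_bound[of _ "c * c"])
    show "AE \<omega> in M. norm (D m \<omega> * D n \<omega>) \<le> c * c"
      using bd[of m] bd[of n]
    proof eventually_elim
      case (elim \<omega>)
      then show ?case unfolding real_norm_def abs_mult by (intro mult_mono) auto
    qed
  qed simp
  have sq: "integrable M (\<lambda>\<omega>. (S n \<omega>)\<^sup>2) \<and> expectation (\<lambda>\<omega>. (S n \<omega>)\<^sup>2) \<le> real n * c\<^sup>2" for n
  proof (induction n)
    case 0
    then show ?case by (simp add: S_def)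
  next
    case (Suc n)
    have cross: "integrable M (\<lambda>\<omega>. S n \<omega> * D n \<omega>)"
      unfolding S_def sum_distrib_right by (intro Bochner_Integration.integrable_sum int)
    have "expectation (\<lambda>\<omega>. S n \<omega> * D n \<omega>) = (\<Sum>l<n. expectation (\<lambda>\<omega>. D l \<omega> * D n \<omega>))"
      unfolding S_def sum_distrib_right by (intro Bochner_Integration.integral_sum int)
    then have cross0: "expectation (\<lambda>\<omega>. S n \<omega> * D n \<omega>) = 0" using orth by simp
    have "expectation (\<lambda>\<omega>. D n \<omega> * D n \<omega>) \<le> expectation (\<lambda>\<omega>. c\<^sup>2)"
      using bd[of n]
      by (intro integral_mono_AE int) (auto elim!: eventually_mono simp: power2_eq_square[symmetric] abs_le_square_iff[symmetric])
    then have d: "expectation (\<lambda>\<omega>. D n \<omega> * D n \<omega>) \<le> c\<^sup>2" by (simp add: prob_space)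
    have e: "(\<lambda>\<omega>. (S (Suc n) \<omega>)\<^sup>2) = (\<lambda>\<omega>. (S n \<omega>)\<^sup>2 + 2 * (S n \<omega> * D n \<omega>) + D n \<omega> * D n \<omega>)"
      by (auto simp: S_def power2_eq_square algebra_simps)
    show ?case
      unfolding e using Suc cross cross0 d int[of n n]
      by (simp add: distrib_right)
  qed
  define Z where "Z k \<omega> = (S (k\<^sup>2) \<omega> / (real k)\<^sup>2)\<^sup>2" for k \<omega>
  have [measurable]: "Z k \<in> borel_measurable M" for k
    unfolding Z_def by measurable
  have EZ: "integrable M (Z k)" "expectation (Z k) \<le> c\<^sup>2 * inverse (real k ^ 2)" for k
  proof -
    have Z: "Z k = (\<lambda>\<omega>. (S (k\<^sup>2) \<omega>)\<^sup>2 / (real k)^4)"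
      by (auto simp: Z_def power_divide)
    show "integrable M (Z k)" unfolding Z using sq by auto
    have "expectation (Z k) = expectation (\<lambda>\<omega>. (S (k\<^sup>2) \<omega>)\<^sup>2) / (real k)^4"
      unfolding Z by simp
    also have "\<dots> \<le> (real (k\<^sup>2) * c\<^sup>2) / (real k)^4"
      by (rule divide_right_mono) (use sq[of "k\<^sup>2"] in auto)
    also have "\<dots> = c\<^sup>2 * inverse (real k ^ 2)"
      by (simp add: field_simps power2_eq_square power4_eq_xxxx)
    finally show "expectation (Z k) \<le> c\<^sup>2 * inverse (real k ^ 2)" .
  qed
  have "(\<integral>\<^sup>+\<omega>. (\<Sum>k. ennreal (Z k \<omega>)) \<partial>M) = (\<Sum>k. (\<integral>\<^sup>+\<omega>. ennreal (Z k \<omega>) \<partial>M))"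
    by (rule nn_integral_suminf) simp
  also have "\<dots> = (\<Sum>k. ennreal (expectation (Z k)))"
    by (intro suminf_cong nn_integral_eq_integral EZ) (simp add: Z_def)
  also have "\<dots> \<noteq> \<infinity>"
  proof -
    have "summable (\<lambda>k. expectation (Z k))"
    proof (rule summable_comparison_test')
      show "summable (\<lambda>k. c\<^sup>2 * inverse (real k ^ 2))"
        by (intro summable_mult inverse_power_summable) simp
      show "norm (expectation (Z k)) \<le> c\<^sup>2 * inverse (real k ^ 2)" if "0 \<le> k" for k
        using EZ(2)[of k] by (simp add: Z_def)
    qed
    then show ?thesis
      unfolding infinity_ennreal_def by (rule ennreal_suminf_neq_top) (simp add: Z_def)
  qed
  finally have "AE \<omega> in M. (\<Sum>k. ennreal (Z k \<omega>)) \<noteq> \<infinity>"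
    by (intro nn_integral_PInf_AE) auto
  moreover have "AE \<omega> in M. \<forall>n. \<bar>D n \<omega>\<bar> \<le> c"
    using bd by (simp add: AE_all_countable)
  ultimately show ?thesis
  proof eventually_elim
    case (elim \<omega>)
    have "summable (\<lambda>k. Z k \<omega>)"
      by (rule summable_suminf_not_top) (use elim in \<open>simp_all add: Z_def\<close>)
    then have "(\<lambda>k. Z k \<omega>) \<longlonglongrightarrow> 0" by (rule summable_LIMSEQ_zero)
    then have "(\<lambda>k. sqrt (Z k \<omega>)) \<longlonglongrightarrow> sqrt 0" by (intro tendsto_real_sqrt)
    then have "(\<lambda>k. \<bar>S (k\<^sup>2) \<omega> / (real k)\<^sup>2\<bar>) \<longlonglongrightarrow> 0" by (simp add: Z_def)
    then have "(\<lambda>k. S (k\<^sup>2) \<omega> / (real k)\<^sup>2) \<longlonglongrightarrow> 0" by (rule tendsto_rabs_zero_cancel)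
    then show ?case
      using elim(2) unfolding S_def by (intro tendsto_average_from_squares) auto
  qed
qed

text \<open>Passing to the law of \<open>T\<close> as a \<open>pmf\<close> turns the integral into
  an unordered sum, which can later be split into past and last step.\<close>

lemma (in prob_space) expectation_countable_values:
  fixes f :: "'b \<Rightarrow> real"
  assumes T: "T \<in> measurable M (count_space L)" and L: "countable L"
    and int: "integrable M (\<lambda>\<omega>. f (T \<omega>))"
  shows "((\<lambda>l. prob {\<omega> \<in> space M. T \<omega> = l} * f l) has_sum expectation (\<lambda>\<omega>. f (T \<omega>))) L"
proof -
  have T'[measurable]: "T \<in> measurable M (count_space UNIV)"
    by (rule measurable_compose[OF T, of id, simplified])  simp
  define D where "D = distr M (count_space UNIV) T"
  interpret D: prob_space D unfolding D_def by (rule prob_space_distr[OF T'])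
  have mD: "measure D {l} = prob {\<omega> \<in> space M. T \<omega> = l}" for l
    unfolding D_def by (subst measure_distr) (auto simp: vimage_def Int_def conj_commute)
  have inL: "T \<omega> \<in> L" if "\<omega> \<in> space M" for \<omega>
    using measurable_space[OF T that] by simp
  \<comment> \<open>A measure is the law of a \<open>pmf\<close> only if almost every point is an
    atom; the points of \<open>L\<close> without mass are countably many and can be removed
    together.\<close>
  have "AE \<omega> in M. \<forall>l\<in>L. measure D {l} = 0 \<longrightarrow> T \<omega> \<noteq> l"
    unfolding AE_ball_countable[OF L]
  proof
    fix l assume "l \<in> L"
    show "AE \<omega> in M. measure D {l} = 0 \<longrightarrow> T \<omega> \<noteq> l"
    proof (cases "measure D {l} = 0")
      case True
      then have "prob {\<omega> \<in> space M. T \<omega> = l} = 0" by (simp add: mD)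
      then have "AE \<omega> in M. \<omega> \<notin> {\<omega> \<in> space M. T \<omega> = l}"
        by (subst (asm) prob_eq_0) auto
      then show ?thesis by (auto elim!: AE_mp)
    qed simp
  qed
  then have "AE \<omega> in M. measure D {T \<omega>} \<noteq> 0"
    using inL by (auto elim!: AE_mp)
  then have AED: "AE l in D. measure D {l} \<noteq> 0"
    unfolding D_def by (subst AE_distr_iff) auto
  define p where "p = Abs_pmf D"
  have pD: "measure_pmf p = D"
    unfolding p_def
    by (rule Abs_pmf_inverse, intro CollectI conjI AED D.prob_space_axioms) (simp add: D_def)
  have pmf: "pmf p l = prob {\<omega> \<in> space M. T \<omega> = l}" for l
    by (simp add: pmf.rep_eq pD mD)
  have "integrable (measure_pmf p) f"
    unfolding pD D_def by (subst integrable_distr_eq) (use int in auto)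
  then have i: "integrable (count_space UNIV) (\<lambda>x. pmf p x * f x)"
    unfolding measure_pmf_eq_density by (subst (asm) integrable_density) auto
  have e: "expectation (\<lambda>\<omega>. f (T \<omega>)) = (\<integral>x. pmf p x * f x \<partial>count_space UNIV)"
  proof -
    have "expectation (\<lambda>\<omega>. f (T \<omega>)) = measure_pmf.expectation p f"
      unfolding pD D_def by (subst integral_distr) auto
    also have "\<dots> = (\<integral>x. pmf p x * f x \<partial>count_space UNIV)"
      unfolding measure_pmf_eq_density by (subst integral_density) auto
    finally show ?thesis .
  qed
  have as: "Infinite_Set_Sum.abs_summable_on (\<lambda>x. pmf p x * f x) UNIV"
    using i by (simp add: Infinite_Set_Sum.abs_summable_on_def)
  then have "(\<lambda>x. pmf p x * f x) summable_on UNIV"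
    by (rule Infinite_Sum.abs_summable_summable[OF abs_summable_equivalent[THEN iffD2]])
  moreover have "infsum (\<lambda>x. pmf p x * f x) UNIV = expectation (\<lambda>\<omega>. f (T \<omega>))"
    using infsetsum_infsum[OF as] by (simp add: e infsetsum_def)
  ultimately have "((\<lambda>x. pmf p x * f x) has_sum expectation (\<lambda>\<omega>. f (T \<omega>))) UNIV"
    by (simp add: has_sum_iff)
  moreover have "pmf p l = 0" if "l \<notin> L" for l
  proof -
    have "{\<omega> \<in> space M. T \<omega> = l} = {}" using inL that by auto
    then show ?thesis unfolding pmf by (simp only: measure_empty)
  qed
  ultimately show ?thesis
    unfolding pmf[symmetric]
    by (subst has_sum_cong_neutral[of UNIV _ _ "\<lambda>x. pmf p x * f x"]) auto
qed

section \<open>Finite histories of a process with countably many values\<close>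

definition history :: "(nat \<Rightarrow> 'w \<Rightarrow> 'b) \<Rightarrow> nat \<Rightarrow> 'w \<Rightarrow> 'b list" where
  "history Y n \<omega> = map (\<lambda>j. Y j \<omega>) [0..<n]"

lemma length_history [simp]: "length (history Y n \<omega>) = n"
  by (simp add: history_def)

lemma history_Suc: "history Y (Suc n) \<omega> = history Y n \<omega> @ [Y n \<omega>]"
  by (simp add: history_def)

lemma take_history: "m \<le> n \<Longrightarrow> take m (history Y n \<omega>) = history Y m \<omega>"
  by (simp add: history_def take_map)

lemma history_eq_iff:
  "length l = n \<Longrightarrow> history Y n \<omega> = l \<longleftrightarrow> (\<forall>j<n. Y j \<omega> = l ! j)"
  by (auto simp: history_def list_eq_iff_nth_eq)

definition (in prob_space) history_prob :: "(nat \<Rightarrow> 'a \<Rightarrow> 'b) \<Rightarrow> 'b list \<Rightarrow> real" where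
  "history_prob Y l = prob {\<omega> \<in> space M. history Y (length l) \<omega> = l}"

lemma (in prob_space) history_event:
  assumes "\<And>n. Y n \<in> measurable M (count_space UNIV)"
  shows "{\<omega> \<in> space M. history Y (length l) \<omega> = l} \<in> events"
proof -
  have [measurable]: "{\<omega> \<in> space M. Y j \<omega> = b} \<in> events" for j b
    using measurable_sets[OF assms, of "{b}" j] by (simp add: vimage_def Int_def conj_commute)
  show ?thesis unfolding history_eq_iff[OF refl] by measurable
qed

lemma (in prob_space) measurable_history:
  assumes Y: "\<And>n. Y n \<in> measurable M (count_space UNIV)"
    and A: "countable A" "\<And>n \<omega>. \<omega> \<in> space M \<Longrightarrow> Y n \<omega> \<in> A"
  shows "history Y n \<in> measurable M (count_space {l \<in> lists A. length l = n})"
proof (subst measurable_count_space_eq_countable)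
  show "countable {l \<in> lists A. length l = n}"
    using countable_lists[OF A(1)] by (rule countable_subset[rotated]) auto
  have "history Y n -` {l} \<inter> space M \<in> events" if "length l = n" for l
    using history_event[where l = l, OF Y] that by (simp add: vimage_def Int_def conj_commute)
  then show "history Y n \<in> space M \<rightarrow> {l \<in> lists A. length l = n} \<and>
      (\<forall>l\<in>{l \<in> lists A. length l = n}. history Y n -` {l} \<inter> space M \<in> events)"
    using A(2) by (auto simp: history_def)
qed

text \<open>There are only countably many lists over \<open>A\<close>, so all those of probability 0
  are avoided almost surely. Bounds that hold on records of positive probability thereby hold along
  almost every run.\<close>

lemma (in prob_space) history_prob_pos:
  assumes Y: "\<And>n. Y n \<in> measurable M (count_space UNIV)"
    and A: "countable A" "AE \<omega> in M. \<forall>n. Y n \<omega> \<in> A"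
  shows "AE \<omega> in M. \<forall>n. 0 < history_prob Y (history Y n \<omega>)"
proof -
  have "AE \<omega> in M. \<forall>l\<in>lists A. history_prob Y l = 0 \<longrightarrow> history Y (length l) \<omega> \<noteq> l"
    unfolding AE_ball_countable[OF countable_lists[OF A(1)]]
  proof
    fix l
    show "AE \<omega> in M. history_prob Y l = 0 \<longrightarrow> history Y (length l) \<omega> \<noteq> l"
    proof (cases "history_prob Y l = 0")
      case True
      then have "AE \<omega> in M. \<omega> \<notin> {\<omega> \<in> space M. history Y (length l) \<omega> = l}"
        unfolding history_prob_def by (subst (asm) prob_eq_0[OF history_event[OF Y]])
      then show ?thesis by (auto elim!: AE_mp)
    qed simp
  qed
  with A(2) show ?thesis
  proof eventually_elim
    case (elim \<omega>)
    have "history_prob Y (history Y n \<omega>) \<noteq> 0" for n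
      using elim(2)[rule_format, of "history Y n \<omega>"] elim(1) by (auto simp: history_def in_lists_conv_set)
    then show ?case by (simp add: history_prob_def zero_less_measure_iff)
  qed
qed

text \<open>
  The process \<open>d\<close> is a bounded martingale difference sequence; conditional expectations reduce to
  sums over the atoms of the countable set of histories.
\<close>

lemma (in prob_space) history_slln_in_set:
  fixes d :: "'b list \<Rightarrow> real"
  assumes Y: "\<And>n. Y n \<in> measurable M (count_space UNIV)"
    and A: "countable A" "\<And>n \<omega>. \<omega> \<in> space M \<Longrightarrow> Y n \<omega> \<in> A"
    and bd: "\<And>l. 0 < history_prob Y l \<Longrightarrow> \<bar>d l\<bar> \<le> c"
    and mart: "\<And>l. ((\<lambda>a. history_prob Y (l @ [a]) * d (l @ [a])) has_sum 0) A"
  shows "AE \<omega> in M. (\<lambda>n. (\<Sum>l<n. d (history Y (Suc l) \<omega>)) / real n) \<longlonglongrightarrow> 0"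
proof (rule slln_orthogonal)
  define L where "L n = {l \<in> lists A. length l = n}" for n
  have cL: "countable (L n)" for n
    using countable_lists[OF A(1)] unfolding L_def by (rule countable_subset[rotated]) auto
  have T: "history Y n \<in> measurable M (count_space (L n))" for n
    unfolding L_def by (rule measurable_history[OF Y A])
  have meas: "(\<lambda>\<omega>. g (history Y n \<omega>)) \<in> borel_measurable M" for g :: "'b list \<Rightarrow> real" and n
    by (rule measurable_compose[OF T]) simp
  show "(\<lambda>\<omega>. d (history Y (Suc n) \<omega>)) \<in> borel_measurable M" for n by (rule meas)
  have "AE \<omega> in M. \<forall>n. 0 < history_prob Y (history Y n \<omega>)"
    by (rule history_prob_pos[OF Y A(1)]) (simp add: A(2))
  then have bdD: "AE \<omega> in M. \<bar>d (history Y n \<omega>)\<bar> \<le> c" for n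
    by eventually_elim (simp add: bd)
  then show "AE \<omega> in M. \<bar>d (history Y (Suc n) \<omega>)\<bar> \<le> c" for n .
  show "expectation (\<lambda>\<omega>. d (history Y (Suc m) \<omega>) * d (history Y (Suc n) \<omega>)) = 0" if "m < n" for m n
  proof -
    \<comment> \<open>The earlier increment, read as a function of the longer history.\<close>
    define g where "g l = d (take (Suc m) l)" for l
    let ?E = "expectation (\<lambda>\<omega>. g (history Y (Suc n) \<omega>) * d (history Y (Suc n) \<omega>))"
    have int: "integrable M (\<lambda>\<omega>. g (history Y (Suc n) \<omega>) * d (history Y (Suc n) \<omega>))"
    proof (rule integrable_const_bound[of _ "c * c"])
      show "AE \<omega> in M. norm (g (history Y (Suc n) \<omega>) * d (history Y (Suc n) \<omega>)) \<le> c * c"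
        using bdD[of "Suc m"] bdD[of "Suc n"]
      proof eventually_elim
        case (elim \<omega>)
        then show ?case
          using that unfolding real_norm_def abs_mult g_def take_history[OF Suc_leI[OF less_SucI[OF that]]]
          by (intro mult_mono) auto
      qed
      show "(\<lambda>\<omega>. g (history Y (Suc n) \<omega>) * d (history Y (Suc n) \<omega>)) \<in> borel_measurable M"
        by (rule meas)
    qed
    \<comment> \<open>Splitting off the last entry makes the expectation an iterated sum;
      \<open>g\<close> does not see that entry because \<open>m < n\<close>, so the inner sum is a
      multiple of the mean-zero condition.\<close>
    have bij: "bij_betw (\<lambda>(l, a). l @ [a]) (L n \<times> A) (L (Suc n))"
    proof (rule bij_betw_byWitness[where f' = "\<lambda>l. (butlast l, last l)"])
      show "\<forall>l\<in>L (Suc n). (\<lambda>(l, a). l @ [a]) (butlast l, last l) = l"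
        by (auto simp: L_def intro!: append_butlast_last_id)
      show "(\<lambda>l. (butlast l, last l)) ` L (Suc n) \<subseteq> L n \<times> A"
        by (auto simp: L_def in_set_butlastD in_lists_conv_set intro!: last_in_set)
    qed (auto simp: L_def)
    have "((\<lambda>l. prob {\<omega> \<in> space M. history Y (Suc n) \<omega> = l} * (g l * d l)) has_sum ?E) (L (Suc n))"
      by (rule expectation_countable_values[OF T cL int])
    then have "((\<lambda>l. history_prob Y l * (g l * d l)) has_sum ?E) (L (Suc n))"
      by (rule has_sum_cong[THEN iffD1, rotated]) (auto simp: history_prob_def L_def)
    then have "((\<lambda>(l, a). history_prob Y (l @ [a]) * (g (l @ [a]) * d (l @ [a]))) has_sum ?E) (L n \<times> A)"
      using has_sum_reindex_bij_betw[OF bij, of "\<lambda>l. history_prob Y l * (g l * d l)" ?E]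
      by (simp add: case_prod_unfold)
    then have "((\<lambda>l. 0) has_sum ?E) (L n)"
    proof (rule has_sum_SigmaD)
      fix l assume "l \<in> L n"
      then have "g (l @ [a]) = g l" for a using that by (simp add: g_def L_def)
      then show "((\<lambda>a. case (l, a) of (l, a) \<Rightarrow> history_prob Y (l @ [a]) * (g (l @ [a]) * d (l @ [a])))
          has_sum 0) A"
        using has_sum_cmult_right[OF mart[of l], of "g l"] by (simp add: mult_ac)
    qed
    then have "?E = 0" using has_sum_0_simp has_sum_unique by blast
    then show ?thesis using that by (simp add: g_def take_history)
  qed
qed

text \<open>Values outside \<open>A\<close> are replaced by a fixed element of \<open>A\<close>.
  This happens on a null set only, so neither the record probabilities nor the almost sure
  conclusion change.\<close>

lemma (in prob_space) history_slln:
  fixes d :: "'b list \<Rightarrow> real"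
  assumes Y: "\<And>n. Y n \<in> measurable M (count_space UNIV)"
    and A: "countable A" "AE \<omega> in M. \<forall>n. Y n \<omega> \<in> A"
    and bd: "\<And>l. 0 < history_prob Y l \<Longrightarrow> \<bar>d l\<bar> \<le> c"
    and mart: "\<And>l. ((\<lambda>a. history_prob Y (l @ [a]) * d (l @ [a])) has_sum 0) A"
  shows "AE \<omega> in M. (\<lambda>n. (\<Sum>l<n. d (history Y (Suc l) \<omega>)) / real n) \<longlonglongrightarrow> 0"
proof -
  have "A \<noteq> {}"
  proof
    assume "A = {}"
    then have "AE \<omega> in M. False" using A(2) by simp
    then show False by simp
  qed
  then obtain a0 where a0: "a0 \<in> A" by blast
  define Z where "Z n \<omega> = (if Y n \<omega> \<in> A then Y n \<omega> else a0)" for n \<omega>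
  have Z: "Z n \<in> measurable M (count_space UNIV)" for n
    unfolding Z_def by (rule measurable_compose[OF Y, of "\<lambda>y. if y \<in> A then y else a0"]) simp
  have eq: "AE \<omega> in M. \<forall>n. history Z n \<omega> = history Y n \<omega>"
    using A(2) by eventually_elim (simp add: history_def Z_def)
  have pr: "history_prob Z l = history_prob Y l" for l
    unfolding history_prob_def
  proof (rule measure_eq_AE[OF _ history_event[OF Z] history_event[OF Y]])
    show "AE \<omega> in M. (\<omega> \<in> {\<omega> \<in> space M. history Z (length l) \<omega> = l}) =
        (\<omega> \<in> {\<omega> \<in> space M. history Y (length l) \<omega> = l})"
      using eq by eventually_elim simp
  qed
  have "AE \<omega> in M. (\<lambda>n. (\<Sum>l<n. d (history Z (Suc l) \<omega>)) / real n) \<longlonglongrightarrow> 0"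
    by (rule history_slln_in_set[OF Z A(1), where c = c]) (use bd mart a0 in \<open>auto simp: pr Z_def\<close>)
  with eq show ?thesis by eventually_elim simp
qed

section \<open>The memory along a random history\<close>

lemma memory_state_cong:
  "(\<And>j. j < n \<Longrightarrow> y j = y' j) \<Longrightarrow> memory_state U \<rho> E \<xi> y n = memory_state U \<rho> E \<xi> y' n"
  by (induction n) auto

lemma density_entry_le: "density_op s \<Longrightarrow> cmod (s i j) \<le> 1"
proof -
  assume s: "density_op s"
  have le: "0 \<le> Re (s i i) \<and> Re (s i i) \<le> 1" for i
    using density_trace_le[OF s, of "{i}"] density_diag_has_sum(2)[OF s] by simp
  have "(cmod (s i j))\<^sup>2 \<le> Re (s i i) * Re (s j j)"
    using s by (intro positive_op_entry_le) (simp add: density_op_def)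
  also have "\<dots> \<le> 1 * 1" using le by (intro mult_mono) auto
  finally show ?thesis by (simp add: abs_square_le_1)
qed

locale memory_run = prob_space P
  for P :: "'w measure" +
  fixes Y :: "nat \<Rightarrow> 'w \<Rightarrow> 'x \<times> 'k"
    and U :: "('h \<times> 'm, 'm \<times> 'h) opmat"
    and \<xi> :: "('m, 'm) opmat"
    and q :: "'x pmf"
    and \<rho> :: "'x \<Rightarrow> ('h, 'h) opmat"
    and K :: "'x \<Rightarrow> 'k set"
    and E :: "'x \<Rightarrow> 'k \<Rightarrow> ('h, 'h) opmat"
  assumes U: "unitary_op U"
    and \<xi>: "density_op \<xi>"
    and \<rho>: "\<And>x. density_op (\<rho> x)"
    and E: "\<And>x. povm (K x) (E x)"
    and run: "memory_experiment P Y U \<xi> q \<rho> K E"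
begin

text \<open>The countable alphabet of the records: settings of positive probability, each with its
  finitely many outcomes.\<close>

definition possible :: "('x \<times> 'k) set" where
  "possible = Sigma (set_pmf q) K"

text \<open>Beyond its length the list has unspecified entries; the recursion reads only positions
  below \<open>length l\<close>.\<close>

definition state_after :: "('x \<times> 'k) list \<Rightarrow> ('m, 'm) opmat" where
  "state_after l = memory_state U \<rho> E \<xi> (\<lambda>j. l ! j) (length l)"

abbreviation outcome_op :: "('x \<times> 'k) list \<Rightarrow> 'x \<Rightarrow> 'k \<Rightarrow> ('m, 'm) opmat" where
  "outcome_op l x k \<equiv> instrument U (\<rho> x) (E x k) (state_after l)"

abbreviation mean_channel :: "('m, 'm) opmat \<Rightarrow> ('m, 'm) opmat" where
  "mean_channel \<equiv> memory_channel U (average_test_state q \<rho>)"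

lemma Y: "Y n \<in> measurable P (count_space UNIV)"
  using run by (simp add: memory_experiment_def)

lemma finite_K: "finite (K x)"
  using E by (simp add: povm_def)

lemma countable_possible: "countable possible"
  unfolding possible_def by (intro countable_SIGMA countable_set_pmf countable_finite finite_K)

lemma state_after_Nil: "state_after [] = \<xi>"
  by (simp add: state_after_def)

lemma state_after_snoc:
  "state_after (l @ [(x, k)]) = (\<lambda>i j. outcome_op l x k i j / op_trace (outcome_op l x k))"
proof -
  have "memory_state U \<rho> E \<xi> (\<lambda>j. (l @ [(x, k)]) ! j) (length l) = state_after l"
    unfolding state_after_def by (rule memory_state_cong) (simp add: nth_append)
  then show ?thesis by (simp add: state_after_def Let_def)
qed

lemma memory_state_history: "memory_state U \<rho> E \<xi> (\<lambda>n. Y n \<omega>) n = state_after (history Y n \<omega>)"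
  unfolding state_after_def length_history by (rule memory_state_cong) (simp add: history_def)

lemma history_prob_nonneg: "0 \<le> history_prob Y l"
  by (simp add: history_prob_def)

lemma history_prob_snoc:
  assumes "k \<in> K x"
  shows "history_prob Y (l @ [(x, k)]) = history_prob Y l * (pmf q x * Re (op_trace (outcome_op l x k)))"
proof -
  let ?y = "\<lambda>j. (l @ [(x, k)]) ! j"
  have "history_prob Y (l @ [(x, k)]) = prob {\<omega> \<in> space P. \<forall>j<Suc (length l). Y j \<omega> = ?y j}"
    unfolding history_prob_def by (subst history_eq_iff) simp_all
  also have "\<dots> = prob {\<omega> \<in> space P. \<forall>j<length l. Y j \<omega> = ?y j} *
      (pmf q x * Re (op_trace (instrument U (\<rho> x) (E x k) (memory_state U \<rho> E \<xi> ?y (length l)))))"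
    using run assms unfolding memory_experiment_def by simp
  also have "memory_state U \<rho> E \<xi> ?y (length l) = state_after l"
    unfolding state_after_def by (rule memory_state_cong) (simp add: nth_append)
  also have "{\<omega> \<in> space P. \<forall>j<length l. Y j \<omega> = ?y j} = {\<omega> \<in> space P. history Y (length l) \<omega> = l}"
    by (auto simp: history_eq_iff nth_append)
  finally show ?thesis by (simp add: history_prob_def)
qed

lemma history_prob_snoc_le: "history_prob Y (l @ [a]) \<le> history_prob Y l"
  unfolding history_prob_def
  by (rule finite_measure_mono[OF _ history_event[OF Y]]) (auto simp: history_Suc)

text \<open>Positive probability of the record forces each prefix to have positive probability and
  each normalising trace to be nonzero.\<close>

lemma density_state_after_possible:
  "l \<in> lists possible \<Longrightarrow> 0 < history_prob Y l \<Longrightarrow> density_op (state_after l)"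
proof (induction l rule: rev_induct)
  case Nil
  then show ?case by (simp add: state_after_Nil \<xi>)
next
  case (snoc a l)
  obtain x k where a: "a = (x, k)" by (rule prod.exhaust)
  have k: "k \<in> K x" and l: "l \<in> lists possible"
    using snoc.prems(1) by (auto simp: a possible_def)
  have pl: "0 < history_prob Y l" using snoc.prems(2) history_prob_snoc_le[of l a] by linarith
  have d: "density_op (state_after l)" by (rule snoc.IH[OF l pl])
  have "Re (op_trace (outcome_op l x k)) \<noteq> 0"
    using snoc.prems(2) unfolding a history_prob_snoc[OF k] by auto
  then have "0 < Re (op_trace (outcome_op l x k))"
    using instrument_trace(3)[OF U \<rho>[of x] d E[of x] k] by linarith
  then show ?case
    unfolding a state_after_snoc by (rule density_normalized_instrument[OF U \<rho> d E k])
qed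

text \<open>For each setting the outcome probabilities add up to 1, and so do the weights of the
  settings. The possible continuations thus use up all the probability of the record.\<close>

lemma history_prob_total:
  assumes "l \<in> lists possible"
  shows "((\<lambda>a. history_prob Y (l @ [a])) has_sum history_prob Y l) possible"
proof (cases "history_prob Y l = 0")
  case True
  then have "history_prob Y (l @ [a]) = 0" for a
    using history_prob_snoc_le[of l a] history_prob_nonneg[of "l @ [a]"] by linarith
  then show ?thesis using True by simp
next
  case False
  then have "0 < history_prob Y l" using history_prob_nonneg[of l] by linarith
  with assms have d: "density_op (state_after l)" by (rule density_state_after_possible)
  have inner: "((\<lambda>k. history_prob Y (l @ [(x, k)])) has_sum history_prob Y l * pmf q x) (K x)" for x
  proof -
    have "(\<Sum>k\<in>K x. history_prob Y (l @ [(x, k)])) =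
        history_prob Y l * (pmf q x * (\<Sum>k\<in>K x. Re (op_trace (outcome_op l x k))))"
      by (simp add: history_prob_snoc sum_distrib_left)
    then show ?thesis
      by (intro has_sum_finiteI finite_K) (simp add: instrument_trace_sum[OF U \<rho> d E])
  qed
  have "(pmf q has_sum 1) (set_pmf q)" by (rule pmf_has_sum) simp
  then have outer: "((\<lambda>x. history_prob Y l * pmf q x) has_sum history_prob Y l) (set_pmf q)"
    using has_sum_cmult_right[of "pmf q" _ 1 "history_prob Y l"] by simp
  show ?thesis
    unfolding possible_def
  proof (rule has_sum_SigmaI)
    show "(\<lambda>a. history_prob Y (l @ [a])) summable_on Sigma (set_pmf q) K"
      by (rule summable_on_SigmaI) (use inner outer in \<open>auto simp: history_prob_nonneg has_sum_iff\<close>)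
  qed (use inner outer in auto)
qed

text \<open>Values outside \<open>possible\<close> are not excluded by definition. After a possible
  record they share an event of probability 0, since the possible continuations exhaust that record;
  there are countably many records, and induction along the run joins the steps.\<close>

lemma AE_possible: "AE \<omega> in P. \<forall>n. Y n \<omega> \<in> possible"
proof -
  have step: "AE \<omega> in P. history Y (length l) \<omega> = l \<longrightarrow> Y (length l) \<omega> \<in> possible"
    if l: "l \<in> lists possible" for l
  proof -
    let ?H = "{\<omega> \<in> space P. history Y (length l) \<omega> = l}"
    let ?G = "{\<omega> \<in> space P. history Y (length l) \<omega> = l \<and> Y (length l) \<omega> \<in> possible}"
    have [measurable]: "?H \<in> events" by (rule history_event[OF Y])
    have [measurable]: "{\<omega> \<in> space P. Y (length l) \<omega> \<in> possible} \<in> events"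
      using measurable_sets[OF Y, of possible "length l"] by (simp add: vimage_def Int_def conj_commute)
    have G: "?G \<in> events" by measurable
    have "history_prob Y l \<le> prob ?G"
    \<comment> \<open>Each finite partial sum is the probability of a disjoint union contained in
      \<open>?G\<close>.\<close>
    proof (rule has_sum_le_finite_sums[OF history_prob_total[OF l]])
      fix F assume F: "finite F" "F \<subseteq> possible"
      let ?D = "\<lambda>a. {\<omega> \<in> space P. history Y (length (l @ [a])) \<omega> = l @ [a]}"
      have "(\<Sum>a\<in>F. history_prob Y (l @ [a])) = prob (\<Union>a\<in>F. ?D a)"
        unfolding history_prob_def
        by (rule finite_measure_finite_Union[symmetric])
           (use F in \<open>auto simp: disjoint_family_on_def simp del: length_append intro!: history_event Y,
             (simp add: history_Suc)+\<close>)
      also have "\<dots> \<le> prob ?G"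
        by (rule finite_measure_mono[OF _ G]) (use F in \<open>auto simp: history_Suc\<close>)
      finally show "(\<Sum>a\<in>F. history_prob Y (l @ [a])) \<le> prob ?G" .
    qed
    moreover have "prob (?H - ?G) = prob ?H - prob ?G"
      by (rule finite_measure_Diff) (use G in auto)
    ultimately have "prob (?H - ?G) = 0"
      using measure_nonneg[of P "?H - ?G"] by (simp add: history_prob_def)
    then have "AE \<omega> in P. \<omega> \<notin> ?H - ?G"
      using G by (subst (asm) prob_eq_0) auto
    then show ?thesis by (rule AE_mp) auto
  qed
  have "AE \<omega> in P. \<forall>l\<in>lists possible. history Y (length l) \<omega> = l \<longrightarrow> Y (length l) \<omega> \<in> possible"
    unfolding AE_ball_countable[OF countable_lists[OF countable_possible]] using step by blast
  then show ?thesis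
  proof eventually_elim
    case (elim \<omega>)
    have "history Y n \<omega> \<in> lists possible" for n
    proof (induction n)
      case (Suc n)
      then show ?case using elim[rule_format, OF Suc] by (simp add: history_Suc)
    qed (simp add: history_def)
    then show ?case
      using elim[rule_format, of "history Y n \<omega>" for n] by auto
  qed
qed

lemma possible_history:
  assumes "0 < history_prob Y l" shows "l \<in> lists possible"
proof (rule ccontr)
  assume l: "l \<notin> lists possible"
  have "AE \<omega> in P. \<omega> \<notin> {\<omega> \<in> space P. history Y (length l) \<omega> = l}"
    using AE_possible
  proof eventually_elim
    case (elim \<omega>)
    then have "history Y (length l) \<omega> \<in> lists possible" by (auto simp: history_def in_lists_conv_set)
    then show ?case using l by auto
  qed
  then have "history_prob Y l = 0"
    unfolding history_prob_def by (subst prob_eq_0[OF history_event[OF Y]])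
  then show False using assms by simp
qed

lemma density_state_after: "0 < history_prob Y l \<Longrightarrow> density_op (state_after l)"
  using density_state_after_possible possible_history by blast

lemma density_mean_channel: "density_op s \<Longrightarrow> density_op (mean_channel s)"
  by (rule density_memory_channel[OF U memory_channel_average(1)[OF U \<rho>]])

text \<open>The martingale difference. On the empty list \<open>butlast\<close> removes nothing, but
  only nonempty histories enter the averages.\<close>

definition innovation :: "'m \<Rightarrow> 'm \<Rightarrow> ('x \<times> 'k) list \<Rightarrow> complex" where
  "innovation i j l = state_after l i j - mean_channel (state_after (butlast l)) i j"

lemma innovation_le:
  assumes "0 < history_prob Y l" shows "cmod (innovation i j l) \<le> 2"
proof -
  have "0 < history_prob Y (butlast l)"
  proof (cases l rule: rev_cases)
    case (snoc l' a)
    then show ?thesis using assms history_prob_snoc_le[of l' a] by simp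
  qed (use assms in simp)
  then have "cmod (mean_channel (state_after (butlast l)) i j) \<le> 1"
    by (intro density_entry_le density_mean_channel density_state_after)
  moreover have "cmod (state_after l i j) \<le> 1"
    by (intro density_entry_le density_state_after assms)
  ultimately show ?thesis
    unfolding innovation_def by (intro order_trans[OF norm_triangle_ineq4]) simp
qed

text \<open>
  The conditional expectation of the next memory state, given the history, is the image of the
  present one under the mean channel: the outcome probabilities cancel the normalisation.
\<close>

lemma innovation_mean_zero:
  "((\<lambda>a. of_real (history_prob Y (l @ [a])) * innovation i j (l @ [a])) has_sum 0) possible"
proof (cases "history_prob Y l = 0")
  case True
  then have "history_prob Y (l @ [a]) = 0" for a
    using history_prob_snoc_le[of l a] history_prob_nonneg[of "l @ [a]"] by linarith
  then show ?thesis by simp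
next
  case False
  then have pl: "0 < history_prob Y l" using history_prob_nonneg[of l] by linarith
  then have d: "density_op (state_after l)" and l: "l \<in> lists possible"
    by (rule density_state_after, rule possible_history)
  let ?p = "of_real (history_prob Y l) :: complex" and ?s = "state_after l"
  let ?c = "mean_channel ?s i j"
  let ?f = "\<lambda>a. of_real (history_prob Y (l @ [a])) * innovation i j (l @ [a])"
  have f: "?f (x, k) = ?p * of_real (pmf q x) *
      (outcome_op l x k i j - of_real (Re (op_trace (outcome_op l x k))) * ?c)" if k: "k \<in> K x" for x k
  \<comment> \<open>At trace 0 the state after the run is the matrix 0 by the convention for
    division; the left side has weight 0, and on the right the unnormalised state vanishes.\<close>
  proof (cases "op_trace (outcome_op l x k) = 0")
    case True
    then show ?thesis
      using instrument_zero_trace[OF U \<rho> d E k True] by (simp add: history_prob_snoc[OF k])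
  next
    case False
    define t where "t = Re (op_trace (outcome_op l x k))"
    have t: "op_trace (outcome_op l x k) = of_real t"
      unfolding t_def by (rule instrument_trace(2)[OF U \<rho> d E k])
    then have "t \<noteq> 0" using False by simp
    then show ?thesis
      by (simp add: history_prob_snoc[OF k] innovation_def state_after_snoc t field_simps)
  qed
  have inner: "((\<lambda>k. ?f (x, k)) has_sum
      ?p * (of_real (pmf q x) * memory_channel U (\<rho> x) ?s i j - of_real (pmf q x) * ?c)) (K x)" for x
  proof (rule has_sum_finiteI[OF finite_K])
    have "(\<Sum>k\<in>K x. ?f (x, k)) = ?p * of_real (pmf q x) *
        ((\<Sum>k\<in>K x. outcome_op l x k i j) - of_real (\<Sum>k\<in>K x. Re (op_trace (outcome_op l x k))) * ?c)"
      by (simp add: f sum_distrib_left[symmetric] sum_subtractf sum_distrib_right)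
    then show "?p * (of_real (pmf q x) * memory_channel U (\<rho> x) ?s i j - of_real (pmf q x) * ?c) =
        (\<Sum>k\<in>K x. ?f (x, k))"
      by (simp add: instrument_sum[OF U \<rho> d E] instrument_trace_sum[OF U \<rho> d E] algebra_simps)
  qed
  have q: "((\<lambda>x. of_real (pmf q x)) has_sum (1 :: complex)) (set_pmf q)"
    using has_sum_of_real[OF pmf_has_sum[of q "set_pmf q"], where 'a = complex] by simp
  have "((\<lambda>x. of_real (pmf q x) * memory_channel U (\<rho> x) ?s i j) has_sum ?c) (set_pmf q)"
    using memory_channel_average(2)[where q = q and i = i and j = j, OF U \<rho> d]
    by (rule has_sum_cong_neutral[THEN iffD1, rotated -1]) (auto simp: set_pmf_iff)
  from has_sum_add[OF this has_sum_cmult_left[OF q, of "- ?c"]]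
  have "((\<lambda>x. of_real (pmf q x) * memory_channel U (\<rho> x) ?s i j - of_real (pmf q x) * ?c) has_sum 0) (set_pmf q)"
    by simp
  from has_sum_cmult_right[OF this, of ?p]
  have outer: "((\<lambda>x. ?p * (of_real (pmf q x) * memory_channel U (\<rho> x) ?s i j - of_real (pmf q x) * ?c))
      has_sum 0) (set_pmf q)" by simp
  \<comment> \<open>Iterated sums determine the sum over pairs only under summability; here the
    increments are at most 2 and the weights have a finite sum.\<close>
  have "(\<lambda>a. norm (?f a)) summable_on possible"
  proof (rule Infinite_Sum.abs_summable_on_comparison_test')
    show "(\<lambda>a. history_prob Y (l @ [a]) * 2) summable_on possible"
      using history_prob_total[OF l] by (intro summable_on_cmult_left) (simp add: has_sum_iff)
    fix a
    show "norm (?f a) \<le> history_prob Y (l @ [a]) * 2"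
      using innovation_le[of "l @ [a]" i j] history_prob_nonneg[of "l @ [a]"]
      by (cases "history_prob Y (l @ [a]) = 0") (auto simp: norm_mult intro!: mult_left_mono)
  qed
  then have "?f summable_on possible" by (rule Infinite_Sum.abs_summable_summable)
  then show ?thesis
    unfolding possible_def by (intro has_sum_SigmaI[OF inner outer])
qed

lemma AE_innovation_average:
  "AE \<omega> in P. (\<lambda>n. (\<Sum>l<n. innovation i j (history Y (Suc l) \<omega>)) / of_nat n) \<longlonglongrightarrow> 0"
proof -
  have Re: "AE \<omega> in P. (\<lambda>n. (\<Sum>l<n. Re (innovation i j (history Y (Suc l) \<omega>))) / real n) \<longlonglongrightarrow> 0"
  proof (rule history_slln[OF Y countable_possible AE_possible])
    show "\<bar>Re (innovation i j l)\<bar> \<le> 2" if "0 < history_prob Y l" for l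
      using innovation_le[OF that, of i j] abs_Re_le_cmod order_trans by blast
    show "((\<lambda>a. history_prob Y (l @ [a]) * Re (innovation i j (l @ [a]))) has_sum 0) possible" for l
      using has_sum_Re[OF innovation_mean_zero[of l i j]] by simp
  qed
  have Im: "AE \<omega> in P. (\<lambda>n. (\<Sum>l<n. Im (innovation i j (history Y (Suc l) \<omega>))) / real n) \<longlonglongrightarrow> 0"
  proof (rule history_slln[OF Y countable_possible AE_possible])
    show "\<bar>Im (innovation i j l)\<bar> \<le> 2" if "0 < history_prob Y l" for l
      using innovation_le[OF that, of i j] abs_Im_le_cmod order_trans by blast
    show "((\<lambda>a. history_prob Y (l @ [a]) * Im (innovation i j (l @ [a]))) has_sum 0) possible" for l
      using has_sum_Im[OF innovation_mean_zero[of l i j]] by simp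
  qed
  from Re Im show ?thesis
    by eventually_elim (simp add: tendsto_complex_iff Re_divide_of_nat Im_divide_of_nat)
qed

text \<open>A deterministic argument for one run: the averaged innovations tend to 0 and also to
  \<open>\<sigma> i j - mean_channel \<sigma> i j\<close>.\<close>

lemma average_state_fixed_entry:
  assumes dens: "\<And>l. density_op (state_after (history Y l \<omega>))"
    and inn: "(\<lambda>n. (\<Sum>l<n. innovation i j (history Y (Suc l) \<omega>)) / of_nat n) \<longlonglongrightarrow> 0"
    and av: "is_average_state (\<lambda>l. state_after (history Y l \<omega>)) \<sigma>"
  shows "mean_channel \<sigma> i j = \<sigma> i j"
proof -
  define s where "s l = state_after (history Y l \<omega>)" for l
  have C: "(\<lambda>n. (\<Sum>l<n. mean_channel (s l) i j) / of_nat n) \<longlonglongrightarrow> mean_channel \<sigma> i j"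
    by (rule memory_channel_average_tendsto[OF U memory_channel_average(1)[OF U \<rho>]])
       (use dens av in \<open>simp_all add: s_def\<close>)
  have "innovation i j (history Y (Suc l) \<omega>) = s (Suc l) i j - mean_channel (s l) i j" for l
    by (simp add: innovation_def s_def history_Suc)
  then have inn': "(\<lambda>n. (\<Sum>l<n. s (Suc l) i j - mean_channel (s l) i j) / of_nat n) \<longlonglongrightarrow> 0"
    using inn by simp
  \<comment> \<open>The boundary terms by which the sums of the states and of the shifted states
    differ.\<close>
  have bd: "(\<lambda>n. (s n i j - s 0 i j) / of_nat n) \<longlonglongrightarrow> 0"
  proof (rule Lim_null_comparison)
    show "\<forall>\<^sub>F n in sequentially. norm ((s n i j - s 0 i j) / of_nat n) \<le> 2 / real n"
    proof (rule always_eventually, rule allI)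
      fix n
      have "cmod (s n i j - s 0 i j) \<le> 1 + 1"
        by (intro order_trans[OF norm_triangle_ineq4] add_mono density_entry_le)
           (simp_all add: s_def dens)
      then show "norm ((s n i j - s 0 i j) / of_nat n) \<le> 2 / real n"
        by (simp add: norm_divide divide_right_mono)
    qed
  qed (rule lim_const_over_n)
  have "(\<lambda>n. (\<Sum>l<n. s l i j) / of_nat n) \<longlonglongrightarrow> \<sigma> i j"
    using av by (simp add: is_average_state_def s_def)
  from tendsto_diff[OF tendsto_add[OF this bd] C]
  have "(\<lambda>n. (\<Sum>l<n. s l i j) / of_nat n + (s n i j - s 0 i j) / of_nat n -
      (\<Sum>l<n. mean_channel (s l) i j) / of_nat n) \<longlonglongrightarrow> \<sigma> i j - mean_channel \<sigma> i j" by simp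
  moreover have "(\<Sum>l<n. s l i j) / of_nat n + (s n i j - s 0 i j) / of_nat n -
      (\<Sum>l<n. mean_channel (s l) i j) / of_nat n =
      (\<Sum>l<n. s (Suc l) i j - mean_channel (s l) i j) / of_nat n" for n
  proof -
    have "(\<Sum>l<n. s (Suc l) i j) = (\<Sum>l<n. s l i j) + (s n i j - s 0 i j)"
      by (induction n) auto
    then show ?thesis by (simp add: sum_subtractf add_divide_distrib diff_divide_distrib)
  qed
  ultimately have "(\<lambda>n. (\<Sum>l<n. s (Suc l) i j - mean_channel (s l) i j) / of_nat n) \<longlonglongrightarrow>
      \<sigma> i j - mean_channel \<sigma> i j" by simp
  from LIMSEQ_unique[OF this inn'] show ?thesis by simp
qed

end

text \<open>The diagonal already has total 1 on \<open>S\<close>, so it vanishes elsewhere, and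
  positivity then annihilates the corresponding rows and columns.\<close>

lemma density_zero_outside:
  assumes "density_op \<tau>" "((\<lambda>i. Re (\<tau> i i)) has_sum 1) S" "i \<notin> S"
  shows "\<tau> i j = 0" "\<tau> j i = 0"
proof -
  have pos: "positive_op \<tau>" using assms(1) by (simp add: density_op_def)
  have "((\<lambda>i. Re (\<tau> i i)) has_sum (1 - 1)) (UNIV - S)"
    by (rule has_sum_Diff[OF density_diag_has_sum(1)[OF assms(1)] assms(2)]) simp
  then have "Re (\<tau> i i) = 0"
    by (rule nonneg_has_sum_le_0D) (use assms(3) density_diag_has_sum(2)[OF assms(1)] in auto)
  then have z: "\<tau> i i = 0" by (subst positive_diag_of_real[OF pos]) simp
  show "\<tau> i j = 0" "\<tau> j i = 0" by (rule positive_op_zero_row[OF pos z])+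
qed

text \<open>
  The index set of the memory may be uncountable, so the exceptional null sets of all matrix entries
  cannot be united directly.  But only countably many basis vectors ever carry weight, and outside
  of them a density operator of full trace vanishes.
\<close>

lemma density_eq_on_support:
  assumes "density_op \<sigma>" "density_op \<tau>"
    and "\<And>i. i \<notin> S \<Longrightarrow> \<sigma> i i = 0"
    and "\<And>i j. i \<in> S \<Longrightarrow> j \<in> S \<Longrightarrow> \<tau> i j = \<sigma> i j"
  shows "\<tau> = \<sigma>"
proof (intro ext)
  fix i j
  have "((\<lambda>i. Re (\<sigma> i i)) has_sum 1) S"
    using density_diag_has_sum(1)[OF assms(1)]
    by (rule has_sum_cong_neutral[THEN iffD1, rotated -1]) (auto simp: assms(3))
  moreover from this have "((\<lambda>i. Re (\<tau> i i)) has_sum 1) S"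
    by (rule has_sum_cong[THEN iffD1, rotated]) (simp add: assms(4))
  ultimately show "\<tau> i j = \<sigma> i j"
    using density_zero_outside[OF assms(1)] density_zero_outside[OF assms(2)] assms(4)
    by (metis (no_types))
qed

context memory_run
begin

text \<open>The exceptional null set is built from countably many records and matrix entries, before
  \<open>\<sigma>\<close> is chosen; one set therefore serves every candidate for the limit.\<close>

lemma AE_average_state_fixed:
  "AE \<omega> in P. \<forall>\<sigma>. is_average_state (memory_state U \<rho> E \<xi> (\<lambda>n. Y n \<omega>)) \<sigma> \<longrightarrow> mean_channel \<sigma> = \<sigma>"
proof -
  \<comment> \<open>Built from the possible records and not from one run, so that the support
    \<open>S\<close> is countable and the same for every \<open>\<omega>\<close>.\<close>
  define R where "R = {l \<in> lists possible. density_op (state_after l)}"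
  define S where "S = (\<Union>l\<in>R. {i. state_after l i i \<noteq> 0})"
  have "countable R"
    unfolding R_def using countable_lists[OF countable_possible] by (rule countable_subset[rotated]) auto
  then have S: "countable S"
    unfolding S_def by (intro countable_UN) (auto simp: R_def intro: density_countable_support)
  have "AE \<omega> in P. \<forall>i\<in>S. \<forall>j\<in>S.
      (\<lambda>n. (\<Sum>l<n. innovation i j (history Y (Suc l) \<omega>)) / of_nat n) \<longlonglongrightarrow> 0"
    unfolding AE_ball_countable[OF S] using AE_innovation_average by blast
  moreover have "AE \<omega> in P. \<forall>n. 0 < history_prob Y (history Y n \<omega>)"
    by (rule history_prob_pos[OF Y countable_possible AE_possible])
  ultimately show ?thesis
  proof eventually_elim
    case (elim \<omega>)
    have dens: "density_op (state_after (history Y l \<omega>))" for l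
      using elim(2) density_state_after by blast
    have supp: "state_after (history Y l \<omega>) i i = 0" if "i \<notin> S" for i l
      using that dens possible_history elim(2) unfolding S_def R_def by blast
    have st: "memory_state U \<rho> E \<xi> (\<lambda>n. Y n \<omega>) = (\<lambda>l. state_after (history Y l \<omega>))"
      by (rule ext) (rule memory_state_history)
    show ?case
      unfolding st
    proof (intro allI impI)
      fix \<sigma> assume av: "is_average_state (\<lambda>l. state_after (history Y l \<omega>)) \<sigma>"
      then have \<sigma>: "density_op \<sigma>" by (simp add: is_average_state_def)
      show "mean_channel \<sigma> = \<sigma>"
      proof (rule density_eq_on_support[OF \<sigma> density_mean_channel[OF \<sigma>], of S])
        \<comment> \<open>Every state along the run has diagonal entry 0 here, and the limit of the
          averages inherits this.\<close>
        fix i assume "i \<notin> S"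
        have "(\<lambda>n. (\<Sum>l<n. state_after (history Y l \<omega>) i i) / of_nat n) \<longlonglongrightarrow> \<sigma> i i"
          using av by (simp add: is_average_state_def)
        then show "\<sigma> i i = 0" by (simp add: supp[OF \<open>i \<notin> S\<close>] LIMSEQ_const_iff)
      next
        fix i j assume "i \<in> S" "j \<in> S"
        then show "mean_channel \<sigma> i j = \<sigma> i j"
          using elim(1) by (intro average_state_fixed_entry[OF dens _ av]) blast
      qed
    qed
  qed
qed

end

theorem theorem3:
  fixes P :: "'w measure"
    and Y :: "nat \<Rightarrow> 'w \<Rightarrow> 'x \<times> 'k"
    and U :: "('h \<times> 'm, 'm \<times> 'h) opmat"
    and \<xi> :: "('m, 'm) opmat"
    and q :: "'x pmf"
    and \<rho> :: "'x \<Rightarrow> ('h, 'h) opmat"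
    and K :: "'x \<Rightarrow> 'k set"
    and E :: "'x \<Rightarrow> 'k \<Rightarrow> ('h, 'h) opmat"
  assumes "unitary_op U"
    and "density_op \<xi>"
    and "\<And>x. density_op (\<rho> x)"
    and "\<And>x. povm (K x) (E x)"
    and "memory_experiment P Y U \<xi> q \<rho> K E"
  shows "AE \<omega> in P. \<forall>\<xi>\<^sub>a\<^sub>v.
    is_average_state (memory_state U \<rho> E \<xi> (\<lambda>n. Y n \<omega>)) \<xi>\<^sub>a\<^sub>v \<longrightarrow>
    memory_channel U (average_test_state q \<rho>) \<xi>\<^sub>a\<^sub>v = \<xi>\<^sub>a\<^sub>v"
proof -
  have "prob_space P" using assms(5) by (simp add: memory_experiment_def)
  then interpret memory_run P Y U \<xi> q \<rho> K E
    using assms by (intro memory_run.intro memory_run_axioms.intro)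
  show ?thesis by (rule AE_average_state_fixed)
qed

end
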